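(* Let $X=V(f)\subseteq\mathbb{P}^n$ be a general smooth hypersurface of degree $d$ over $\mathbb{C}$. If either $d=3$ and $n\geq5$, or $d\geq4$ and $n\geq3$, then the hyperplane-section map $$\Phi(f):\mathbb{P}^{n*}\dashrightarrow\mathcal{M}(d,n-1)$$ is generically finite onto its image.
   Context: "General" means: for all $[f]$ in some nonempty Zariski open subset of $\mathbb{P}(\mathbb{C}[x_0,\ldots,x_n]_d)$ (depending on $n$ and $d$) consisting of smooth hypersurfaces. $\mathcal{M}(d,n-1)$ is the coarse moduli space of smooth degree $d$ hypersurfaces in $\mathbb{P}^{n-1}$, i.e. the geometric (GIT) quotient by $PGL_n(\mathbb{C})$ of the open subset of $\mathbb{P}(\mathbb{C}[x_1,\ldots,x_n]_d)$ parametrizing smooth hypersurfaces. $U_f=\{H\in\mathbb{P}^{n*}\mid X\cap H\text{ is smooth}\}$ is nonempty and Zariski open, and $\Phi(f)$ is the rational map given on $U_f$ by $H\mapsto[X\cap H]$, where $X\cap H\subseteq H\simeq\mathbb{P}^{n-1}$. It is generically finite onto its image if the general fiber of $\mathbb{P}^{n*}\dashrightarrow\operatorname{Im}\Phi(f)$ is finite, equivalently $\dim\operatorname{Im}\Phi(f)=n$. *)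

theory Defs
  imports "HOL-Analysis.Analysis" "HOL-Library.Poly_Mapping"
begin

section \<open>Polynomials in several variables over the complex numbers\<close>

text \<open>A polynomial is the finitely supported map from monomials (themselves finitely supported
  exponent maps) to coefficients, with the convolution product of \<^theory>\<open>HOL-Library.Poly_Mapping\<close>.\<close>

type_synonym 'v mpoly = "('v \<Rightarrow>\<^sub>0 nat) \<Rightarrow>\<^sub>0 complex"

definition mdeg :: "('v \<Rightarrow>\<^sub>0 nat) \<Rightarrow> nat"
  where "mdeg m = (\<Sum>i\<in>Poly_Mapping.keys m. Poly_Mapping.lookup m i)"

definition monomials :: "'v set \<Rightarrow> nat \<Rightarrow> ('v \<Rightarrow>\<^sub>0 nat) set"
  where "monomials I d = {m. Poly_Mapping.keys m \<subseteq> I \<and> mdeg m = d}"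

definition forms :: "'v set \<Rightarrow> nat \<Rightarrow> 'v mpoly set"
  where "forms I d = {f. Poly_Mapping.keys f \<subseteq> monomials I d}"

definition eval_with :: "(complex \<Rightarrow> 'b::comm_semiring_1) \<Rightarrow> ('v \<Rightarrow> 'b) \<Rightarrow> 'v mpoly \<Rightarrow> 'b"
  where "eval_with h \<phi> f =
    (\<Sum>m\<in>Poly_Mapping.keys f. h (Poly_Mapping.lookup f m) *
       (\<Prod>i\<in>Poly_Mapping.keys m. \<phi> i ^ Poly_Mapping.lookup m i))"

definition meval :: "('v \<Rightarrow> complex) \<Rightarrow> 'v mpoly \<Rightarrow> complex"
  where "meval = eval_with (\<lambda>c. c)"

definition msubst :: "('v \<Rightarrow> 'w mpoly) \<Rightarrow> 'v mpoly \<Rightarrow> 'w mpoly"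
  where "msubst = eval_with (Poly_Mapping.single 0)"

definition mvar :: "'v \<Rightarrow> 'v mpoly"
  where "mvar i = Poly_Mapping.single (Poly_Mapping.single i 1) 1"

definition mpartial :: "'v \<Rightarrow> 'v mpoly \<Rightarrow> 'v mpoly"
  where "mpartial i f =
    (\<Sum>m\<in>Poly_Mapping.keys f. Poly_Mapping.single (m - Poly_Mapping.single i 1)
       (of_nat (Poly_Mapping.lookup m i) * Poly_Mapping.lookup f m))"

lemma eval_with_superset:
  assumes "finite K" "Poly_Mapping.keys f \<subseteq> K" "h 0 = 0"
  shows "eval_with h \<phi> f = (\<Sum>m\<in>K. h (Poly_Mapping.lookup f m) *
       (\<Prod>i\<in>Poly_Mapping.keys m. \<phi> i ^ Poly_Mapping.lookup m i))"
  unfolding eval_with_def using assms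
  by (intro sum.mono_neutral_left) (auto simp: in_keys_iff)

lemma monomial_eval_superset:
  assumes "finite K" "Poly_Mapping.keys m \<subseteq> K"
  shows "(\<Prod>i\<in>Poly_Mapping.keys m. (\<phi> i :: 'b::comm_semiring_1) ^ Poly_Mapping.lookup m i)
       = (\<Prod>i\<in>K. \<phi> i ^ Poly_Mapping.lookup m i)"
  using assms by (intro prod.mono_neutral_left) (auto simp: in_keys_iff)

lemma monomial_eval_add:
  "(\<Prod>i\<in>Poly_Mapping.keys (m + m'). (\<phi> i :: 'b::comm_semiring_1) ^ Poly_Mapping.lookup (m + m') i)
   = (\<Prod>i\<in>Poly_Mapping.keys m. \<phi> i ^ Poly_Mapping.lookup m i) *
     (\<Prod>i\<in>Poly_Mapping.keys m'. \<phi> i ^ Poly_Mapping.lookup m' i)"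
proof -
  let ?K = "Poly_Mapping.keys m \<union> Poly_Mapping.keys m'"
  have *: "Poly_Mapping.keys (m + m') \<subseteq> ?K" by (rule Poly_Mapping.keys_add)
  show ?thesis
    by (subst (1 2 3) monomial_eval_superset[where K = ?K])
       (use * in \<open>auto simp: lookup_add power_add prod.distrib\<close>)
qed

lemma eval_with_add:
  assumes "h 0 = 0" "\<And>a b. h (a + b) = h a + h b"
  shows "eval_with h \<phi> (f + g) = eval_with h \<phi> f + eval_with h \<phi> g"
proof -
  let ?K = "Poly_Mapping.keys f \<union> Poly_Mapping.keys g"
  have *: "Poly_Mapping.keys (f + g) \<subseteq> ?K" by (rule Poly_Mapping.keys_add)
  show ?thesis
    by (subst (1 2 3) eval_with_superset[where K = ?K])
       (use * assms in \<open>auto simp: lookup_add distrib_right sum.distrib\<close>)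
qed

lemma eval_with_single:
  assumes "h 0 = 0"
  shows "eval_with h \<phi> (Poly_Mapping.single m c) =
     h c * (\<Prod>i\<in>Poly_Mapping.keys m. \<phi> i ^ Poly_Mapping.lookup m i)"
  by (subst eval_with_superset[where K = "{m}"]) (use assms in auto)

lemma mpoly_single_add_induct [case_names zero single add]:
  fixes f :: "'k \<Rightarrow>\<^sub>0 'b::comm_monoid_add"
  assumes "P 0" "\<And>m c. P (Poly_Mapping.single m c)"
    and "\<And>f g. P f \<Longrightarrow> P g \<Longrightarrow> P (f + g)"
  shows "P f"
proof (induction f rule: update_induct)
  case const
  then show ?case using assms(1) by simp
next
  case (update f a b)
  have "Poly_Mapping.update a b f = f + Poly_Mapping.single a b"
    using update(1) by (intro poly_mapping_eqI) (auto simp: lookup_update lookup_add lookup_single in_keys_iff when_def)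
  then show ?case using update assms by metis
qed

lemma eval_with_mult:
  assumes h: "h 0 = 0" "\<And>a b. h (a + b) = h a + h b" "\<And>a b. h (a * b) = h a * h b"
  shows "eval_with h \<phi> (f * g) = eval_with h \<phi> f * eval_with h \<phi> g"
proof (induction f rule: mpoly_single_add_induct)
  case zero
  then show ?case by (simp add: eval_with_def)
next
  case (single m c)
  show ?case
  proof (induction g rule: mpoly_single_add_induct)
    case zero
    then show ?case by (simp add: eval_with_def)
  next
    case (single m' c')
    then show ?case
      by (simp add: mult_single eval_with_single[of h, OF h(1)] h(3) monomial_eval_add mult_ac)
  next
    case (add f g)
    then show ?case by (simp add: distrib_left eval_with_add[of h, OF h(1,2)])
  qed
next
  case (add f g)
  then show ?case by (simp add: distrib_right eval_with_add[of h, OF h(1,2)])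
qed

lemma meval_mult: "meval x (f * g) = meval x f * meval x g"
  unfolding meval_def by (rule eval_with_mult) auto

lemma mdeg_superset:
  assumes "finite K" "Poly_Mapping.keys m \<subseteq> K"
  shows "mdeg m = (\<Sum>i\<in>K. Poly_Mapping.lookup m i)"
  unfolding mdeg_def using assms by (intro sum.mono_neutral_left) (auto simp: in_keys_iff)

lemma mdeg_add: "mdeg (m + m') = mdeg m + mdeg m'"
proof -
  let ?K = "Poly_Mapping.keys m \<union> Poly_Mapping.keys m'"
  have *: "Poly_Mapping.keys (m + m') \<subseteq> ?K" by (rule Poly_Mapping.keys_add)
  show ?thesis
    by (subst (1 2 3) mdeg_superset[where K = ?K])
       (use * in \<open>auto simp: lookup_add sum.distrib\<close>)
qed

lemma forms_mult:
  assumes "f \<in> forms I d" "g \<in> forms I e"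
  shows "f * g \<in> forms I (d + e)"
proof -
  have "m + m' \<in> monomials I (d + e)" if "m \<in> monomials I d" "m' \<in> monomials I e" for m m'
    using that Poly_Mapping.keys_add[of m m'] by (auto simp: monomials_def mdeg_add)
  then show ?thesis
    using assms keys_mult[of f g] unfolding forms_def by blast
qed

lemma meval_scale:
  assumes "f \<in> forms I d"
  shows "meval (\<lambda>i. c * x i) f = c ^ d * meval x f"
proof -
  have "meval (\<lambda>i. c * x i) f = (\<Sum>m\<in>Poly_Mapping.keys f. c ^ d * (Poly_Mapping.lookup f m *
       (\<Prod>i\<in>Poly_Mapping.keys m. x i ^ Poly_Mapping.lookup m i)))"
    unfolding meval_def eval_with_def
  proof (rule sum.cong[OF refl])
    fix m assume "m \<in> Poly_Mapping.keys f"
    then have "mdeg m = d" using assms by (auto simp: forms_def monomials_def)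
    then have "(\<Prod>i\<in>Poly_Mapping.keys m. c ^ Poly_Mapping.lookup m i) = c ^ d"
      by (simp add: mdeg_def flip: power_sum)
    then show "Poly_Mapping.lookup f m * (\<Prod>i\<in>Poly_Mapping.keys m. (c * x i) ^ Poly_Mapping.lookup m i)
       = c ^ d * (Poly_Mapping.lookup f m * (\<Prod>i\<in>Poly_Mapping.keys m. x i ^ Poly_Mapping.lookup m i))"
      by (simp add: power_mult_distrib prod.distrib)
  qed
  then show ?thesis by (simp add: meval_def eval_with_def sum_distrib_left)
qed

section \<open>Projective space and its Zariski topology\<close>

text \<open>Coordinates are indexed by an arbitrary set \<open>I\<close>: \<open>cvec I\<close> is the coordinate space with
  coordinates in \<open>I\<close>, and a point of \<open>proj_space I\<close> is a line through the origin of it (a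
  one-dimensional subspace). Taking \<open>I = {..n}\<close> gives \<open>n\<close>-dimensional projective space;
  \<open>I = monomials {..n} d\<close> gives the projective space of degree \<open>d\<close> forms, the coordinates
  of a form being its coefficients.\<close>

definition cvec :: "'v set \<Rightarrow> ('v \<Rightarrow> complex) set"
  where "cvec I = {x. \<forall>i. i \<notin> I \<longrightarrow> x i = 0}"

definition pline :: "('v \<Rightarrow> complex) \<Rightarrow> ('v \<Rightarrow> complex) set"
  where "pline x = range (\<lambda>c i. c * x i)"

definition proj_space :: "'v set \<Rightarrow> ('v \<Rightarrow> complex) set set"
  where "proj_space I = pline ` (cvec I - {\<lambda>_. 0})"

definition zero_locus :: "'v set \<Rightarrow> 'v mpoly set \<Rightarrow> ('v \<Rightarrow> complex) set set"
  where "zero_locus I S = {p \<in> proj_space I. \<forall>F\<in>S. \<forall>x\<in>p. meval x F = 0}"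

definition zariski_open :: "'v set \<Rightarrow> ('v \<Rightarrow> complex) set set \<Rightarrow> bool"
  where "zariski_open I U \<longleftrightarrow>
    (\<exists>S. S \<subseteq> (\<Union>e. forms I e) \<and> U = proj_space I - zero_locus I S)"

definition zariski :: "'v set \<Rightarrow> ('v \<Rightarrow> complex) set topology"
  where "zariski I = topology (zariski_open I)"

lemma zero_locus_Int:
  assumes S: "S \<subseteq> (\<Union>e. forms I e)" and T: "T \<subseteq> (\<Union>e. forms I e)"
  shows "zero_locus I S \<union> zero_locus I T = zero_locus I {F * G | F G. F \<in> S \<and> G \<in> T}"
proof (intro subset_antisym subsetI)
  fix p assume "p \<in> zero_locus I S \<union> zero_locus I T"
  then show "p \<in> zero_locus I {F * G | F G. F \<in> S \<and> G \<in> T}"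
    by (auto simp: zero_locus_def meval_mult)
next
  fix p assume p: "p \<in> zero_locus I {F * G | F G. F \<in> S \<and> G \<in> T}"
  then obtain u where u: "p = pline u" and pI: "p \<in> proj_space I"
    by (auto simp: zero_locus_def proj_space_def)
  show "p \<in> zero_locus I S \<union> zero_locus I T"
  proof (rule ccontr)
    assume "\<not> ?thesis"
    then obtain F G x y where *: "F \<in> S" "x \<in> p" "meval x F \<noteq> 0" "G \<in> T" "y \<in> p" "meval y G \<noteq> 0"
      using pI by (auto simp: zero_locus_def)
    obtain d e where "F \<in> forms I d" "G \<in> forms I e" using * S T by blast
    moreover obtain a b where "x = (\<lambda>i. a * u i)" "y = (\<lambda>i. b * u i)"
      using * by (auto simp: u pline_def)
    ultimately have "meval u F \<noteq> 0" "meval u G \<noteq> 0" using * by (auto simp: meval_scale)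
    then have "meval u (F * G) \<noteq> 0" by (simp add: meval_mult)
    moreover have "u \<in> p" unfolding u pline_def by (rule image_eqI[where x = 1]) auto
    ultimately show False using p * by (auto simp: zero_locus_def)
  qed
qed

lemma istopology_zariski: "istopology (zariski_open I)"
  unfolding istopology_def
proof (intro conjI allI impI)
  fix U V assume "zariski_open I U" "zariski_open I V"
  then obtain S T where S: "S \<subseteq> (\<Union>e. forms I e)" "U = proj_space I - zero_locus I S"
    and T: "T \<subseteq> (\<Union>e. forms I e)" "V = proj_space I - zero_locus I T"
    by (auto simp: zariski_open_def)
  have "U \<inter> V = proj_space I - zero_locus I {F * G | F G. F \<in> S \<and> G \<in> T}"
    using zero_locus_Int[OF S(1) T(1)] S(2) T(2) by blast
  moreover have "{F * G | F G. F \<in> S \<and> G \<in> T} \<subseteq> (\<Union>e. forms I e)"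
    using S(1) T(1) forms_mult by fastforce
  ultimately show "zariski_open I (U \<inter> V)" unfolding zariski_open_def by blast
next
  fix \<K> assume "\<forall>K\<in>\<K>. zariski_open I K"
  then obtain S where S: "\<And>K. K \<in> \<K> \<Longrightarrow> S K \<subseteq> (\<Union>e. forms I e)"
      "\<And>K. K \<in> \<K> \<Longrightarrow> proj_space I - zero_locus I (S K) = K"
    unfolding zariski_open_def by metis
  have "\<Union>\<K> = (\<Union>K\<in>\<K>. proj_space I - zero_locus I (S K))" using S(2) by auto
  also have "\<dots> = proj_space I - zero_locus I (\<Union>K\<in>\<K>. S K)"
    by (auto simp: zero_locus_def)
  finally have "\<Union>\<K> = proj_space I - zero_locus I (\<Union>K\<in>\<K>. S K)" .
  moreover have "(\<Union>K\<in>\<K>. S K) \<subseteq> (\<Union>e. forms I e)" using S(1) by (intro UN_least)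
  ultimately show "zariski_open I (\<Union>\<K>)" unfolding zariski_open_def by (intro exI conjI)
qed

lemma openin_zariski: "openin (zariski I) U \<longleftrightarrow> zariski_open I U"
  by (simp add: zariski_def istopology_zariski)

lemma topspace_zariski: "topspace (zariski I) = proj_space I"
proof -
  have "zero_locus I {1} = {}"
  proof -
    have "meval x 1 = 1" for x :: "'a \<Rightarrow> complex"
      using eval_with_single[of "\<lambda>c. c" x 0 1] by (simp add: meval_def)
    moreover have "p \<noteq> {}" if "p \<in> proj_space I" for p
      using that by (auto simp: proj_space_def pline_def)
    ultimately show ?thesis by (auto simp: zero_locus_def)
  qed
  moreover have "{1} \<subseteq> (\<Union>e. forms I e)"
    by (auto intro!: exI[of _ 0] simp: forms_def monomials_def mdeg_def)
  ultimately have "zariski_open I (proj_space I)"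
    unfolding zariski_open_def by (metis Diff_empty)
  then show ?thesis
    by (auto simp: topspace_def openin_zariski zariski_open_def)
qed

section \<open>Smooth hypersurfaces and their moduli\<close>

definition smooth_forms :: "'v set \<Rightarrow> nat \<Rightarrow> 'v mpoly set"
  where "smooth_forms I d = {f \<in> forms I d. f \<noteq> 0 \<and>
    (\<forall>x\<in>cvec I. x \<noteq> (\<lambda>_. 0) \<and> meval x f = 0 \<longrightarrow> (\<exists>i\<in>I. meval x (mpartial i f) \<noteq> 0))}"

definition form_point :: "'v mpoly \<Rightarrow> (('v \<Rightarrow>\<^sub>0 nat) \<Rightarrow> complex) set"
  where "form_point f = pline (Poly_Mapping.lookup f)"

definition smooth_locus :: "'v set \<Rightarrow> nat \<Rightarrow> (('v \<Rightarrow>\<^sub>0 nat) \<Rightarrow> complex) set set"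
  where "smooth_locus I d = form_point ` smooth_forms I d"

text \<open>A matrix \<open>A\<close> with columns indexed by \<open>J\<close> gives the linear map \<open>lin_map J A\<close> on \<open>cvec J\<close>
  and the pullback \<open>lin_pullback J A\<close> of forms along it.\<close>

definition lin_map :: "'w set \<Rightarrow> ('v \<Rightarrow> 'w \<Rightarrow> complex) \<Rightarrow> ('w \<Rightarrow> complex) \<Rightarrow> ('v \<Rightarrow> complex)"
  where "lin_map J A y = (\<lambda>i. \<Sum>j\<in>J. A i j * y j)"

definition lin_pullback :: "'w set \<Rightarrow> ('v \<Rightarrow> 'w \<Rightarrow> complex) \<Rightarrow> 'v mpoly \<Rightarrow> 'w mpoly"
  where "lin_pullback J A = msubst (\<lambda>i. \<Sum>j\<in>J. Poly_Mapping.single 0 (A i j) * mvar j)"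

definition GL :: "'v set \<Rightarrow> ('v \<Rightarrow> 'v \<Rightarrow> complex) set"
  where "GL I = {A. bij_betw (lin_map I A) (cvec I) (cvec I)}"

text \<open>Scalar matrices act trivially on the points \<open>form_point f\<close>, so orbits under \<open>GL\<close> are the
  orbits under \<open>PGL\<close>.\<close>

definition pgl_orbit :: "'v set \<Rightarrow> (('v \<Rightarrow>\<^sub>0 nat) \<Rightarrow> complex) set \<Rightarrow> (('v \<Rightarrow>\<^sub>0 nat) \<Rightarrow> complex) set set"
  where "pgl_orbit I p = {form_point (lin_pullback I A f) | A f. A \<in> GL I \<and> form_point f = p}"

definition quotient_top :: "'a topology \<Rightarrow> ('a \<Rightarrow> 'b) \<Rightarrow> 'b topology"
  where "quotient_top X q =
    topology (\<lambda>V. V \<subseteq> q ` topspace X \<and> openin X {x \<in> topspace X. q x \<in> V})"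

lemma istopology_quotient_top:
  "istopology (\<lambda>V. V \<subseteq> q ` topspace X \<and> openin X {x \<in> topspace X. q x \<in> V})"
  unfolding istopology_def
proof (intro conjI allI impI)
  fix S T
  assume "S \<subseteq> q ` topspace X \<and> openin X {x \<in> topspace X. q x \<in> S}"
    and "T \<subseteq> q ` topspace X \<and> openin X {x \<in> topspace X. q x \<in> T}"
  moreover have "{x \<in> topspace X. q x \<in> S \<inter> T} =
      {x \<in> topspace X. q x \<in> S} \<inter> {x \<in> topspace X. q x \<in> T}" by auto
  ultimately show "S \<inter> T \<subseteq> q ` topspace X" "openin X {x \<in> topspace X. q x \<in> S \<inter> T}"
    by (auto intro: openin_Int)
next
  fix \<K>
  assume *: "\<forall>K\<in>\<K>. K \<subseteq> q ` topspace X \<and> openin X {x \<in> topspace X. q x \<in> K}"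
  have "{x \<in> topspace X. q x \<in> \<Union>\<K>} = (\<Union>K\<in>\<K>. {x \<in> topspace X. q x \<in> K})" by auto
  then show "\<Union>\<K> \<subseteq> q ` topspace X" "openin X {x \<in> topspace X. q x \<in> \<Union>\<K>}"
    using * by auto
qed

lemma openin_quotient_top:
  "openin (quotient_top X q) V \<longleftrightarrow> V \<subseteq> q ` topspace X \<and> openin X {x \<in> topspace X. q x \<in> V}"
  by (simp add: quotient_top_def istopology_quotient_top)

lemma topspace_quotient_top: "topspace (quotient_top X q) = q ` topspace X"
proof -
  have "{x \<in> topspace X. q x \<in> q ` topspace X} = topspace X" by auto
  then show ?thesis by (auto simp: topspace_def[of "quotient_top X q"] openin_quotient_top)
qed

lemma quotient_map_quotient_top: "quotient_map X (quotient_top X q) q"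
  by (auto simp: quotient_map_def topspace_quotient_top openin_quotient_top)

text \<open>The geometric quotient of the locus of smooth hypersurfaces by the projective linear group:
  its points are the orbits, and its Zariski topology is the quotient topology (both by definition
  of a geometric quotient). The structure sheaf is not recorded, since generic finiteness involves
  only points and the topology.\<close>

definition moduli :: "'v set \<Rightarrow> nat \<Rightarrow> (('v \<Rightarrow>\<^sub>0 nat) \<Rightarrow> complex) set set topology"
  where "moduli I d =
    quotient_top (subtopology (zariski (monomials I d)) (smooth_locus I d)) (pgl_orbit I)"

section \<open>The hyperplane-section map\<close>

text \<open>Homogeneous coordinates are \<open>x\<^sub>0, \<dots>, x\<^sub>n\<close> (indices \<open>{..n}\<close>) on the ambient space and
  \<open>x\<^sub>1, \<dots>, x\<^sub>n\<close> (indices \<open>{1..n}\<close>) on projective space of one dimension less. A point \<open>H\<close> of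
  the dual projective space is the line spanned by the coefficient vector of a linear form.\<close>

definition hyperplane :: "nat \<Rightarrow> (nat \<Rightarrow> complex) set \<Rightarrow> (nat \<Rightarrow> complex) set"
  where "hyperplane n H = {x \<in> cvec {..n}. \<forall>a\<in>H. (\<Sum>i\<le>n. a i * x i) = 0}"

text \<open>A chosen linear isomorphism from \<open>cvec {1..n}\<close> onto the hyperplane. Two such choices differ
  by an element of \<open>GL {1..n}\<close>, so neither smoothness nor the \<open>PGL\<close> orbit of the section below
  depends on the choice.\<close>

definition hyperplane_chart :: "nat \<Rightarrow> (nat \<Rightarrow> complex) set \<Rightarrow> nat \<Rightarrow> nat \<Rightarrow> complex"
  where "hyperplane_chart n H =
    (SOME A. bij_betw (lin_map {1..n} A) (cvec {1..n}) (hyperplane n H))"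

definition hyperplane_section :: "nat \<Rightarrow> nat mpoly \<Rightarrow> (nat \<Rightarrow> complex) set \<Rightarrow> nat mpoly"
  where "hyperplane_section n f H = lin_pullback {1..n} (hyperplane_chart n H) f"

definition smooth_sections :: "nat \<Rightarrow> nat \<Rightarrow> nat mpoly \<Rightarrow> (nat \<Rightarrow> complex) set set"
  where "smooth_sections n d f =
    {H \<in> proj_space {..n}. hyperplane_section n f H \<in> smooth_forms {1..n} d}"

definition hyperplane_section_map ::
    "nat \<Rightarrow> nat mpoly \<Rightarrow> (nat \<Rightarrow> complex) set \<Rightarrow> ((nat \<Rightarrow>\<^sub>0 nat) \<Rightarrow> complex) set set"
  where "hyperplane_section_map n f H = pgl_orbit {1..n} (form_point (hyperplane_section n f H))"

text \<open>The rational map given by \<open>\<phi>\<close> on \<open>U\<close> has finite general fibre over its image: the fibres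
  over a nonempty open subset of the image are finite. The intended domains \<open>U\<close> are irreducible,
  so that nonempty open subsets of the image are dense.\<close>

definition generically_finite_onto_image :: "'a set \<Rightarrow> 'b topology \<Rightarrow> ('a \<Rightarrow> 'b) \<Rightarrow> bool"
  where "generically_finite_onto_image U Y \<phi> \<longleftrightarrow>
    (\<exists>V. openin (subtopology Y (\<phi> ` U)) V \<and> V \<noteq> {} \<and> (\<forall>y\<in>V. finite {H \<in> U. \<phi> H = y}))"

end

theory Submission
  imports Defs "HOL-Computational_Algebra.Polynomial"
begin

text \<open>Sections by hyperplanes are the forms \<open>f \<circ> M\<close> for injective \<open>(n + 1) \<times> n\<close> matrices \<open>M\<close>, taken
  modulo \<open>GL\<^sub>n\<close>, so it suffices that the polynomial map \<open>M \<mapsto> f \<circ> M\<close> has finite fibres over a nonempty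
  open part of its image. Its differential at the inclusion of \<open>x\<^sub>0 = 0\<close> sends linear forms
  \<open>l\<^sub>0, \<dots>, l\<^sub>n\<close> to the sum of the \<open>l\<^sub>i \<partial>\<^sub>i f\<close> restricted to \<open>x\<^sub>0 = 0\<close>; it is injective for
  one \<open>f\<close>, the Fermat form plus \<open>x\<^sub>0 q\<close> for a suitable \<open>q\<close>, hence for general \<open>f\<close>. Then as many
  values of \<open>f \<circ> M\<close> at points as there are matrix entries are algebraically independent, and every
  entry of \<open>M\<close> is algebraic over them; the fibres are finite wherever the coefficients of these
  algebraic relations do not all vanish.\<close>

text \<open>The matrices have \<open>n * (n + 1) = n + n ^ 2\<close> parameters, \<open>n\<close>
  for the hyperplane and \<open>n ^ 2\<close> for its coordinates, so injectivity of the
  differential controls the variation of the section and its reparametrisations together. This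
  removes the group from the fibre count. If several sections lie in the orbit of \<open>g\<close>,
  their hyperplanes can be parametrised so that all the pulled back forms equal one fixed translate
  of \<open>g\<close>, the projective scalar being absorbed by a \<open>d\<close>-th root. Thus a
  fibre over an orbit is covered by a single fibre of the map on matrices, and each hyperplane is
  recovered as the image of its matrix. The moduli space carries only a quotient topology, so an
  open set in it has to come from a \<open>GL\<close>-stable open condition on forms; this is why
  the algebraic relation is tested on all \<open>GL\<close>-translates of the evaluation points.
  Each generic condition is encoded by a homogeneous polynomial in coefficients or matrix entries
  together with one point where it does not vanish. The points differ from condition to condition;
  restricting to a line shows that the conditions can be met simultaneously.\<close>

abbreviation (input) "lookup \<equiv> Poly_Mapping.lookup"
abbreviation (input) "keys \<equiv> Poly_Mapping.keys"
abbreviation (input) "single \<equiv> Poly_Mapping.single"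

section \<open>Evaluation of polynomials and forms\<close>

text \<open>The values lie in any commutative semiring: \<open>mpow x m\<close> is a number for
  numerical \<open>x\<close>, while \<open>mpow \<psi> \<beta>\<close> below is a product of
  polynomials.\<close>

definition mpow :: "('v \<Rightarrow> 'b::comm_semiring_1) \<Rightarrow> ('v \<Rightarrow>\<^sub>0 nat) \<Rightarrow> 'b"
  where "mpow x m = (\<Prod>i\<in>keys m. x i ^ lookup m i)"

lemma mpow_superset:
  assumes "finite K" "keys m \<subseteq> K"
  shows "mpow x m = (\<Prod>i\<in>K. x i ^ lookup m i)"
  unfolding mpow_def by (rule monomial_eval_superset[OF assms])

lemma mpow_add: "mpow x (m + m') = mpow x m * mpow x m'"
  unfolding mpow_def by (rule monomial_eval_add)

lemma mpow_zero [simp]: "mpow x 0 = 1"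
  by (simp add: mpow_def)

lemma mpow_single [simp]: "mpow x (single i k) = x i ^ k"
  by (simp add: mpow_def)

lemma mpow_cong: "(\<And>i. i \<in> keys m \<Longrightarrow> x i = y i) \<Longrightarrow> mpow x m = mpow y m"
  unfolding mpow_def by (rule prod.cong) auto

lemma meval_eq: "meval x f = (\<Sum>m\<in>keys f. lookup f m * mpow x m)"
  by (simp add: meval_def eval_with_def mpow_def)

lemma meval_superset:
  assumes "finite K" "keys f \<subseteq> K"
  shows "meval x f = (\<Sum>m\<in>K. lookup f m * mpow x m)"
  using eval_with_superset[OF assms, of "\<lambda>c. c" x] by (simp add: meval_def mpow_def)

lemma meval_add [simp]: "meval x (f + g) = meval x f + meval x g"
  unfolding meval_def by (rule eval_with_add) auto

lemma meval_zero [simp]: "meval x 0 = 0"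
  by (simp add: meval_eq)

lemma meval_single [simp]: "meval x (single m c) = c * mpow x m"
  unfolding meval_def mpow_def by (rule eval_with_single) simp

lemma meval_one [simp]: "meval x 1 = 1"
  using meval_single[of x 0 1] by simp

lemma meval_uminus [simp]: "meval x (- f) = - meval x f"
  using meval_add[of x f "- f"] by (simp add: add_eq_0_iff)

lemma meval_diff [simp]: "meval x (f - g) = meval x f - meval x g"
  using meval_add[of x f "- g"] by simp

declare meval_mult [simp]

lemma meval_sum [simp]: "meval x (\<Sum>a\<in>A. f a) = (\<Sum>a\<in>A. meval x (f a))"
  by (induction A rule: infinite_finite_induct) auto

lemma meval_prod [simp]: "meval x (\<Prod>a\<in>A. f a) = (\<Prod>a\<in>A. meval x (f a))"
  by (induction A rule: infinite_finite_induct) auto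

lemma meval_power [simp]: "meval x (f ^ k) = meval x f ^ k"
  by (induction k) auto

lemma meval_mvar [simp]: "meval x (mvar i) = x i"
  by (simp add: mvar_def)

text \<open>Evaluation uses only finite sums, products and powers. The two instances needed are
  evaluation after a substitution and restriction to a curve with polynomial coordinates.\<close>

lemma eval_with_hom:
  fixes \<theta> :: "'b::comm_semiring_1 \<Rightarrow> 'c::comm_semiring_1"
  assumes "\<theta> 0 = 0" "\<theta> 1 = 1" "\<And>a b. \<theta> (a + b) = \<theta> a + \<theta> b" "\<And>a b. \<theta> (a * b) = \<theta> a * \<theta> b"
  shows "\<theta> (eval_with h \<phi> f) = eval_with (\<lambda>c. \<theta> (h c)) (\<lambda>i. \<theta> (\<phi> i)) f"
proof -
  have s: "\<theta> (sum u A) = (\<Sum>a\<in>A. \<theta> (u a))" for u and A :: "('d \<Rightarrow>\<^sub>0 nat) set"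
    by (induction A rule: infinite_finite_induct) (auto simp: assms)
  have p: "\<theta> (prod u A) = (\<Prod>a\<in>A. \<theta> (u a))" for u and A :: "'d set"
    by (induction A rule: infinite_finite_induct) (auto simp: assms)
  have e: "\<theta> (u ^ k) = \<theta> u ^ k" for u k
    by (induction k) (auto simp: assms)
  show ?thesis unfolding eval_with_def by (simp add: s p e assms)
qed

lemma meval_msubst: "meval x (msubst \<sigma> f) = meval (\<lambda>i. meval x (\<sigma> i)) f"
proof -
  have "meval x (msubst \<sigma> f) = eval_with (\<lambda>c. meval x (single 0 c)) (\<lambda>i. meval x (\<sigma> i)) f"
    unfolding msubst_def by (rule eval_with_hom) auto
  then show ?thesis by (simp only: meval_single mpow_zero mult_1_right) (simp add: meval_def)
qed

lemma poly_eval_with: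
  "poly (eval_with (\<lambda>a. [:a:]) \<phi> F) t = meval (\<lambda>i. poly (\<phi> i) t) F"
proof -
  have "poly (eval_with (\<lambda>a. [:a:]) \<phi> F) t = eval_with (\<lambda>c. poly [:c:] t) (\<lambda>i. poly (\<phi> i) t) F"
    by (rule eval_with_hom[where \<theta> = "\<lambda>p. poly p t"]) auto
  then show ?thesis by (simp add: meval_def)
qed

section \<open>Monomials and forms of a fixed degree\<close>

lemma finite_monomials:
  assumes "finite I"
  shows "finite (monomials I d)"
proof -
  have "lookup m \<in> {f. \<forall>i. (i \<in> I \<longrightarrow> f i \<in> {..d}) \<and> (i \<notin> I \<longrightarrow> f i = 0)}" if "m \<in> monomials I d" for m
  proof -
    have "lookup m i \<le> d" if "i \<in> I" for i
      using that \<open>m \<in> monomials I d\<close> assms member_le_sum[of i I "lookup m"]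
      by (auto simp: monomials_def mdeg_superset[of I m])
    then show ?thesis using that by (auto simp: monomials_def in_keys_iff)
  qed
  then have "lookup ` monomials I d \<subseteq> {f. \<forall>i. (i \<in> I \<longrightarrow> f i \<in> {..d}) \<and> (i \<notin> I \<longrightarrow> f i = 0)}"
    by (intro image_subsetI)
  then have "finite (lookup ` monomials I d)"
    by (rule finite_subset) (intro finite_set_of_finite_funs assms finite_atMost)
  then show ?thesis
    by (rule finite_imageD) (auto intro!: inj_onI poly_mapping_eqI)
qed

lemma lookup_sum_single:
  fixes \<phi> :: "'k \<Rightarrow> 'b::comm_monoid_add"
  assumes "finite B"
  shows "lookup (\<Sum>s\<in>B. single s (\<phi> s)) k = (if k \<in> B then \<phi> k else 0)"
  using assms by (simp add: lookup_sum lookup_single when_def sum.delta')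

lemma monomials_mono: "I \<subseteq> J \<Longrightarrow> monomials I d \<subseteq> monomials J d"
  by (auto simp: monomials_def)

lemma mdeg_single [simp]: "mdeg (single i k) = k"
  by (simp add: mdeg_def)

lemma mdeg_zero [simp]: "mdeg 0 = 0"
  by (simp add: mdeg_def)

lemma monomials_add: "m \<in> monomials I d \<Longrightarrow> m' \<in> monomials I e \<Longrightarrow> m + m' \<in> monomials I (d + e)"
  using Poly_Mapping.keys_add[of m m'] by (auto simp: monomials_def mdeg_add)

lemma monomials_single: "i \<in> I \<Longrightarrow> single i k \<in> monomials I k"
  by (auto simp: monomials_def)

lemma forms_mono: "I \<subseteq> J \<Longrightarrow> f \<in> forms I d \<Longrightarrow> f \<in> forms J d"
  using monomials_mono[of I J d] by (auto simp: forms_def)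

lemma forms_zero [simp]: "0 \<in> forms I d"
  by (simp add: forms_def)

lemma forms_add: "f \<in> forms I d \<Longrightarrow> g \<in> forms I d \<Longrightarrow> f + g \<in> forms I d"
  using Poly_Mapping.keys_add[of f g] by (auto simp: forms_def)

lemma forms_uminus: "f \<in> forms I d \<Longrightarrow> - f \<in> forms I d"
  by (auto simp: forms_def in_keys_iff)

lemma forms_diff: "f \<in> forms I d \<Longrightarrow> g \<in> forms I d \<Longrightarrow> f - g \<in> forms I d"
  using forms_add[OF _ forms_uminus, of f I d g] by simp

lemma forms_sum: "(\<And>a. a \<in> A \<Longrightarrow> f a \<in> forms I d) \<Longrightarrow> (\<Sum>a\<in>A. f a) \<in> forms I d"
  by (induction A rule: infinite_finite_induct) (auto intro: forms_add)

lemma forms_single: "m \<in> monomials I d \<Longrightarrow> single m c \<in> forms I d"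
  by (simp add: forms_def)

lemma forms_const: "single 0 c \<in> forms I 0"
  by (rule forms_single) (simp add: monomials_def)

lemma forms_one: "1 \<in> forms I 0"
  using forms_const[of 1] by simp

lemma forms_scale: "f \<in> forms I d \<Longrightarrow> single 0 c * f \<in> forms I d"
  using forms_mult[OF forms_const, of f I d c] by simp

lemma forms_mvar: "i \<in> I \<Longrightarrow> mvar i \<in> forms I 1"
  unfolding mvar_def by (intro forms_single monomials_single)

lemma forms_power: "f \<in> forms I d \<Longrightarrow> f ^ k \<in> forms I (d * k)"
  by (induction k) (use forms_one forms_mult[of f I d] in fastforce)+

lemma forms_prod: "(\<And>a. a \<in> A \<Longrightarrow> f a \<in> forms I (e a)) \<Longrightarrow> (\<Prod>a\<in>A. f a) \<in> forms I (\<Sum>a\<in>A. e a)"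
  by (induction A rule: infinite_finite_induct) (auto intro: forms_mult simp: forms_one)

lemma forms_msubst:
  assumes f: "f \<in> forms I d" and \<sigma>: "\<And>i. i \<in> I \<Longrightarrow> \<sigma> i \<in> forms J e"
  shows "msubst \<sigma> f \<in> forms J (e * d)"
  unfolding msubst_def eval_with_def
proof (intro forms_sum forms_scale)
  fix m assume "m \<in> keys f"
  then have m: "keys m \<subseteq> I" "mdeg m = d" using f by (auto simp: forms_def monomials_def)
  have "(\<Prod>i\<in>keys m. \<sigma> i ^ lookup m i) \<in> forms J (\<Sum>i\<in>keys m. e * lookup m i)"
    using m \<sigma> by (intro forms_prod forms_power) auto
  then show "(\<Prod>i\<in>keys m. \<sigma> i ^ lookup m i) \<in> forms J (e * d)"
    using m by (auto simp: mdeg_def simp flip: sum_distrib_left)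
qed

lemma meval_forms:
  assumes "f \<in> forms I d" "finite I"
  shows "meval x f = (\<Sum>m\<in>monomials I d. lookup f m * mpow x m)"
  using assms by (intro meval_superset finite_monomials) (auto simp: forms_def)

lemma meval_cong:
  assumes "f \<in> forms I d" "\<And>i. i \<in> I \<Longrightarrow> x i = y i"
  shows "meval x f = meval y f"
  unfolding meval_eq using assms
  by (intro sum.cong refl arg_cong2[of _ _ _ _ "(*)"] mpow_cong) (auto 0 3 simp: forms_def monomials_def)

lemma cvec_diff: "x \<in> cvec I \<Longrightarrow> y \<in> cvec I \<Longrightarrow> (\<lambda>i. x i - y i) \<in> cvec I"
  by (simp add: cvec_def)

text \<open>Weights turning distinct monomials into distinct powers of one variable, as in Kronecker
  substitution.\<close>

lemma separating_weights:
  assumes "finite I" "finite S" "\<And>m. m \<in> S \<Longrightarrow> keys m \<subseteq> I"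
  shows "\<exists>w::'v \<Rightarrow> nat. inj_on (\<lambda>m. \<Sum>i\<in>I. w i * lookup m i) S"
  using assms
proof (induction I arbitrary: S rule: finite_induct)
  case empty
  then show ?case by (auto simp: inj_on_def)
next
  case (insert v I)
  define r where "r m = (\<Sum>i\<in>I. single i (lookup m i))" for m :: "'v \<Rightarrow>\<^sub>0 nat"
  have lr: "lookup (r m) i = (if i \<in> I then lookup m i else 0)" for m i
    unfolding r_def using insert by (simp add: lookup_sum_single)
  have "keys m \<subseteq> I" if "m \<in> r ` S" for m
    using that by (auto simp: in_keys_iff lr split: if_splits)
  then obtain w where w: "inj_on (\<lambda>m. \<Sum>i\<in>I. w i * lookup m i) (r ` S)"
    using insert.IH[of "r ` S"] insert.prems by auto
  define W where "W m = (\<Sum>i\<in>I. w i * lookup m i)" for m :: "'v \<Rightarrow>\<^sub>0 nat"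
  have Wr: "W (r m) = W m" for m by (simp add: W_def lr)
  \<comment> \<open>With \<open>b\<close> above all weights \<open>W m\<close>, the number
    \<open>b * lookup m v + W m\<close> determines its remainder \<open>W m\<close> and its quotient
    \<open>lookup m v\<close> modulo \<open>b\<close>.\<close>
  obtain b where b: "\<And>m. m \<in> S \<Longrightarrow> W m < b"
  proof
    show "W m < Suc (Max (W ` S))" if "m \<in> S" for m
      using insert.prems(1) that by (simp add: less_Suc_eq_le)
  qed
  define w' where "w' = w(v := b)"
  have w': "(\<Sum>i\<in>insert v I. w' i * lookup m i) = b * lookup m v + W m" for m
    using insert.hyps by (simp add: w'_def W_def) (rule sum.cong, auto)
  have "inj_on (\<lambda>m. \<Sum>i\<in>insert v I. w' i * lookup m i) S"
  proof (rule inj_onI, unfold w')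
    fix m m' assume m: "m \<in> S" "m' \<in> S" and eq: "b * lookup m v + W m = b * lookup m' v + W m'"
    have "(b * lookup m v + W m) mod b = W m" "(b * lookup m' v + W m') mod b = W m'"
      using b m by auto
    then have W: "W m = W m'" using eq by simp
    then have v: "lookup m v = lookup m' v" using eq b[OF m(1)] by auto
    have "r m = r m'"
      using inj_onD[OF w, of "r m" "r m'"] W m by (simp add: Wr flip: W_def)
    then have "lookup m i = lookup m' i" if "i \<in> I" for i using lr that by metis
    moreover have "lookup m i = lookup m' i" if "i \<notin> insert v I" for i
      using insert.prems(2)[OF m(1)] insert.prems(2)[OF m(2)] that
      by (metis in_keys_iff subsetD)
    ultimately show "m = m'" using v by (intro poly_mapping_eqI) (metis insert_iff)
  qed
  then show ?case by blast
qed

text \<open>Substituting \<open>t ^ w i\<close> for the \<open>i\<close>-th variable, with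
  separating weights \<open>w\<close>, prevents any cancellation between monomials; the resulting
  one-variable polynomial is nonzero and has only finitely many roots.\<close>

lemma meval_nonzero:
  assumes "f \<noteq> 0"
  shows "\<exists>x. meval x f \<noteq> 0"
proof -
  define I where "I = (\<Union>m\<in>keys f. keys m)"
  have "finite I" by (simp add: I_def)
  then obtain w where w: "inj_on (\<lambda>m. \<Sum>i\<in>I. w i * lookup m i) (keys f)"
    using separating_weights[of I "keys f"] by (auto simp: I_def)
  define W where "W m = (\<Sum>i\<in>I. w i * lookup m i)" for m :: "'a \<Rightarrow>\<^sub>0 nat"
  define p where "p = (\<Sum>m\<in>keys f. monom (lookup f m) (W m))"
  obtain m0 where m0: "m0 \<in> keys f" using assms by (auto simp: poly_mapping_eq_iff fun_eq_iff in_keys_iff)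
  have "coeff p (W m0) = (\<Sum>m\<in>keys f. if m = m0 then lookup f m else 0)"
    unfolding p_def coeff_sum using w m0 by (intro sum.cong refl) (auto simp: W_def inj_on_def)
  then have "p \<noteq> 0" using m0 by (auto simp: in_keys_iff)
  then have "finite {t. poly p t = 0}" by (rule poly_roots_finite)
  then obtain t where "poly p t \<noteq> 0" using infinite_UNIV_char_0[where 'a = complex]
    by (metis (mono_tags, lifting) UNIV_I finite_subset mem_Collect_eq subsetI)
  moreover have "poly p t = meval (\<lambda>i. t ^ w i) f"
    unfolding p_def meval_eq poly_sum poly_monom
  proof (intro sum.cong refl arg_cong2[of _ _ _ _ "(*)"])
    fix m assume "m \<in> keys f"
    then show "t ^ W m = mpow (\<lambda>i. t ^ w i) m"
      using \<open>finite I\<close> by (subst mpow_superset[of I]) (auto simp: I_def W_def power_sum power_mult)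
  qed
  ultimately show ?thesis by metis
qed

lemma forms_nonzero:
  assumes "f \<in> forms I d" "f \<noteq> 0"
  shows "\<exists>x\<in>cvec I. meval x f \<noteq> 0"
proof -
  obtain x where x: "meval x f \<noteq> 0" using meval_nonzero[OF assms(2)] by blast
  show ?thesis
    by (rule bexI[of _ "\<lambda>i. if i \<in> I then x i else 0"])
      (use x meval_cong[OF assms(1), of x "\<lambda>i. if i \<in> I then x i else 0"] in \<open>auto simp: cvec_def\<close>)
qed

lemma forms_eqI:
  assumes "f \<in> forms I d" "g \<in> forms I d" "\<And>x. x \<in> cvec I \<Longrightarrow> meval x f = meval x g"
  shows "f = g"
proof (rule ccontr)
  assume "f \<noteq> g"
  then obtain x where "x \<in> cvec I" "meval x (f - g) \<noteq> 0"
    using forms_nonzero[OF forms_diff[OF assms(1,2)]] by auto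
  then show False using assms(3) by simp
qed

text \<open>Irreducibility of the coordinate space. On the line joining \<open>x\<close> (at
  \<open>t = 0\<close>) to \<open>y\<close> (at \<open>t = 1\<close>) both polynomials restrict to
  nonzero polynomials in \<open>t\<close>, so their product has a nonroot.\<close>

lemma common_nonvanishing:
  assumes "x \<in> cvec I" "meval x F \<noteq> 0" "y \<in> cvec I" "meval y G \<noteq> 0"
  shows "\<exists>z\<in>cvec I. meval z F \<noteq> 0 \<and> meval z G \<noteq> 0"
proof -
  define \<phi> where "\<phi> i = [:x i, y i - x i:]" for i
  define p where "p = eval_with (\<lambda>a. [:a:]) \<phi> F"
  define q where "q = eval_with (\<lambda>a. [:a:]) \<phi> G"
  have "poly p 0 \<noteq> 0" "poly q 1 \<noteq> 0"
    using assms by (simp_all add: p_def q_def poly_eval_with \<phi>_def)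
  then have "p * q \<noteq> 0" by auto
  then have "finite {t. poly (p * q) t = 0}" by (rule poly_roots_finite)
  then obtain t where "poly (p * q) t \<noteq> 0" using infinite_UNIV_char_0[where 'a = complex]
    by (metis (mono_tags, lifting) UNIV_I finite_subset mem_Collect_eq subsetI)
  then have "meval (\<lambda>i. poly (\<phi> i) t) F \<noteq> 0 \<and> meval (\<lambda>i. poly (\<phi> i) t) G \<noteq> 0"
    by (simp add: p_def q_def poly_eval_with)
  moreover have "(\<lambda>i. poly (\<phi> i) t) \<in> cvec I" using assms by (auto simp: cvec_def \<phi>_def)
  ultimately show ?thesis by blast
qed

section \<open>Linear systems\<close>

text \<open>Gaussian elimination: one pivot removes one equation and one unknown, and the removed
  unknown is recovered by back substitution.\<close>

lemma underdetermined:
  fixes a :: "'r \<Rightarrow> 'c \<Rightarrow> complex"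
  assumes "finite Q" "finite C" "card Q < card C"
  shows "\<exists>z. (\<exists>c\<in>C. z c \<noteq> 0) \<and> (\<forall>q\<in>Q. (\<Sum>c\<in>C. a q c * z c) = 0)"
  using assms
proof (induction Q arbitrary: C a rule: finite_induct)
  case empty
  then have "C \<noteq> {}" by auto
  then show ?case by (intro exI[of _ "\<lambda>_. 1"]) auto
next
  case (insert q Q)
  show ?case
  proof (cases "\<forall>c\<in>C. a q c = 0")
    case True
    then show ?thesis using insert.IH[of C a] insert.prems insert.hyps by auto
  next
    case False
    then obtain p where p: "p \<in> C" "a q p \<noteq> 0" by blast
    define b where "b r c = a r c - a r p * a q c / a q p" for r c
    have "card Q < card (C - {p})" using insert.prems insert.hyps p by auto
    then obtain z where z: "\<exists>c\<in>C - {p}. z c \<noteq> 0"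
        "\<And>r. r \<in> Q \<Longrightarrow> (\<Sum>c\<in>C - {p}. b r c * z c) = 0"
      using insert.IH[of "C - {p}" b] insert.prems by auto
    define s where "s = (\<Sum>c\<in>C - {p}. a q c * z c)"
    define z' where "z' = z(p := - s / a q p)"
    have *: "(\<Sum>c\<in>C. a r c * z' c) = a r p * (- s / a q p) + (\<Sum>c\<in>C - {p}. a r c * z c)" for r
      by (subst sum.remove[OF insert.prems(1) p(1)]) (auto simp: z'_def intro: sum.cong)
    have "(\<Sum>c\<in>C. a r c * z' c) = 0" if "r \<in> insert q Q" for r
    proof (cases "r = q")
      case True
      then show ?thesis unfolding * using p by (simp add: s_def)
    next
      case False
      then have "(\<Sum>c\<in>C - {p}. b r c * z c) = 0" using z that by auto
      then show ?thesis unfolding * s_def b_def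
        by (simp add: algebra_simps sum_subtractf sum_distrib_left sum_divide_distrib)
    qed
    moreover have "\<exists>c\<in>C. z' c \<noteq> 0" using z by (auto simp: z'_def)
    ultimately show ?thesis by blast
  qed
qed

text \<open>Adjoining the right-hand side as one more column gives more unknowns than equations. In
  a nontrivial solution the coordinate of the new column is nonzero because the kernel is trivial,
  and dividing by it solves the system.\<close>

lemma square_system_solvable:
  fixes a :: "'c \<Rightarrow> 'c \<Rightarrow> complex"
  assumes "finite C"
    and "\<And>z. \<forall>s\<in>C. (\<Sum>c\<in>C. a s c * z c) = 0 \<Longrightarrow> \<forall>c\<in>C. z c = 0"
  shows "\<exists>v. \<forall>s\<in>C. (\<Sum>c\<in>C. a s c * v c) = w s"
proof -
  \<comment> \<open>\<open>None\<close> labels the adjoined column \<open>- w\<close>.\<close>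
  define b where "b s k = (case k of None \<Rightarrow> - w s | Some c \<Rightarrow> a s c)" for s k
  have sum: "(\<Sum>k\<in>insert None (Some ` C). b s k * z k) = - w s * z None + (\<Sum>c\<in>C. a s c * z (Some c))" for s z
    using assms(1) by (subst sum.insert) (auto simp: b_def sum.reindex)
  have "card (insert None (Some ` C)) = Suc (card C)"
    using assms(1) by (subst card_insert_disjoint) (auto simp: card_image)
  then obtain z where z: "\<exists>k\<in>insert None (Some ` C). z k \<noteq> 0"
      "\<And>s. s \<in> C \<Longrightarrow> (\<Sum>k\<in>insert None (Some ` C). b s k * z k) = 0"
    using underdetermined[of C "insert None (Some ` C)" b] assms(1) by auto
  have "z None \<noteq> 0"
  proof
    assume "z None = 0"
    then have "\<forall>c\<in>C. z (Some c) = 0"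
      using assms(2)[of "\<lambda>c. z (Some c)"] z(2) unfolding sum by simp
    then show False using z(1) \<open>z None = 0\<close> by auto
  qed
  then have "(\<Sum>c\<in>C. a s c * (z (Some c) / z None)) = w s" if "s \<in> C" for s
    using z(2)[OF that] unfolding sum by (simp add: field_simps flip: sum_divide_distrib)
  then show ?thesis by (intro exI[of _ "\<lambda>c. z (Some c) / z None"]) blast
qed

text \<open>\<open>F\<close> is the product of the pivots in fraction-free elimination at \<open>x0\<close>, and \<open>\<rho>\<close> selects the
  pivot rows.\<close>

lemma open_nonsingular:
  fixes a :: "'r \<Rightarrow> 'c \<Rightarrow> 'k mpoly"
  assumes "finite C" and "\<And>r c. r \<in> R \<Longrightarrow> c \<in> C \<Longrightarrow> a r c \<in> forms K e0"
    and "\<And>z. \<forall>r\<in>R. (\<Sum>c\<in>C. meval x0 (a r c) * z c) = 0 \<Longrightarrow> \<forall>c\<in>C. z c = 0"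
  shows "\<exists>F e \<rho>. F \<in> forms K e \<and> \<rho> ` C \<subseteq> R \<and> meval x0 F \<noteq> 0 \<and>
    (\<forall>x z. meval x F \<noteq> 0 \<longrightarrow> (\<forall>s\<in>C. (\<Sum>c\<in>C. meval x (a (\<rho> s) c) * z c) = 0) \<longrightarrow> (\<forall>c\<in>C. z c = 0))"
  using assms
proof (induction C arbitrary: a e0 rule: finite_induct)
  case empty
  show ?case by (rule exI[of _ 1]) (auto intro: forms_one)
next
  case (insert p C)
  \<comment> \<open>Were column \<open>p\<close> zero at \<open>x0\<close>, the unit vector at
    \<open>p\<close> would lie in the kernel.\<close>
  have "\<exists>r\<in>R. meval x0 (a r p) \<noteq> 0"
  proof (rule ccontr)
    assume "\<not> ?thesis"
    then have "\<forall>r\<in>R. (\<Sum>c\<in>insert p C. meval x0 (a r c) * (if c = p then 1 else 0)) = 0"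
      using insert.hyps by (auto simp: if_distrib[of "(*) _"] sum.delta' cong: if_cong)
    from insert.prems(2)[OF this] show False by simp
  qed
  then obtain q where q: "q \<in> R" "meval x0 (a q p) \<noteq> 0" by blast
  \<comment> \<open>Cross multiplication replaces division by the pivot, so the reduced entries are
    again forms, of twice the degree.\<close>
  define b where "b r c = a q p * a r c - a r p * a q c" for r c
  have sum_b: "(\<Sum>c\<in>C. meval x (b r c) * z c) =
      meval x (a q p) * (\<Sum>c\<in>C. meval x (a r c) * z c) - meval x (a r p) * (\<Sum>c\<in>C. meval x (a q c) * z c)"
    for x r z
    by (simp add: b_def left_diff_distrib sum_subtractf sum_distrib_left mult.assoc)
  have sum_a: "(\<Sum>c\<in>insert p C. meval x (a r c) * z c) = meval x (a r p) * z p + (\<Sum>c\<in>C. meval x (a r c) * z c)"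
    for x r z using insert.hyps by simp
  have "\<exists>F e \<rho>. F \<in> forms K e \<and> \<rho> ` C \<subseteq> R \<and> meval x0 F \<noteq> 0 \<and>
    (\<forall>x z. meval x F \<noteq> 0 \<longrightarrow> (\<forall>s\<in>C. (\<Sum>c\<in>C. meval x (b (\<rho> s) c) * z c) = 0) \<longrightarrow> (\<forall>c\<in>C. z c = 0))"
  proof (rule insert.IH)
    show "b r c \<in> forms K (e0 + e0)" if "r \<in> R" "c \<in> C" for r c
      unfolding b_def using that q insert.prems(1) by (intro forms_diff forms_mult) auto
    fix z assume z: "\<forall>r\<in>R. (\<Sum>c\<in>C. meval x0 (b r c) * z c) = 0"
    define s where "s = (\<Sum>c\<in>C. meval x0 (a q c) * z c)"
    define z' where "z' = z(p := - s / meval x0 (a q p))"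
    have "(\<Sum>c\<in>insert p C. meval x0 (a r c) * z' c) = 0" if "r \<in> R" for r
    proof -
      have "(\<Sum>c\<in>C. meval x0 (a r c) * z' c) = (\<Sum>c\<in>C. meval x0 (a r c) * z c)"
        using insert.hyps by (intro sum.cong) (auto simp: z'_def)
      moreover have "meval x0 (a q p) * (\<Sum>c\<in>C. meval x0 (a r c) * z c) = meval x0 (a r p) * s"
        using z that unfolding sum_b s_def by simp
      ultimately show ?thesis unfolding sum_a using q by (simp add: z'_def field_simps)
    qed
    then have "\<forall>c\<in>insert p C. z' c = 0" using insert.prems(2) by blast
    then show "\<forall>c\<in>C. z c = 0" using insert.hyps by (auto simp: z'_def split: if_splits)
  qed
  then obtain F e \<rho> where F: "F \<in> forms K e" "\<rho> ` C \<subseteq> R" "meval x0 F \<noteq> 0"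
    "\<And>x z. meval x F \<noteq> 0 \<Longrightarrow> \<forall>s\<in>C. (\<Sum>c\<in>C. meval x (b (\<rho> s) c) * z c) = 0 \<Longrightarrow> \<forall>c\<in>C. z c = 0"
    by blast
  show ?case
  proof (intro exI[of _ "a q p * F"] exI[of _ "e0 + e"] exI[of _ "\<rho>(p := q)"] conjI allI impI)
    show "a q p * F \<in> forms K (e0 + e)" using F q insert.prems(1) by (intro forms_mult) auto
    show "(\<rho>(p := q)) ` insert p C \<subseteq> R" using F q by auto
    show "meval x0 (a q p * F) \<noteq> 0" using F q by simp
    fix x z assume x: "meval x (a q p * F) \<noteq> 0"
      and z: "\<forall>s\<in>insert p C. (\<Sum>c\<in>insert p C. meval x (a ((\<rho>(p := q)) s) c) * z c) = 0"
    have zq: "(\<Sum>c\<in>C. meval x (a q c) * z c) = - (meval x (a q p) * z p)"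
      using bspec[OF z, of p] unfolding sum_a by (simp add: eq_neg_iff_add_eq_0 add.commute)
    have "(\<Sum>c\<in>C. meval x (b (\<rho> s) c) * z c) = 0" if "s \<in> C" for s
    proof -
      have "s \<noteq> p" using that insert.hyps by auto
      then have "(\<Sum>c\<in>C. meval x (a (\<rho> s) c) * z c) = - (meval x (a (\<rho> s) p) * z p)"
        using bspec[OF z, of s] that unfolding sum_a by (simp add: eq_neg_iff_add_eq_0 add.commute)
      then show ?thesis unfolding sum_b zq by simp
    qed
    then have C: "\<forall>c\<in>C. z c = 0" using F(4)[of x z] x by auto
    then have "meval x (a q p) * z p = 0" using zq by simp
    then show "\<forall>c\<in>insert p C. z c = 0" using C x by auto
  qed
qed

section \<open>Partial derivatives and smoothness\<close>

lemma meval_mpartial: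
  "meval x (mpartial i f) = (\<Sum>m\<in>keys f. of_nat (lookup m i) * lookup f m * mpow x (m - single i 1))"
  by (simp add: mpartial_def)

lemma meval_mpartial_superset:
  assumes "finite K" "keys f \<subseteq> K"
  shows "meval x (mpartial i f) = (\<Sum>m\<in>K. of_nat (lookup m i) * lookup f m * mpow x (m - single i 1))"
  unfolding meval_mpartial using assms by (intro sum.mono_neutral_left) (auto simp: in_keys_iff)

lemma meval_mpartial_forms:
  assumes "f \<in> forms I d" "finite I"
  shows "meval x (mpartial i f) =
    (\<Sum>m\<in>monomials I d. of_nat (lookup m i) * lookup f m * mpow x (m - single i 1))"
  using assms by (intro meval_mpartial_superset finite_monomials) (auto simp: forms_def)

lemma meval_mpartial_add:
  "meval x (mpartial i (f + g)) = meval x (mpartial i f) + meval x (mpartial i g)"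
proof -
  let ?K = "keys f \<union> keys g"
  have *: "keys (f + g) \<subseteq> ?K" by (rule Poly_Mapping.keys_add)
  show ?thesis
    by (subst (1 2 3) meval_mpartial_superset[where K = ?K])
       (use * in \<open>auto simp: lookup_add distrib_left distrib_right sum.distrib\<close>)
qed

lemma meval_mpartial_single:
  "meval x (mpartial i (single m c)) = of_nat (lookup m i) * c * mpow x (m - single i 1)"
  by (subst meval_mpartial_superset[where K = "{m}"]) auto

lemma meval_mpartial_sum:
  "meval x (mpartial i (\<Sum>a\<in>A. f a)) = (\<Sum>a\<in>A. meval x (mpartial i (f a)))"
  by (induction A rule: infinite_finite_induct) (auto simp: meval_mpartial_add mpartial_def[of _ 0])

text \<open>The chain rule, which ties the formal \<open>mpartial\<close> to complex
  differentiation. It is applied to straight lines, where two expressions for the same function are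
  differentiated and compared.\<close>

lemma meval_has_derivative:
  assumes f: "f \<in> forms I d" and I: "finite I"
    and \<gamma>: "\<And>i. i \<in> I \<Longrightarrow> ((\<lambda>t. \<gamma> t i) has_field_derivative \<gamma>' i) (at t0)"
  shows "((\<lambda>t. meval (\<gamma> t) f) has_field_derivative
    (\<Sum>i\<in>I. \<gamma>' i * meval (\<gamma> t0) (mpartial i f))) (at t0)"
proof -
  have mp: "mpow x m = (\<Prod>i\<in>I. x i ^ lookup m i)" if "m \<in> keys f" for x :: "'a \<Rightarrow> complex" and m
    using that f I by (intro mpow_superset) (auto simp: forms_def monomials_def)
  \<comment> \<open>If the \<open>i\<close>-th variable is absent from \<open>m\<close>, both
    subtractions truncate to exponent 0, so the identity holds in that case as well.\<close>
  have mp': "mpow x (m - single i 1) = x i ^ (lookup m i - 1) * (\<Prod>j\<in>I - {i}. x j ^ lookup m j)"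
    if "m \<in> keys f" "i \<in> I" for x :: "'a \<Rightarrow> complex" and m i
  proof -
    have "keys (m - single i 1) \<subseteq> I"
      using that f by (fastforce simp: forms_def monomials_def in_keys_iff lookup_minus)
    then have "mpow x (m - single i 1) = (\<Prod>j\<in>I. x j ^ lookup (m - single i 1) j)"
      using I by (intro mpow_superset)
    also have "\<dots> = x i ^ (lookup m i - 1) * (\<Prod>j\<in>I - {i}. x j ^ lookup m j)"
      using I that(2)
      by (subst prod.remove[of _ i]) (auto simp: lookup_minus lookup_single intro!: prod.cong)
    finally show ?thesis .
  qed
  have "((\<lambda>t. mpow (\<gamma> t) m) has_field_derivative
      (\<Sum>i\<in>I. \<gamma>' i * (of_nat (lookup m i) * mpow (\<gamma> t0) (m - single i 1)))) (at t0)"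
    if m: "m \<in> keys f" for m
  proof -
    have "((\<lambda>t. \<Prod>i\<in>I. \<gamma> t i ^ lookup m i) has_field_derivative
      (\<Sum>i\<in>I. of_nat (lookup m i) * (\<gamma>' i * \<gamma> t0 i ^ (lookup m i - 1)) * (\<Prod>j\<in>I - {i}. \<gamma> t0 j ^ lookup m j))) (at t0)"
      using DERIV_power[OF \<gamma>] by (intro has_field_derivative_prod) simp
    then show ?thesis unfolding mp[OF m]
      by (rule DERIV_cong) (auto simp: mp'[OF m, simplified One_nat_def] intro!: sum.cong)
  qed
  then have "((\<lambda>t. \<Sum>m\<in>keys f. lookup f m * mpow (\<gamma> t) m) has_field_derivative
      (\<Sum>m\<in>keys f. lookup f m * (\<Sum>i\<in>I. \<gamma>' i * (of_nat (lookup m i) * mpow (\<gamma> t0) (m - single i 1))))) (at t0)"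
    by (intro DERIV_sum DERIV_cmult)
  moreover have "(\<Sum>m\<in>keys f. lookup f m * (\<Sum>i\<in>I. \<gamma>' i * (of_nat (lookup m i) * mpow (\<gamma> t0) (m - single i 1))))
      = (\<Sum>i\<in>I. \<gamma>' i * meval (\<gamma> t0) (mpartial i f))"
    unfolding meval_mpartial sum_distrib_left by (subst sum.swap) (simp add: mult_ac)
  ultimately show ?thesis unfolding meval_eq by simp
qed

section \<open>The Fermat form and an open condition for smoothness\<close>

definition fermat :: "'v set \<Rightarrow> nat \<Rightarrow> 'v mpoly"
  where "fermat I d = (\<Sum>i\<in>I. single (single i d) 1)"

lemma lookup_fermat:
  assumes "finite I" "d > 0"
  shows "lookup (fermat I d) m = (if \<exists>i\<in>I. m = single i d then 1 else 0)"
proof -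
  have inj: "single i d = single j d \<longleftrightarrow> i = j" for i j :: 'a
    using assms(2) by (metis lookup_single_eq lookup_single_not_eq less_numeral_extra(3))
  show ?thesis
  proof (cases "\<exists>i\<in>I. m = single i d")
    case True
    then obtain i where "i \<in> I" "m = single i d" by blast
    then show ?thesis using assms
      by (auto simp: fermat_def lookup_sum lookup_single inj when_def)
  next
    case False
    then show ?thesis
      by (auto simp: fermat_def lookup_sum lookup_single when_def intro!: sum.neutral)
  qed
qed

lemma fermat_forms: "fermat I d \<in> forms I d"
  unfolding fermat_def by (intro forms_sum forms_single monomials_single)

text \<open>Macaulay's matrix: in degree \<open>e = |I|(d - 2) + 1\<close> every monomial is divisible by the
  \<open>(d - 1)\<close>-st power of a variable, so for the Fermat form the multiples of the partial derivatives
  span all forms of degree \<open>e\<close>. Whenever they do, the partial derivatives have no common zero.\<close>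

lemma smooth_certificate:
  fixes I :: "'v set"
  assumes I: "finite I" "I \<noteq> {}" and d: "d \<ge> 2"
  shows "\<exists>F e. F \<in> forms (monomials I d) e \<and> meval (lookup (fermat I d)) F \<noteq> 0 \<and>
    (\<forall>f\<in>forms I d. meval (lookup f) F \<noteq> 0 \<longrightarrow> f \<in> smooth_forms I d)"
proof -
  define e where "e = card I * (d - 2) + 1"
  define C where "C = monomials I e"
  define idx where "idx m = (SOME i. i \<in> I \<and> d - 1 \<le> lookup m i)" for m :: "'v \<Rightarrow>\<^sub>0 nat"
  \<comment> \<open>With \<open>i = idx m\<close>, row \<open>m\<close> of Macaulay's matrix is the
    \<open>i\<close>-th partial derivative times \<open>m\<close> divided by the
    \<open>(d - 1)\<close>-st power of the \<open>i\<close>-th variable. The term of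
    \<open>f\<close> at \<open>k\<close> contributes to the monomial \<open>g m k\<close>, and
    \<open>a m m'\<close> is the coefficient at \<open>m'\<close>, a linear form in the coefficients
    of \<open>f\<close>.\<close>
  define g where "g m k = (m - single (idx m) (d - 1)) + (k - single (idx m) 1)" for m k :: "'v \<Rightarrow>\<^sub>0 nat"
  define a where "a m m' = (\<Sum>k\<in>monomials I d. if 1 \<le> lookup k (idx m) \<and> g m k = m'
      then single (single k 1) (of_nat (lookup k (idx m))) else 0 :: ('v \<Rightarrow>\<^sub>0 nat) mpoly)" for m m'
  have finC: "finite C" and finM: "finite (monomials I d)"
    using I by (simp_all add: C_def finite_monomials)
  have idx: "idx m \<in> I" "d - 1 \<le> lookup m (idx m)" if "m \<in> C" for m
  proof -
    have "\<exists>i\<in>I. d - 1 \<le> lookup m i"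
    proof (rule ccontr)
      assume "\<not> ?thesis"
      then have "\<forall>i\<in>I. lookup m i \<le> d - 2" by auto
      then have "(\<Sum>i\<in>I. lookup m i) \<le> card I * (d - 2)" using sum_bounded_above[of I "lookup m" "d - 2"] by simp
      moreover have "(\<Sum>i\<in>I. lookup m i) = e"
        using that I mdeg_superset[of I m] by (auto simp: C_def monomials_def)
      ultimately show False by (simp add: e_def)
    qed
    then have "idx m \<in> I \<and> d - 1 \<le> lookup m (idx m)"
      using someI_ex[of "\<lambda>i. i \<in> I \<and> d - 1 \<le> lookup m i"] unfolding idx_def by blast
    then show "idx m \<in> I" "d - 1 \<le> lookup m (idx m)" by auto
  qed
  have gC: "g m k \<in> C" if m: "m \<in> C" and k: "k \<in> monomials I d" "1 \<le> lookup k (idx m)" for m k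
  proof -
    have m1: "m = (m - single (idx m) (d - 1)) + single (idx m) (d - 1)"
      using idx(2)[OF m] by (intro poly_mapping_eqI) (auto simp: lookup_add lookup_minus lookup_single when_def)
    have k1: "k = (k - single (idx m) 1) + single (idx m) 1"
      using k by (intro poly_mapping_eqI) (auto simp: lookup_add lookup_minus lookup_single when_def)
    have "mdeg m = mdeg (m - single (idx m) (d - 1)) + (d - 1)"
      using arg_cong[OF m1, of mdeg] unfolding mdeg_add mdeg_single .
    moreover have "mdeg k = mdeg (k - single (idx m) 1) + 1"
      using arg_cong[OF k1, of mdeg] unfolding mdeg_add mdeg_single .
    ultimately have "mdeg (g m k) = e" using m k d by (auto simp: g_def mdeg_add C_def monomials_def)
    moreover have "keys (g m k) \<subseteq> I"
      using m k by (auto simp: g_def C_def monomials_def in_keys_iff lookup_add lookup_minus subset_iff)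
    ultimately show ?thesis by (simp add: C_def monomials_def)
  qed
  have aforms: "a m m' \<in> forms (monomials I d) 1" for m m'
    unfolding a_def by (intro forms_sum) (auto intro!: forms_single monomials_single)
  have ev: "meval x (a m m') = (\<Sum>k\<in>monomials I d. if 1 \<le> lookup k (idx m) \<and> g m k = m'
      then of_nat (lookup k (idx m)) * x k else 0)" for x m m'
    unfolding a_def by (simp add: if_distrib[of "meval x"] cong: if_cong)
  \<comment> \<open>For the Fermat form the \<open>i\<close>-th derivative is \<open>d\<close> times
    the very power that was divided out of \<open>m\<close>, so the matrix is \<open>d\<close> times
    the identity.\<close>
  have diag: "meval (lookup (fermat I d)) (a m m') = (if m' = m then of_nat d else 0)"
    if m: "m \<in> C" for m m'
  proof -
    define k0 where "k0 = (single (idx m) d :: 'v \<Rightarrow>\<^sub>0 nat)"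
    have k0: "k0 \<in> monomials I d" "lookup k0 (idx m) = d"
      using idx(1)[OF m] by (simp_all add: k0_def monomials_single)
    have gk0: "g m k0 = m"
      using idx(2)[OF m] d unfolding g_def k0_def
      by (intro poly_mapping_eqI) (auto simp: lookup_add lookup_minus lookup_single when_def)
    have "meval (lookup (fermat I d)) (a m m') =
        (\<Sum>k\<in>monomials I d. if k = k0 then (if m' = m then of_nat d else 0) else 0)"
      unfolding ev
    proof (rule sum.cong[OF refl])
      fix k assume k: "k \<in> monomials I d"
      show "(if 1 \<le> lookup k (idx m) \<and> g m k = m' then of_nat (lookup k (idx m)) * lookup (fermat I d) k else 0)
        = (if k = k0 then (if m' = m then of_nat d else 0) else 0 :: complex)"
      proof (cases "k = k0")
        case True
        then show ?thesis using k0 gk0 d I idx(1)[OF m] by (auto simp: lookup_fermat k0_def)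
      next
        case False
        then have "lookup (fermat I d) k = 0 \<or> lookup k (idx m) = 0"
          using I d by (auto simp: lookup_fermat k0_def lookup_single when_def split: if_splits)
        then show ?thesis using False by auto
      qed
    qed
    also have "\<dots> = (if m' = m then of_nat d else 0)" using finM k0 by simp
    finally show ?thesis .
  qed
  have ker: "\<forall>c\<in>C. z c = 0" if z: "\<forall>r\<in>C. (\<Sum>c\<in>C. meval (lookup (fermat I d)) (a r c) * z c) = 0" for z
  proof
    fix c assume c: "c \<in> C"
    have "(\<Sum>c'\<in>C. meval (lookup (fermat I d)) (a c c') * z c') = (\<Sum>c'\<in>C. if c' = c then of_nat d * z c' else 0)"
      using c by (intro sum.cong) (auto simp: diag)
    then show "z c = 0" using bspec[OF z c] c finC d by simp
  qed
  obtain F e' \<rho> where F: "F \<in> forms (monomials I d) e'" "\<rho> ` C \<subseteq> C" "meval (lookup (fermat I d)) F \<noteq> 0"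
    "\<And>x z. meval x F \<noteq> 0 \<Longrightarrow> \<forall>s\<in>C. (\<Sum>c\<in>C. meval x (a (\<rho> s) c) * z c) = 0 \<Longrightarrow> \<forall>c\<in>C. z c = 0"
  proof -
    have "\<exists>F e \<rho>. F \<in> forms (monomials I d) e \<and> \<rho> ` C \<subseteq> C \<and> meval (lookup (fermat I d)) F \<noteq> 0 \<and>
      (\<forall>x z. meval x F \<noteq> 0 \<longrightarrow> (\<forall>s\<in>C. (\<Sum>c\<in>C. meval x (a (\<rho> s) c) * z c) = 0) \<longrightarrow> (\<forall>c\<in>C. z c = 0))"
      by (rule open_nonsingular[OF finC aforms]) (rule ker)
    then show ?thesis using that by blast
  qed
  \<comment> \<open>At a common zero \<open>x\<close> of the partial derivatives, the vector of all
    monomial values \<open>mpow x c\<close> lies in the kernel of the matrix. Hence these values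
    vanish, in particular the pure powers of the coordinates.\<close>
  have sing: "x = (\<lambda>_. 0)" if f: "f \<in> forms I d" and Ff: "meval (lookup f) F \<noteq> 0" and x: "x \<in> cvec I"
    and par: "\<And>i. i \<in> I \<Longrightarrow> meval x (mpartial i f) = 0" for f x
  proof -
    have "(\<Sum>c\<in>C. meval (lookup f) (a m c) * mpow x c) = 0" if m: "m \<in> C" for m
    proof -
      have "(\<Sum>c\<in>C. meval (lookup f) (a m c) * mpow x c) = (\<Sum>k\<in>monomials I d. \<Sum>c\<in>C.
          if c = g m k then (if 1 \<le> lookup k (idx m) then of_nat (lookup k (idx m)) * lookup f k * mpow x c else 0) else 0)"
        unfolding ev sum_distrib_right by (subst sum.swap) (auto intro!: sum.cong)
      also have "\<dots> = (\<Sum>k\<in>monomials I d. mpow x (m - single (idx m) (d - 1)) *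
          (of_nat (lookup k (idx m)) * lookup f k * mpow x (k - single (idx m) 1)))"
      proof (rule sum.cong[OF refl])
        fix k assume k: "k \<in> monomials I d"
        show "(\<Sum>c\<in>C. if c = g m k then (if 1 \<le> lookup k (idx m) then of_nat (lookup k (idx m)) * lookup f k * mpow x c else 0) else 0)
          = mpow x (m - single (idx m) (d - 1)) * (of_nat (lookup k (idx m)) * lookup f k * mpow x (k - single (idx m) 1))"
          using finC gC[OF m k] by (cases "1 \<le> lookup k (idx m)") (auto simp: g_def mpow_add sum.delta)
      qed
      also have "\<dots> = mpow x (m - single (idx m) (d - 1)) * meval x (mpartial (idx m) f)"
        using f I by (simp add: meval_mpartial_forms sum_distrib_left)
      finally show ?thesis using par idx(1)[OF m] by simp
    qed
    then have "\<forall>s\<in>C. (\<Sum>c\<in>C. meval (lookup f) (a (\<rho> s) c) * mpow x c) = 0"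
      using F(2) by (metis image_subset_iff)
    then have "\<forall>c\<in>C. mpow x c = 0" by (rule F(4)[OF Ff])
    then have "x i ^ e = 0" if "i \<in> I" for i
      using that monomials_single[of i I e] by (metis C_def mpow_single)
    then have "x i = 0" if "i \<in> I" for i using that by auto
    then show ?thesis using x by (auto simp: cvec_def)
  qed
  have "f \<in> smooth_forms I d" if f: "f \<in> forms I d" and Ff: "meval (lookup f) F \<noteq> 0" for f
  proof -
    have "f \<noteq> 0"
    proof
      assume "f = 0"
      obtain j where "j \<in> I" using I by blast
      have "(\<lambda>i. if i = j then 1 else 0) = (\<lambda>_. 0 :: complex)"
        using \<open>f = 0\<close> \<open>j \<in> I\<close> by (intro sing[OF f Ff]) (auto simp: cvec_def mpartial_def)
      then show False by (metis zero_neq_one)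
    qed
    then show ?thesis unfolding smooth_forms_def using sing[OF f Ff] f by blast
  qed
  then show ?thesis using F by blast
qed

section \<open>Algebraic independence and algebraic relations\<close>

lemma mpow_scale: "mpow (\<lambda>i. c * x i) m = c ^ mdeg m * mpow x m"
  by (simp add: mpow_def mdeg_def power_mult_distrib prod.distrib power_sum)

lemma mpoly_mult_nonzero:
  fixes F G :: "'v mpoly"
  assumes "F \<noteq> 0" "G \<noteq> 0"
  shows "F * G \<noteq> 0"
proof -
  obtain x y where "meval x F \<noteq> 0" "meval y G \<noteq> 0" using meval_nonzero assms by blast
  then obtain z where "meval z F \<noteq> 0 \<and> meval z G \<noteq> 0"
    using common_nonvanishing[of x UNIV F y G] by (auto simp: cvec_def)
  then have "meval z (F * G) \<noteq> 0" by simp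
  then show ?thesis by (metis meval_zero)
qed

lemma mpoly_prod_nonzero:
  fixes F :: "'a \<Rightarrow> 'v mpoly"
  shows "(\<And>a. a \<in> A \<Longrightarrow> F a \<noteq> 0) \<Longrightarrow> (\<Prod>a\<in>A. F a) \<noteq> 0"
  by (induction A rule: infinite_finite_induct) (simp_all add: mpoly_mult_nonzero)

text \<open>The Jacobian criterion for algebraic independence: if curves through \<open>y0\<close> realise every tangent
  direction, then the lowest order term of \<open>c\<close> at \<open>y0\<close> survives along one of them.\<close>

lemma nonvanishing_along_curve:
  fixes \<Gamma> :: "(complex \<Rightarrow> 's \<Rightarrow> complex) set"
  assumes c: "c \<noteq> 0"
    and \<Gamma>: "\<And>w. \<exists>\<gamma>\<in>\<Gamma>. \<forall>s. \<gamma> 0 s = y0 s \<and> ((\<lambda>t. \<gamma> t s) has_field_derivative w s) (at 0)"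
  shows "\<exists>\<gamma>\<in>\<Gamma>. \<exists>t. meval (\<gamma> t) c \<noteq> 0"
proof -
  \<comment> \<open>The Taylor expansion of \<open>c\<close> at \<open>y0\<close>;
    \<open>low\<close> below is its lowest homogeneous part.\<close>
  define c' where "c' = msubst (\<lambda>i. single 0 (y0 i) + mvar i) c"
  have ev: "meval z c' = meval (\<lambda>i. y0 i + z i) c" for z
    by (simp add: c'_def meval_msubst)
  obtain y1 where "meval y1 c \<noteq> 0" using meval_nonzero[OF c] by blast
  then have "meval (\<lambda>i. y1 i - y0 i) c' \<noteq> 0" by (simp add: ev)
  then have "c' \<noteq> 0" by auto
  then have ne: "keys c' \<noteq> {}" by (auto simp: poly_mapping_eq_iff fun_eq_iff in_keys_iff)
  define r where "r = Min (mdeg ` keys c')"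
  have r_le: "r \<le> mdeg m" if "m \<in> keys c'" for m using that by (simp add: r_def)
  have "r \<in> mdeg ` keys c'" unfolding r_def using ne by (intro Min_in) auto
  then obtain m0 where m0: "m0 \<in> keys c'" "mdeg m0 = r" by auto
  define low where "low = (\<Sum>m\<in>{m\<in>keys c'. mdeg m = r}. single m (lookup c' m))"
  have "lookup low m0 \<noteq> 0" using m0 by (simp add: low_def lookup_sum_single in_keys_iff)
  then have "low \<noteq> 0" by auto
  then obtain w where w: "meval w low \<noteq> 0" using meval_nonzero by blast
  obtain \<gamma> where \<gamma>: "\<gamma> \<in> \<Gamma>" "\<And>s. \<gamma> 0 s = y0 s"
      "\<And>s. ((\<lambda>t. \<gamma> t s) has_field_derivative w s) (at 0)"
    using \<Gamma>[of w] by blast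
  define U where "U t s = (\<gamma> t s - y0 s) / t" for t s
  have U: "((\<lambda>t. U t s) \<longlongrightarrow> w s) (at 0)" for s
    using \<gamma>(3)[of s] unfolding has_field_derivative_iff by (simp add: U_def \<gamma>(2))
  \<comment> \<open>\<open>br t\<close> is \<open>c'\<close> at \<open>t * U t\<close> divided by
    \<open>t ^ r\<close>. The subtraction is exact since \<open>r\<close> is the minimal degree, and
    by \<open>0 ^ 0 = 1\<close> the limit at 0 retains precisely the terms of degree
    \<open>r\<close>, giving the value of \<open>low\<close> at \<open>w\<close>.\<close>
  define br where "br t = (\<Sum>m\<in>keys c'. lookup c' m * (t ^ (mdeg m - r) * mpow (U t) m))" for t
  have "(br \<longlongrightarrow> (\<Sum>m\<in>keys c'. lookup c' m * (0 ^ (mdeg m - r) * mpow w m))) (at 0)"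
    unfolding br_def mpow_def by (intro tendsto_intros U)
  also have "(\<Sum>m\<in>keys c'. lookup c' m * (0 ^ (mdeg m - r) * mpow w m)) =
      (\<Sum>m\<in>keys c'. if mdeg m = r then lookup c' m * mpow w m else 0)"
    by (intro sum.cong) (auto simp: power_0_left dest: r_le)
  also have "\<dots> = meval w low" by (simp add: low_def) (rule sum.inter_filter[symmetric], simp)
  finally have "eventually (\<lambda>t. br t \<noteq> 0) (at 0)" using w by (intro tendsto_imp_eventually_ne)
  moreover have "eventually (\<lambda>t. t \<noteq> (0::complex)) (at 0)" by (simp add: eventually_at_filter)
  ultimately have "eventually (\<lambda>t. br t \<noteq> 0 \<and> t \<noteq> 0) (at 0)" by (rule eventually_conj)
  then obtain t where t: "br t \<noteq> 0" "t \<noteq> 0" using eventually_happens' by (metis (mono_tags, lifting) at_neq_bot)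
  have "meval (\<gamma> t) c = meval (\<lambda>s. t * U t s) c'" using t by (simp add: ev U_def)
  also have "\<dots> = (\<Sum>m\<in>keys c'. lookup c' m * (t ^ mdeg m * mpow (U t) m))"
    by (simp add: meval_eq mpow_scale)
  also have "\<dots> = t ^ r * br t"
    unfolding br_def sum_distrib_left
  proof (rule sum.cong[OF refl])
    fix m assume "m \<in> keys c'"
    then have "t ^ mdeg m = t ^ r * t ^ (mdeg m - r)" using r_le by (simp flip: power_add)
    then show "lookup c' m * (t ^ mdeg m * mpow (U t) m) = t ^ r * (lookup c' m * (t ^ (mdeg m - r) * mpow (U t) m))"
      by simp
  qed
  finally have "meval (\<gamma> t) c \<noteq> 0" using t by simp
  then show ?thesis using \<gamma>(1) by blast
qed

text \<open>Since the total degree is fixed, the exponent of one chosen variable is determined by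
  the others, each of which is at most \<open>e\<close>.\<close>

lemma card_monomials_le:
  assumes B: "finite B" "B \<noteq> {}"
  shows "card (monomials B e) \<le> (e + 1) ^ (card B - 1)"
proof -
  obtain b where b: "b \<in> B" using B by blast
  define r where "r m = restrict (lookup m) (B - {b})" for m :: "'a \<Rightarrow>\<^sub>0 nat"
  have tot: "lookup m b + (\<Sum>i\<in>B - {b}. lookup m i) = e" if "m \<in> monomials B e" for m
    using that b B mdeg_superset[of B m] sum.remove[of B b "lookup m"] by (simp add: monomials_def)
  have "inj_on r (monomials B e)"
  proof (rule inj_onI)
    fix m m' assume m: "m \<in> monomials B e" "m' \<in> monomials B e" "r m = r m'"
    have i: "lookup m i = lookup m' i" if "i \<in> B - {b}" for i
      using fun_cong[OF m(3), of i] that by (simp add: r_def)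
    then have "(\<Sum>i\<in>B - {b}. lookup m i) = (\<Sum>i\<in>B - {b}. lookup m' i)" by (intro sum.cong) auto
    then have "lookup m b = lookup m' b" using tot[OF m(1)] tot[OF m(2)] by simp
    moreover have "lookup m i = lookup m' i" if "i \<notin> B" for i
      using m that unfolding monomials_def by (metis (mono_tags, lifting) in_keys_iff mem_Collect_eq subsetD)
    ultimately show "m = m'" using i by (intro poly_mapping_eqI) (metis Diff_iff singletonD)
  qed
  moreover have "r ` monomials B e \<subseteq> (B - {b}) \<rightarrow>\<^sub>E {..e}"
  proof (intro image_subsetI PiE_I)
    fix m i assume m: "m \<in> monomials B e" and i: "i \<in> B - {b}"
    have "lookup m i \<le> (\<Sum>i\<in>B - {b}. lookup m i)" using i B by (intro member_le_sum) auto
    then show "r m i \<in> {..e}" using tot[OF m] i by (simp add: r_def)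
  qed (auto simp: r_def restrict_def)
  ultimately have "card (monomials B e) \<le> card ((B - {b}) \<rightarrow>\<^sub>E {..e})"
    using B by (intro card_inj_on_le[of r]) (auto intro: finite_PiE)
  also have "\<dots> = (e + 1) ^ (card B - 1)" using B b by (simp add: card_PiE)
  finally show ?thesis .
qed

text \<open>This box indexes the products between which a linear relation is sought; its size is an
  exact power, which keeps the comparison of growth rates elementary.\<close>

lemma card_exponent_box:
  assumes S: "finite S" and m: "m > 0"
  shows "card {\<beta>::'s \<Rightarrow>\<^sub>0 nat. keys \<beta> \<subseteq> S \<and> (\<forall>s. lookup \<beta> s < m)} = m ^ card S"
proof -
  let ?\<Lambda> = "{\<beta>::'s \<Rightarrow>\<^sub>0 nat. keys \<beta> \<subseteq> S \<and> (\<forall>s. lookup \<beta> s < m)}"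
  have "bij_betw (\<lambda>\<beta>. restrict (lookup \<beta>) S) ?\<Lambda> (S \<rightarrow>\<^sub>E {..<m})"
  proof (rule bij_betw_byWitness[where f' = "\<lambda>\<phi>. \<Sum>s\<in>S. single s (\<phi> s)"])
    show "\<forall>\<beta>\<in>?\<Lambda>. (\<Sum>s\<in>S. single s (restrict (lookup \<beta>) S s)) = \<beta>"
    proof
      fix \<beta> assume "\<beta> \<in> ?\<Lambda>"
      then have "lookup \<beta> s = 0" if "s \<notin> S" for s using that by (auto simp: not_in_keys_iff_lookup_eq_zero[symmetric])
      then show "(\<Sum>s\<in>S. single s (restrict (lookup \<beta>) S s)) = \<beta>"
        using S by (intro poly_mapping_eqI) (simp add: lookup_sum_single)
    qed
    show "\<forall>\<phi>\<in>S \<rightarrow>\<^sub>E {..<m}. restrict (lookup (\<Sum>s\<in>S. single s (\<phi> s))) S = \<phi>"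
    proof (intro ballI ext)
      fix \<phi> s assume \<phi>: "\<phi> \<in> S \<rightarrow>\<^sub>E {..<m}"
      show "restrict (lookup (\<Sum>s\<in>S. single s (\<phi> s))) S s = \<phi> s"
        using S PiE_arb[OF \<phi>, of s] by (cases "s \<in> S") (simp_all add: lookup_sum_single)
    qed
    show "(\<lambda>\<beta>. restrict (lookup \<beta>) S) ` ?\<Lambda> \<subseteq> S \<rightarrow>\<^sub>E {..<m}" by auto
    show "(\<lambda>\<phi>. \<Sum>s\<in>S. single s (\<phi> s)) ` (S \<rightarrow>\<^sub>E {..<m}) \<subseteq> ?\<Lambda>"
    proof (intro image_subsetI CollectI conjI allI subsetI)
      fix \<phi> s assume \<phi>: "\<phi> \<in> S \<rightarrow>\<^sub>E {..<m}"
      show "s \<in> S" if "s \<in> keys (\<Sum>s\<in>S. single s (\<phi> s))"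
        using that S by (metis in_keys_iff lookup_sum_single)
      show "lookup (\<Sum>s\<in>S. single s (\<phi> s)) s < m"
        using \<phi> S m by (auto simp: lookup_sum_single)
    qed
  qed
  then show ?thesis using S by (simp add: bij_betw_same_card card_PiE)
qed

text \<open>Any form \<open>h\<close> of degree \<open>d\<close> is algebraic over at least as many degree \<open>d\<close> forms as there are
  variables: products of total degree \<open>D\<close> outnumber the monomials of degree \<open>d * D\<close>.\<close>

lemma algebraic_relation:
  fixes \<psi> :: "'s \<Rightarrow> 'b mpoly"
  assumes B: "finite B" "B \<noteq> {}" and S: "finite S" "card B \<le> card S" and d: "d > 0"
    and \<psi>: "\<And>s. s \<in> S \<Longrightarrow> \<psi> s \<in> forms B d" and h: "h \<in> forms B d"
  shows "\<exists>D \<alpha> \<Lambda>. finite \<Lambda> \<and> (\<forall>\<beta>\<in>\<Lambda>. keys \<beta> \<subseteq> S \<and> mdeg \<beta> \<le> D) \<and> (\<exists>\<beta>\<in>\<Lambda>. \<alpha> \<beta> \<noteq> 0) \<and>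
    (\<Sum>\<beta>\<in>\<Lambda>. single 0 (\<alpha> \<beta>) * (h ^ (D - mdeg \<beta>) * mpow \<psi> \<beta>)) = 0"
proof -
  define N where "N = card S"
  \<comment> \<open>\<open>m\<close> just exceeds \<open>(d * N) ^ (N - 1)\<close>, whence
    \<open>(d * N * m) ^ (N - 1) < m ^ N\<close>. \<open>D\<close> is the largest total degree in
    the box, so the factor \<open>h ^ (D - mdeg \<beta>)\<close> brings every product to the same
    degree \<open>d * D\<close>.\<close>
  define m where "m = (d * N) ^ (N - 1) + 1"
  define D where "D = N * (m - 1)"
  define \<Lambda> where "\<Lambda> = {\<beta>::'s \<Rightarrow>\<^sub>0 nat. keys \<beta> \<subseteq> S \<and> (\<forall>s. lookup \<beta> s < m)}"
  define Q where "Q = monomials B (d * D)"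
  have B1: "card B \<ge> 1" using B by (simp add: Suc_leI card_gt_0_iff)
  then have N1: "N \<ge> 1" using S by (simp add: N_def)
  have cardL: "card \<Lambda> = m ^ N" unfolding \<Lambda>_def N_def using S by (intro card_exponent_box) (auto simp: m_def)
  have "card Q \<le> (d * D + 1) ^ (card B - 1)" unfolding Q_def by (rule card_monomials_le[OF B])
  also have "\<dots> \<le> (d * D + 1) ^ (N - 1)" using S by (intro power_increasing) (auto simp: N_def)
  also have "\<dots> \<le> (d * N * m) ^ (N - 1)"
  proof (rule power_mono)
    have "d * N \<ge> 1" using d N1 by simp
    moreover have "d * N * m = d * D + d * N" by (simp add: m_def D_def algebra_simps)
    ultimately show "d * D + 1 \<le> d * N * m" by linarith
  qed simp
  also have "\<dots> = (d * N) ^ (N - 1) * m ^ (N - 1)" by (simp add: power_mult_distrib)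
  also have "\<dots> < m * m ^ (N - 1)" by (simp add: m_def)
  also have "\<dots> = m ^ N" using N1 by (cases N) auto
  finally have less: "card Q < card \<Lambda>" by (simp add: cardL)
  have finL: "finite \<Lambda>" using less card.infinite by fastforce
  have deg: "mdeg \<beta> \<le> D" if "\<beta> \<in> \<Lambda>" for \<beta>
  proof -
    have "lookup \<beta> s \<le> m - 1" for s
    proof -
      have "lookup \<beta> s < m" using that by (simp add: \<Lambda>_def)
      then show ?thesis by linarith
    qed
    then have "(\<Sum>s\<in>S. lookup \<beta> s) \<le> card S * (m - 1)"
      using sum_bounded_above[of S "lookup \<beta>" "m - 1"] by simp
    then show ?thesis using that S mdeg_superset[of S \<beta>] by (simp add: \<Lambda>_def D_def N_def)
  qed
  define P where "P \<beta> = h ^ (D - mdeg \<beta>) * mpow \<psi> \<beta>" for \<beta>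
  have P: "P \<beta> \<in> forms B (d * D)" if "\<beta> \<in> \<Lambda>" for \<beta>
  proof -
    have "(\<Prod>s\<in>keys \<beta>. \<psi> s ^ lookup \<beta> s) \<in> forms B (\<Sum>s\<in>keys \<beta>. d * lookup \<beta> s)"
      using that \<psi> by (intro forms_prod forms_power) (auto simp: \<Lambda>_def)
    then have "mpow \<psi> \<beta> \<in> forms B (d * mdeg \<beta>)" by (simp add: mpow_def mdeg_def sum_distrib_left)
    then have "P \<beta> \<in> forms B (d * (D - mdeg \<beta>) + d * mdeg \<beta>)"
      unfolding P_def by (intro forms_mult forms_power h)
    then show ?thesis using deg[OF that] by (simp flip: distrib_left)
  qed
  \<comment> \<open>One equation per monomial of degree \<open>d * D\<close>, one unknown per
    element of the box.\<close>
  obtain \<alpha> where \<alpha>: "\<exists>\<beta>\<in>\<Lambda>. \<alpha> \<beta> \<noteq> 0" "\<And>q. q \<in> Q \<Longrightarrow> (\<Sum>\<beta>\<in>\<Lambda>. lookup (P \<beta>) q * \<alpha> \<beta>) = 0"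
    using underdetermined[OF _ finL less, of "\<lambda>q \<beta>. lookup (P \<beta>) q"] B
    by (auto simp: Q_def finite_monomials)
  define R where "R = (\<Sum>\<beta>\<in>\<Lambda>. single 0 (\<alpha> \<beta>) * P \<beta>)"
  have "R \<in> forms B (d * D)" unfolding R_def by (intro forms_sum forms_scale P)
  moreover have "meval x R = 0" for x
  proof -
    have "meval x R = (\<Sum>\<beta>\<in>\<Lambda>. \<alpha> \<beta> * meval x (P \<beta>))" by (simp add: R_def)
    also have "\<dots> = (\<Sum>\<beta>\<in>\<Lambda>. \<Sum>q\<in>Q. \<alpha> \<beta> * (lookup (P \<beta>) q * mpow x q))"
      by (intro sum.cong refl) (simp add: meval_forms[OF P B(1)] Q_def sum_distrib_left)
    also have "\<dots> = (\<Sum>q\<in>Q. (\<Sum>\<beta>\<in>\<Lambda>. lookup (P \<beta>) q * \<alpha> \<beta>) * mpow x q)"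
      by (subst sum.swap) (simp add: sum_distrib_left mult_ac)
    also have "\<dots> = 0" using \<alpha>(2) by simp
    finally show ?thesis .
  qed
  ultimately have "R = 0" by (intro forms_eqI[of R B "d * D" 0]) auto
  show ?thesis
  proof (intro exI[of _ D] exI[of _ \<alpha>] exI[of _ \<Lambda>] conjI)
    show "\<forall>\<beta>\<in>\<Lambda>. keys \<beta> \<subseteq> S \<and> mdeg \<beta> \<le> D" using deg by (simp add: \<Lambda>_def)
    show "(\<Sum>\<beta>\<in>\<Lambda>. single 0 (\<alpha> \<beta>) * (h ^ (D - mdeg \<beta>) * mpow \<psi> \<beta>)) = 0"
      using \<open>R = 0\<close> unfolding R_def P_def .
  qed (use finL \<alpha>(1) in blast)+
qed

text \<open>For given values \<open>y\<close> of \<open>\<psi>\<close>, the algebraic relation is a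
  one-variable polynomial equation for the value of \<open>h\<close>. \<open>c\<close> is one of its
  coefficients, as a form in \<open>y\<close>; where it is nonzero, the equation has finitely many
  roots. That \<open>c\<close> does not vanish on all values taken by \<open>\<psi>\<close> is a
  separate matter, left to the Jacobian criterion.\<close>

lemma finitely_many_values:
  fixes \<psi> :: "'s \<Rightarrow> 'b mpoly"
  assumes B: "finite B" "B \<noteq> {}" and S: "finite S" "card B \<le> card S" and d: "d > 0"
    and \<psi>: "\<And>s. s \<in> S \<Longrightarrow> \<psi> s \<in> forms B d" and h: "h \<in> forms B d"
  shows "\<exists>c e. c \<in> forms S e \<and> c \<noteq> 0 \<and>
    (\<forall>y. meval y c \<noteq> 0 \<longrightarrow> finite {meval M h | M. \<forall>s\<in>S. meval M (\<psi> s) = y s})"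
proof -
  have "\<exists>D \<alpha> \<Lambda>. finite \<Lambda> \<and> (\<forall>\<beta>\<in>\<Lambda>. keys \<beta> \<subseteq> S \<and> mdeg \<beta> \<le> D) \<and> (\<exists>\<beta>\<in>\<Lambda>. \<alpha> \<beta> \<noteq> 0) \<and>
      (\<Sum>\<beta>\<in>\<Lambda>. single 0 (\<alpha> \<beta>) * (h ^ (D - mdeg \<beta>) * mpow \<psi> \<beta>)) = 0"
    by (rule algebraic_relation[OF B S d _ h]) (rule \<psi>)
  then obtain D \<alpha> \<Lambda> where *: "finite \<Lambda> \<and> (\<forall>\<beta>\<in>\<Lambda>. keys \<beta> \<subseteq> S \<and> mdeg \<beta> \<le> D) \<and> (\<exists>\<beta>\<in>\<Lambda>. \<alpha> \<beta> \<noteq> 0) \<and>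
      (\<Sum>\<beta>\<in>\<Lambda>. single 0 (\<alpha> \<beta>) * (h ^ (D - mdeg \<beta>) * mpow \<psi> \<beta>)) = 0"
    by (elim exE)
  then have rel: "(\<Sum>\<beta>\<in>\<Lambda>. single 0 (\<alpha> \<beta>) * (h ^ (D - mdeg \<beta>) * mpow \<psi> \<beta>)) = 0" by simp
  have \<Lambda>: "finite \<Lambda>" "\<And>\<beta>. \<beta> \<in> \<Lambda> \<Longrightarrow> keys \<beta> \<subseteq> S" "\<And>\<beta>. \<beta> \<in> \<Lambda> \<Longrightarrow> mdeg \<beta> \<le> D"
    and \<alpha>: "\<exists>\<beta>\<in>\<Lambda>. \<alpha> \<beta> \<noteq> 0" using * by simp_all
  obtain \<beta>0 where \<beta>0: "\<beta>0 \<in> \<Lambda>" "\<alpha> \<beta>0 \<noteq> 0" using \<alpha> by blast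
  define c where "c = (\<Sum>\<beta>\<in>{\<beta>\<in>\<Lambda>. mdeg \<beta> = mdeg \<beta>0}. single \<beta> (\<alpha> \<beta>))"
  have "lookup c \<beta>0 \<noteq> 0" using \<Lambda>(1) \<beta>0 by (simp add: c_def lookup_sum_single)
  then have "c \<noteq> 0" by auto
  moreover have "c \<in> forms S (mdeg \<beta>0)"
    unfolding c_def using \<Lambda> by (intro forms_sum forms_single) (auto simp: monomials_def)
  moreover have "finite {meval M h | M. \<forall>s\<in>S. meval M (\<psi> s) = y s}" if y: "meval y c \<noteq> 0" for y
  proof -
    define p where "p = (\<Sum>\<beta>\<in>\<Lambda>. monom (\<alpha> \<beta> * mpow y \<beta>) (D - mdeg \<beta>))"
    have "coeff p (D - mdeg \<beta>0) = (\<Sum>\<beta>\<in>\<Lambda>. if mdeg \<beta> = mdeg \<beta>0 then \<alpha> \<beta> * mpow y \<beta> else 0)"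
      unfolding p_def coeff_sum
    proof (rule sum.cong[OF refl])
      fix \<beta> assume "\<beta> \<in> \<Lambda>"
      then have "D - mdeg \<beta> = D - mdeg \<beta>0 \<longleftrightarrow> mdeg \<beta> = mdeg \<beta>0" using \<Lambda>(3)[of \<beta>] \<Lambda>(3)[OF \<beta>0(1)] by auto
      then show "coeff (monom (\<alpha> \<beta> * mpow y \<beta>) (D - mdeg \<beta>)) (D - mdeg \<beta>0) =
          (if mdeg \<beta> = mdeg \<beta>0 then \<alpha> \<beta> * mpow y \<beta> else 0)" by simp
    qed
    also have "\<dots> = meval y c" using \<Lambda>(1) by (simp add: c_def) (rule sum.inter_filter[symmetric])
    finally have "p \<noteq> 0" using y by auto
    then have "finite {t. poly p t = 0}" by (rule poly_roots_finite)
    moreover have "poly p (meval M h) = 0" if M: "\<forall>s\<in>S. meval M (\<psi> s) = y s" for M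
    proof -
      have "mpow (\<lambda>s. meval M (\<psi> s)) \<beta> = mpow y \<beta>" if "\<beta> \<in> \<Lambda>" for \<beta>
        using M \<Lambda>(2)[OF that] by (intro mpow_cong) auto
      moreover have "meval M (mpow \<psi> \<beta>) = mpow (\<lambda>s. meval M (\<psi> s)) \<beta>" for \<beta>
        by (simp add: mpow_def)
      moreover have "meval M (\<Sum>\<beta>\<in>\<Lambda>. single 0 (\<alpha> \<beta>) * (h ^ (D - mdeg \<beta>) * mpow \<psi> \<beta>)) = 0"
        unfolding rel by simp
      ultimately show ?thesis by (simp add: p_def poly_sum poly_monom mult_ac)
    qed
    ultimately show ?thesis by (elim rev_finite_subset) blast
  qed
  ultimately show ?thesis by blast
qed

text \<open>Each coordinate is treated through its \<open>d\<close>-th power, a form of the same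
  degree as the \<open>\<psi> s\<close>; a number has only finitely many \<open>d\<close>-th roots.
  The product of the coefficients obtained serves all coordinates at once.\<close>

lemma finite_fibres:
  fixes \<psi> :: "'s \<Rightarrow> 'b mpoly"
  assumes B: "finite B" "B \<noteq> {}" and S: "finite S" "card B \<le> card S" and d: "d > 0"
    and \<psi>: "\<And>s. s \<in> S \<Longrightarrow> \<psi> s \<in> forms B d"
  shows "\<exists>c e. c \<in> forms S e \<and> c \<noteq> 0 \<and>
    (\<forall>y. meval y c \<noteq> 0 \<longrightarrow> finite {M \<in> cvec B. \<forall>s\<in>S. meval M (\<psi> s) = y s})"
proof -
  define good where "good b c e \<longleftrightarrow> c \<in> forms S e \<and> c \<noteq> 0 \<and>
    (\<forall>y. meval y c \<noteq> 0 \<longrightarrow> finite {meval M (mvar b ^ d) | M. \<forall>s\<in>S. meval M (\<psi> s) = y s})" for b c e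
  have "\<exists>c e. good b c e" if "b \<in> B" for b
  proof -
    have "mvar b ^ d \<in> forms B d" using forms_power[OF forms_mvar[OF that], of d] by simp
    from finitely_many_values[OF B S d _ this, of \<psi>] show ?thesis
      unfolding good_def using \<psi> by blast
  qed
  then have "\<forall>b\<in>B. \<exists>c e. good b c e" by blast
  then obtain c where "\<forall>b\<in>B. \<exists>e. good b (c b) e" by (rule bchoice[THEN exE])
  then obtain e where ce: "\<forall>b\<in>B. good b (c b) (e b)" by (rule bchoice[THEN exE])
  have c: "c b \<in> forms S (e b)" "c b \<noteq> 0"
    "\<And>y. meval y (c b) \<noteq> 0 \<Longrightarrow> finite {meval M (mvar b ^ d) | M. \<forall>s\<in>S. meval M (\<psi> s) = y s}"
    if "b \<in> B" for b
    using bspec[OF ce that] unfolding good_def by simp_all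
  have "finite {M \<in> cvec B. \<forall>s\<in>S. meval M (\<psi> s) = y s}" if y: "meval y (\<Prod>b\<in>B. c b) \<noteq> 0" for y
  proof -
    define V where "V b = {M b | M. \<forall>s\<in>S. meval M (\<psi> s) = y s}" for b
    have "finite (V b)" if b: "b \<in> B" for b
    proof -
      have "meval y (c b) \<noteq> 0" using y b B by auto
      then have "finite {meval M (mvar b ^ d) | M. \<forall>s\<in>S. meval M (\<psi> s) = y s}" by (rule c(3)[OF b])
      moreover have "{meval M (mvar b ^ d) | M. \<forall>s\<in>S. meval M (\<psi> s) = y s} = (\<lambda>z. z ^ d) ` V b"
        by (auto simp: V_def)
      ultimately have "finite ((\<lambda>z. z ^ d) ` V b)" by simp
      then have "finite (\<Union>w\<in>(\<lambda>z. z ^ d) ` V b. {z. z ^ d = w})"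
        using finite_nth_roots[OF d] by blast
      then show ?thesis by (rule rev_finite_subset) auto
    qed
    then have "finite (\<Union>b\<in>B. V b)" using B by blast
    then have "finite {M. \<forall>b. (b \<in> B \<longrightarrow> M b \<in> (\<Union>b\<in>B. V b)) \<and> (b \<notin> B \<longrightarrow> M b = 0)}"
      using B by (intro finite_set_of_finite_funs)
    then show ?thesis by (rule rev_finite_subset) (auto simp: V_def cvec_def)
  qed
  then have "\<forall>y. meval y (\<Prod>b\<in>B. c b) \<noteq> 0 \<longrightarrow> finite {M \<in> cvec B. \<forall>s\<in>S. meval M (\<psi> s) = y s}"
    by (intro allI impI)
  moreover have "(\<Prod>b\<in>B. c b) \<in> forms S (\<Sum>b\<in>B. e b)" using c(1) by (rule forms_prod)
  moreover have "(\<Prod>b\<in>B. c b) \<noteq> 0" using c(2) by (rule mpoly_prod_nonzero)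
  ultimately show ?thesis
    by (intro exI[of _ "\<Prod>b\<in>B. c b"] exI[of _ "\<Sum>b\<in>B. e b"] conjI)
qed

section \<open>Linear substitutions\<close>

lemma meval_lin_pullback: "meval y (lin_pullback J A f) = meval (lin_map J A y) f"
  by (simp add: lin_pullback_def meval_msubst lin_map_def)

lemma lin_pullback_forms:
  assumes "f \<in> forms I d"
  shows "lin_pullback J A f \<in> forms J d"
proof -
  have "(\<Sum>j\<in>J. single 0 (A i j) * mvar j) \<in> forms J 1" for i
    by (intro forms_sum forms_scale forms_mvar)
  then show ?thesis using forms_msubst[OF assms, of _ J 1] by (simp add: lin_pullback_def)
qed

lemma lin_map_compose:
  "lin_map K A (lin_map J C y) = lin_map J (\<lambda>i j. \<Sum>k\<in>K. A i k * C k j) y"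
  unfolding lin_map_def
  by (rule ext, simp add: sum_distrib_left sum_distrib_right mult.assoc, subst sum.swap, simp)

lemma lin_map_scale_matrix: "lin_map J (\<lambda>i j. c * A i j) y = (\<lambda>i. c * lin_map J A y i)"
  by (simp add: lin_map_def sum_distrib_left mult.assoc)

lemma lin_map_add: "lin_map J A (\<lambda>j. x j + y j) = (\<lambda>i. lin_map J A x i + lin_map J A y i)"
  by (simp add: lin_map_def distrib_left sum.distrib)

lemma lin_map_scale: "lin_map J A (\<lambda>j. c * y j) = (\<lambda>i. c * lin_map J A y i)"
  by (simp add: lin_map_def sum_distrib_left mult.left_commute)

lemma lin_map_diff: "lin_map J A (\<lambda>j. x j - y j) = (\<lambda>i. lin_map J A x i - lin_map J A y i)"
  by (simp add: lin_map_def right_diff_distrib sum_subtractf)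

lemma lin_map_zero [simp]: "lin_map J A (\<lambda>_. 0) = (\<lambda>_. 0)"
  by (simp add: lin_map_def)

lemma lin_map_unit: "finite J \<Longrightarrow> lin_map J A (\<lambda>k. if k = j then 1 else 0) i = (if j \<in> J then A i j else 0)"
  by (simp add: lin_map_def if_distrib[of "(*) _"] cong: if_cong)

lemma lin_map_id:
  assumes "finite J" "y \<in> cvec J"
  shows "lin_map J (\<lambda>i j. if i = j then 1 else 0) y = y"
  using assms by (auto simp: lin_map_def cvec_def fun_eq_iff if_distrib[of "\<lambda>c. c * _"] cong: if_cong)

lemma cvec_zero [simp]: "(\<lambda>_. 0) \<in> cvec I"
  by (simp add: cvec_def)

section \<open>The general linear group\<close>

lemma GL_mem: "A \<in> GL I \<Longrightarrow> y \<in> cvec I \<Longrightarrow> lin_map I A y \<in> cvec I"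
  unfolding GL_def by (auto dest: bij_betwE)

lemma GL_inj: "A \<in> GL I \<Longrightarrow> y \<in> cvec I \<Longrightarrow> lin_map I A y = (\<lambda>_. 0) \<Longrightarrow> y = (\<lambda>_. 0)"
  using inj_onD[of "lin_map I A" "cvec I" y "\<lambda>_. 0"] by (simp add: GL_def bij_betw_def)

lemma GL_surj: "A \<in> GL I \<Longrightarrow> x \<in> cvec I \<Longrightarrow> \<exists>y\<in>cvec I. x = lin_map I A y"
  unfolding GL_def bij_betw_def by blast

text \<open>In finite dimension a trivial kernel suffices, surjectivity being
  \<open>square_system_solvable\<close>.\<close>

lemma GL_I:
  assumes I: "finite I" and mem: "\<And>y. y \<in> cvec I \<Longrightarrow> lin_map I A y \<in> cvec I"
    and ker: "\<And>y. y \<in> cvec I \<Longrightarrow> lin_map I A y = (\<lambda>_. 0) \<Longrightarrow> y = (\<lambda>_. 0)"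
  shows "A \<in> GL I"
proof -
  have "inj_on (lin_map I A) (cvec I)"
  proof (rule inj_onI)
    fix x y assume xy: "x \<in> cvec I" "y \<in> cvec I" "lin_map I A x = lin_map I A y"
    then have "lin_map I A (\<lambda>i. x i - y i) = (\<lambda>_. 0)" by (simp add: lin_map_diff)
    with cvec_diff[OF xy(1,2)] have "(\<lambda>i. x i - y i) = (\<lambda>_. 0)" by (rule ker)
    then show "x = y" by (simp add: fun_eq_iff)
  qed
  moreover have "\<exists>y\<in>cvec I. lin_map I A y = x" if x: "x \<in> cvec I" for x
  proof -
    have "\<exists>v. \<forall>s\<in>I. (\<Sum>c\<in>I. A s c * v c) = x s"
    proof (rule square_system_solvable[OF I])
      fix z assume z: "\<forall>s\<in>I. (\<Sum>c\<in>I. A s c * z c) = 0"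
      define z' where "z' i = (if i \<in> I then z i else 0)" for i
      have z': "z' \<in> cvec I" by (simp add: z'_def cvec_def)
      have "lin_map I A z' i = (\<Sum>c\<in>I. A i c * z c)" for i
        unfolding lin_map_def by (intro sum.cong) (simp_all add: z'_def)
      then have "lin_map I A z' i = 0" for i
        using z mem[OF z'] by (cases "i \<in> I") (auto simp: cvec_def)
      then have "lin_map I A z' = (\<lambda>_. 0)" by (rule ext)
      with z' have "z' = (\<lambda>_. 0)" by (rule ker)
      then show "\<forall>c\<in>I. z c = 0" by (auto simp: z'_def fun_eq_iff split: if_splits)
    qed
    then obtain v where v: "\<forall>s\<in>I. (\<Sum>c\<in>I. A s c * v c) = x s" by blast
    define y where "y i = (if i \<in> I then v i else 0)" for i
    have y: "y \<in> cvec I" by (simp add: y_def cvec_def)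
    have "lin_map I A y i = (\<Sum>c\<in>I. A i c * v c)" for i
      unfolding lin_map_def by (intro sum.cong) (simp_all add: y_def)
    then have "lin_map I A y i = x i" for i
      using v x mem[OF y] by (cases "i \<in> I") (auto simp: cvec_def)
    then show ?thesis using y by blast
  qed
  ultimately show ?thesis using mem unfolding GL_def bij_betw_def by blast
qed

lemma GL_id: "finite I \<Longrightarrow> (\<lambda>i j. if i = j then 1 else 0) \<in> GL I"
  by (rule GL_I) (simp_all add: lin_map_id)

lemma GL_compose:
  assumes "finite I" "A \<in> GL I" "C \<in> GL I"
  shows "(\<lambda>i j. \<Sum>k\<in>I. A i k * C k j) \<in> GL I"
  using assms by (intro GL_I) (auto simp flip: lin_map_compose intro: GL_mem dest: GL_inj)

lemma GL_scale:
  assumes "finite I" "A \<in> GL I" "c \<noteq> 0"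
  shows "(\<lambda>i j. c * A i j) \<in> GL I"
proof (rule GL_I)
  show "lin_map I (\<lambda>i j. c * A i j) y \<in> cvec I" if "y \<in> cvec I" for y
    using GL_mem[OF assms(2) that] by (simp add: lin_map_scale_matrix cvec_def)
  show "y = (\<lambda>_. 0)" if "y \<in> cvec I" "lin_map I (\<lambda>i j. c * A i j) y = (\<lambda>_. 0)" for y
    using GL_inj[OF assms(2) that(1)] that(2) assms(3) by (simp add: lin_map_scale_matrix fun_eq_iff)
qed (fact assms)

text \<open>\<open>T\<close> is the inverse of \<open>A\<close> after \<open>C\<close>, built column
  by column from the images of unit vectors. This compares an arbitrary parametrisation of a
  hyperplane with the chosen chart; with \<open>C\<close> the identity it inverts
  \<open>A\<close>.\<close>

lemma lin_map_factor:
  assumes I: "finite I" and A: "bij_betw (lin_map I A) (cvec I) X"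
    and mem: "\<And>y. y \<in> cvec I \<Longrightarrow> lin_map I C y \<in> X"
    and ker: "\<And>y. y \<in> cvec I \<Longrightarrow> lin_map I C y = (\<lambda>_. 0) \<Longrightarrow> y = (\<lambda>_. 0)"
  shows "\<exists>T\<in>GL I. \<forall>y\<in>cvec I. lin_map I C y = lin_map I A (lin_map I T y)"
proof -
  define u where "u j = (\<lambda>k. if k = j then 1 else 0 :: complex)" for j :: 'a
  define T where "T i j = (if j \<in> I then inv_into (cvec I) (lin_map I A) (lin_map I C (u j)) i else 0)" for i j
  have Tu: "(\<lambda>i. T i j) \<in> cvec I" "lin_map I A (\<lambda>i. T i j) = lin_map I C (u j)" if "j \<in> I" for j
  proof -
    have "u j \<in> cvec I" using that by (auto simp: u_def cvec_def)
    then have "lin_map I C (u j) \<in> lin_map I A ` cvec I" using mem A by (simp add: bij_betw_def)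
    then show "(\<lambda>i. T i j) \<in> cvec I" "lin_map I A (\<lambda>i. T i j) = lin_map I C (u j)"
      using that inv_into_into[of "lin_map I C (u j)" "lin_map I A" "cvec I"]
        f_inv_into_f[of "lin_map I C (u j)" "lin_map I A" "cvec I"] by (simp_all add: T_def)
  qed
  have eq: "lin_map I C y = lin_map I A (lin_map I T y)" for y
  proof
    fix i
    have "lin_map I A (lin_map I T y) i = (\<Sum>j\<in>I. lin_map I A (\<lambda>k. T k j) i * y j)"
      unfolding lin_map_compose by (simp add: lin_map_def)
    also have "\<dots> = (\<Sum>j\<in>I. C i j * y j)"
      using I by (intro sum.cong) (simp_all add: Tu u_def lin_map_unit)
    finally show "lin_map I C y i = lin_map I A (lin_map I T y) i" by (simp add: lin_map_def)
  qed
  have "T \<in> GL I"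
  proof (rule GL_I[OF I])
    show "lin_map I T y \<in> cvec I" for y using Tu(1) by (auto simp: lin_map_def cvec_def)
    show "y = (\<lambda>_. 0)" if "y \<in> cvec I" "lin_map I T y = (\<lambda>_. 0)" for y
      using ker[OF that(1)] eq[of y] that(2) by simp
  qed
  then show ?thesis using eq by blast
qed

lemma GL_inverse:
  assumes I: "finite I" and A: "A \<in> GL I"
  shows "\<exists>T\<in>GL I. \<forall>y\<in>cvec I. lin_map I A (lin_map I T y) = y"
proof -
  have "\<exists>T\<in>GL I. \<forall>y\<in>cvec I. lin_map I (\<lambda>i j. if i = j then 1 else 0) y = lin_map I A (lin_map I T y)"
    using A I by (intro lin_map_factor[where X = "cvec I"]) (simp_all add: GL_def lin_map_id)
  then show ?thesis using lin_map_id[OF I] by (metis (no_types, lifting))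
qed

text \<open>By surjectivity each coordinate direction is \<open>lin_map I A v\<close> for some
  \<open>v\<close>, and the derivative of \<open>g\<close> in it at \<open>lin_map I A y\<close> is
  the derivative of the pullback at \<open>y\<close> along \<open>v\<close>. If all partial
  derivatives of the pullback vanish at \<open>y\<close>, so do those of \<open>g\<close> at the
  image, which is nonzero.\<close>

lemma smooth_pullback:
  assumes I: "finite I" and A: "A \<in> GL I" and g: "g \<in> smooth_forms I d"
  shows "lin_pullback I A g \<in> smooth_forms I d"
proof -
  have gf: "g \<in> forms I d" "g \<noteq> 0" and sm: "\<And>x. x \<in> cvec I \<Longrightarrow> x \<noteq> (\<lambda>_. 0) \<Longrightarrow> meval x g = 0 \<Longrightarrow>
      \<exists>i\<in>I. meval x (mpartial i g) \<noteq> 0"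
    using g by (auto simp: smooth_forms_def)
  let ?h = "lin_pullback I A g"
  have hf: "?h \<in> forms I d" using gf(1) by (rule lin_pullback_forms)
  obtain x where x: "x \<in> cvec I" "meval x g \<noteq> 0" using forms_nonzero[OF gf] by blast
  obtain y where "x = lin_map I A y" using GL_surj[OF A x(1)] by blast
  then have "meval y ?h \<noteq> 0" using x by (simp add: meval_lin_pullback)
  then have "?h \<noteq> 0" by auto
  moreover have "\<exists>j\<in>I. meval y (mpartial j ?h) \<noteq> 0"
    if y: "y \<in> cvec I" "y \<noteq> (\<lambda>_. 0)" "meval y ?h = 0" for y
  proof (rule ccontr)
    assume "\<not> ?thesis"
    then have z: "meval y (mpartial j ?h) = 0" if "j \<in> I" for j using that by blast
    let ?x = "lin_map I A y"
    obtain i where i: "i \<in> I" "meval ?x (mpartial i g) \<noteq> 0"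
      using sm[of ?x] GL_mem[OF A y(1)] GL_inj[OF A y(1)] y by (auto simp: meval_lin_pullback)
    define u where "u = (\<lambda>k. if k = i then 1 else 0 :: complex)"
    have "u \<in> cvec I" using i by (auto simp: u_def cvec_def)
    then obtain v where v: "u = lin_map I A v" using GL_surj[OF A] by blast
    have "((\<lambda>t. meval (\<lambda>j. y j + t * v j) ?h) has_field_derivative
        (\<Sum>j\<in>I. v j * meval (\<lambda>j. y j + 0 * v j) (mpartial j ?h))) (at 0)"
      by (rule meval_has_derivative[OF hf I]) (auto intro!: derivative_eq_intros)
    then have 1: "((\<lambda>t. meval (\<lambda>j. y j + t * v j) ?h) has_field_derivative 0) (at 0)"
      using z by simp
    have "((\<lambda>t. meval (\<lambda>j. ?x j + t * u j) g) has_field_derivative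
        (\<Sum>j\<in>I. u j * meval (\<lambda>j. ?x j + 0 * u j) (mpartial j g))) (at 0)"
      by (rule meval_has_derivative[OF gf(1) I]) (auto intro!: derivative_eq_intros)
    moreover have "(\<Sum>j\<in>I. u j * meval (\<lambda>j. ?x j + 0 * u j) (mpartial j g)) = meval ?x (mpartial i g)"
      using i I by (simp add: u_def if_distrib[of "\<lambda>c. c * _"] cong: if_cong)
    moreover have "meval (\<lambda>j. ?x j + t * u j) g = meval (\<lambda>j. y j + t * v j) ?h" for t
      by (simp add: v meval_lin_pullback lin_map_add lin_map_scale)
    ultimately have "((\<lambda>t. meval (\<lambda>j. y j + t * v j) ?h) has_field_derivative meval ?x (mpartial i g)) (at 0)"
      by simp
    then show False using DERIV_unique[OF 1] i by simp
  qed
  ultimately show ?thesis using hf by (simp add: smooth_forms_def)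
qed

text \<open>A form pulled back along a noninjective map is a cone, singular at every kernel vector.\<close>

lemma smooth_imp_injective:
  assumes I: "finite I" and f: "f \<in> forms K d" and d: "d \<ge> 2"
    and g: "lin_pullback I M f \<in> smooth_forms I d"
    and y: "y \<in> cvec I" "\<And>i. i \<in> K \<Longrightarrow> lin_map I M y i = 0"
  shows "y = (\<lambda>_. 0)"
proof (rule ccontr)
  assume "y \<noteq> (\<lambda>_. 0)"
  let ?g = "lin_pullback I M f"
  have gf: "?g \<in> forms I d" using f by (rule lin_pullback_forms)
  have "meval y ?g = meval (\<lambda>i. 0 * lin_map I M y i) f"
    unfolding meval_lin_pullback by (rule meval_cong[OF f]) (simp add: y)
  also have "\<dots> = 0" unfolding meval_scale[OF f] using d by simp
  finally obtain j where j: "j \<in> I" "meval y (mpartial j ?g) \<noteq> 0"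
    using g y(1) \<open>y \<noteq> _\<close> by (auto simp: smooth_forms_def)
  define u where "u = (\<lambda>k. if k = j then 1 else 0 :: complex)"
  have "((\<lambda>t. meval (\<lambda>j. y j + t * u j) ?g) has_field_derivative
      (\<Sum>j\<in>I. u j * meval (\<lambda>j. y j + 0 * u j) (mpartial j ?g))) (at 0)"
    by (rule meval_has_derivative[OF gf I]) (auto intro!: derivative_eq_intros)
  moreover have "(\<Sum>k\<in>I. u k * meval (\<lambda>j. y j + 0 * u j) (mpartial k ?g)) = meval y (mpartial j ?g)"
    using j I by (simp add: u_def if_distrib[of "\<lambda>c. c * _"] cong: if_cong)
  \<comment> \<open>Because \<open>y\<close> is killed, moving from it by \<open>t * u\<close> only
    scales the image of \<open>u\<close> by \<open>t\<close>; the factor \<open>t ^ d\<close> has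
    zero derivative at 0 as \<open>d \<ge> 2\<close>.\<close>
  moreover have "meval (\<lambda>j. y j + t * u j) ?g = t ^ d * meval (lin_map I M u) f" for t
  proof -
    have "meval (\<lambda>j. y j + t * u j) ?g = meval (\<lambda>i. t * lin_map I M u i) f"
      unfolding meval_lin_pullback lin_map_add lin_map_scale by (rule meval_cong[OF f]) (simp add: y)
    then show ?thesis by (simp add: meval_scale[OF f])
  qed
  ultimately have "((\<lambda>t. t ^ d * meval (lin_map I M u) f) has_field_derivative meval y (mpartial j ?g)) (at 0)"
    by simp
  moreover have "((\<lambda>t. t ^ d * meval (lin_map I M u) f) has_field_derivative 0) (at 0)"
    using d by (auto intro!: derivative_eq_intros simp: power_0_left)
  ultimately show False using DERIV_unique j(2) by blast
qed

section \<open>Hyperplanes and their charts\<close>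

lemma hyperplane_pline:
  "hyperplane n (pline a) = {x \<in> cvec {..n}. (\<Sum>i\<le>n. a i * x i) = 0}"
proof -
  have "(\<Sum>i\<le>n. c * a i * x i) = c * (\<Sum>i\<le>n. a i * x i)" for c x
    by (simp add: sum_distrib_left mult.assoc)
  moreover have "a \<in> pline a" unfolding pline_def by (rule image_eqI[of _ _ 1]) auto
  ultimately show ?thesis unfolding hyperplane_def by (auto simp: pline_def)
qed

lemma hyperplane_inj: "inj_on (hyperplane n) (proj_space {..n})"
proof (rule inj_onI)
  fix H H' assume H: "H \<in> proj_space {..n}" "H' \<in> proj_space {..n}" and eq: "hyperplane n H = hyperplane n H'"
  obtain a where a: "H = pline a" "a \<in> cvec {..n}" "a \<noteq> (\<lambda>_. 0)" using H by (auto simp: proj_space_def)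
  obtain b where b: "H' = pline b" "b \<in> cvec {..n}" "b \<noteq> (\<lambda>_. 0)" using H by (auto simp: proj_space_def)
  obtain k where k: "k \<le> n" "a k \<noteq> 0" using a by (auto simp: cvec_def fun_eq_iff)
  have ratio: "a k * b i = a i * b k" for i
  proof (cases "i \<le> n \<and> i \<noteq> k")
    case True
    \<comment> \<open>This vector lies on the hyperplane of \<open>a\<close>; lying on that of
      \<open>b\<close> is the asserted proportionality.\<close>
    define x where "x j = (if j = i then a k else 0) - (if j = k then a i else 0)" for j
    have s: "(\<Sum>j\<le>n. c j * x j) = c i * a k - c k * a i" for c
      using True k by (simp add: x_def right_diff_distrib sum_subtractf if_distrib[of "(*) _"] cong: if_cong)
    have "x \<in> cvec {..n}" using True k by (auto simp: x_def cvec_def)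
    then have "x \<in> hyperplane n H" unfolding a(1) hyperplane_pline by (simp add: s)
    then have "x \<in> hyperplane n H'" using eq by simp
    then show ?thesis unfolding b(1) hyperplane_pline by (simp add: s mult.commute)
  next
    case False
    then show ?thesis using a(2) b(2) by (auto simp: cvec_def)
  qed
  have bk: "b k \<noteq> 0"
  proof
    assume "b k = 0"
    then have "b = (\<lambda>_. 0)" using ratio k by (auto simp: fun_eq_iff)
    then show False using b(3) by simp
  qed
  define r where "r = b k / a k"
  have r: "r \<noteq> 0" "b = (\<lambda>i. r * a i)" "a = (\<lambda>i. (1 / r) * b i)"
    using ratio k bk by (auto simp: r_def fun_eq_iff field_simps)
  have sub: "pline y \<subseteq> pline x" if "y = (\<lambda>i. q * x i)" for x y :: "nat \<Rightarrow> complex" and q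
    unfolding pline_def that
  proof (rule image_subsetI)
    fix c show "(\<lambda>i. c * (q * x i)) \<in> range (\<lambda>c i. c * x i)"
      by (rule range_eqI[of _ _ "c * q"]) (simp add: mult.assoc)
  qed
  have "pline a = pline b" using sub[OF r(2)] sub[OF r(3)] by blast
  then show "H = H'" using a b by blast
qed

text \<open>The chart is a \<open>SOME\<close>, so one isomorphism has to be exhibited: the equation
  is solved for a coordinate \<open>k\<close> with \<open>a k \<noteq> 0\<close>, and the others
  serve as parameters.\<close>

lemma hyperplane_chart_bij:
  assumes H: "H \<in> proj_space {..n}"
  shows "bij_betw (lin_map {1..n} (hyperplane_chart n H)) (cvec {1..n}) (hyperplane n H)"
proof -
  obtain a where a: "H = pline a" "a \<in> cvec {..n}" "a \<noteq> (\<lambda>_. 0)" using H by (auto simp: proj_space_def)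
  obtain k where k: "k \<le> n" "a k \<noteq> 0" using a by (auto simp: cvec_def fun_eq_iff)
  \<comment> \<open>The increasing enumeration of the indices other than \<open>k\<close>, starting
    from 1.\<close>
  define \<sigma> where "\<sigma> j = (if j \<le> k then j - 1 else j)" for j :: nat
  have \<sigma>: "bij_betw \<sigma> {1..n} ({..n} - {k})"
    by (rule bij_betw_byWitness[where f' = "\<lambda>i. if i < k then i + 1 else i"])
       (use k in \<open>auto simp: \<sigma>_def\<close>)
  define A where "A i j = (if i = k then - a (\<sigma> j) / a k else if i = \<sigma> j then 1 else 0)" for i j
  have A\<sigma>: "lin_map {1..n} A y (\<sigma> j) = y j" if "j \<in> {1..n}" for y j
  proof -
    have "\<sigma> j \<noteq> k" using \<sigma> that by (auto simp: bij_betw_def)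
    then have "lin_map {1..n} A y (\<sigma> j) = (\<Sum>l\<in>{1..n}. if l = j then y l else 0)"
      unfolding lin_map_def A_def using \<sigma> that
      by (intro sum.cong) (auto simp: bij_betw_def dest: inj_onD)
    then show ?thesis using that by simp
  qed
  have Ak: "a k * lin_map {1..n} A y k = - (\<Sum>j\<in>{1..n}. a (\<sigma> j) * y j)" for y
    using k by (simp add: lin_map_def A_def sum_distrib_left sum_negf)
  have tot: "(\<Sum>i\<le>n. a i * x i) = a k * x k + (\<Sum>j\<in>{1..n}. a (\<sigma> j) * x (\<sigma> j))" for x
  proof -
    have "(\<Sum>i\<le>n. a i * x i) = a k * x k + (\<Sum>i\<in>{..n} - {k}. a i * x i)"
      using k by (subst sum.remove[of _ k]) auto
    then show ?thesis using sum.reindex_bij_betw[OF \<sigma>, of "\<lambda>i. a i * x i"] by simp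
  qed
  have mem: "lin_map {1..n} A y \<in> hyperplane n H" for y
  proof -
    have "lin_map {1..n} A y i = 0" if "i \<notin> {..n}" for i
    proof -
      have "i \<noteq> k" "i \<noteq> \<sigma> j" if "j \<in> {1..n}" for j
        using \<sigma> k that \<open>i \<notin> {..n}\<close> by (auto simp: bij_betw_def)
      then show ?thesis unfolding lin_map_def A_def by (intro sum.neutral) auto
    qed
    moreover have "(\<Sum>j\<in>{1..n}. a (\<sigma> j) * lin_map {1..n} A y (\<sigma> j)) = (\<Sum>j\<in>{1..n}. a (\<sigma> j) * y j)"
      by (intro sum.cong refl) (simp only: A\<sigma>)
    ultimately show ?thesis
      unfolding a(1) hyperplane_pline cvec_def tot using Ak[of y] by (simp del: One_nat_def)
  qed
  have "bij_betw (lin_map {1..n} A) (cvec {1..n}) (hyperplane n H)"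
  proof (rule bij_betw_byWitness[where f' = "\<lambda>x j. if j \<in> {1..n} then x (\<sigma> j) else 0"])
    show "\<forall>y\<in>cvec {1..n}. (\<lambda>j. if j \<in> {1..n} then lin_map {1..n} A y (\<sigma> j) else 0) = y"
      by (auto simp: A\<sigma>[simplified] cvec_def fun_eq_iff)
    show "\<forall>x\<in>hyperplane n H. lin_map {1..n} A (\<lambda>j. if j \<in> {1..n} then x (\<sigma> j) else 0) = x"
    proof
      fix x assume x: "x \<in> hyperplane n H"
      define y where "y j = (if j \<in> {1..n} then x (\<sigma> j) else 0)" for j
      have "lin_map {1..n} A y i = x i" for i
      proof -
        consider "i = k" | j where "j \<in> {1..n}" "i = \<sigma> j" | "i \<notin> {..n}"
          using bij_betw_imp_surj_on[OF \<sigma>] by blast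
        then show ?thesis
        proof cases
          case 1
          have "a k * lin_map {1..n} A y k = - (\<Sum>j\<in>{1..n}. a (\<sigma> j) * x (\<sigma> j))"
            unfolding Ak by (rule arg_cong[where f = uminus], rule sum.cong) (simp_all add: y_def)
          also have "\<dots> = a k * x k" using x unfolding a(1) hyperplane_pline tot
            by (simp add: add_eq_0_iff del: One_nat_def)
          finally show ?thesis using k 1 by simp
        next
          case 2
          then show ?thesis by (simp add: A\<sigma>[simplified] y_def)
        next
          case 3
          then show ?thesis using mem[of y] x by (simp add: hyperplane_def cvec_def)
        qed
      qed
      then show "lin_map {1..n} A (\<lambda>j. if j \<in> {1..n} then x (\<sigma> j) else 0) = x"
        unfolding y_def[abs_def] by (rule ext)
    qed
    show "lin_map {1..n} A ` cvec {1..n} \<subseteq> hyperplane n H" using mem by blast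
    show "(\<lambda>x j. if j \<in> {1..n} then x (\<sigma> j) else 0) ` hyperplane n H \<subseteq> cvec {1..n}"
      by (auto simp: cvec_def)
  qed
  then have "\<exists>A. bij_betw (lin_map {1..n} A) (cvec {1..n}) (hyperplane n H)" by blast
  from someI_ex[OF this] show ?thesis unfolding hyperplane_chart_def .
qed

text \<open>A vector orthogonal to the \<open>n\<close> columns solves \<open>n\<close> equations in
  \<open>n + 1\<close> unknowns, so a nonzero one exists.\<close>

lemma image_in_hyperplane:
  "\<exists>H\<in>proj_space {..n}. \<forall>x\<in>cvec {..n}. (\<exists>y. x = lin_map {1..n} M y) \<longrightarrow> x \<in> hyperplane n H"
proof -
  obtain z where z: "\<exists>i\<in>{..n}. z i \<noteq> 0" "\<And>j. j \<in> {1..n} \<Longrightarrow> (\<Sum>i\<in>{..n}. M i j * z i) = 0"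
    using underdetermined[of "{1..n}" "{..n}" "\<lambda>j i. M i j"] by force
  define a where "a i = (if i \<le> n then z i else 0)" for i
  have a: "a \<in> cvec {..n}" "a \<noteq> (\<lambda>_. 0)" using z(1) by (auto simp: a_def cvec_def fun_eq_iff)
  have "(\<Sum>i\<le>n. a i * lin_map {1..n} M y i) = 0" for y
  proof -
    have "(\<Sum>i\<le>n. a i * lin_map {1..n} M y i) = (\<Sum>j\<in>{1..n}. (\<Sum>i\<in>{..n}. M i j * z i) * y j)"
      unfolding lin_map_def sum_distrib_left sum_distrib_right
      by (subst sum.swap) (auto simp: a_def mult_ac intro!: sum.cong)
    then show ?thesis using z(2) by simp
  qed
  then show ?thesis using a by (intro bexI[of _ "pline a"]) (auto simp: hyperplane_pline proj_space_def)
qed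

section \<open>Orbits and open sets\<close>

lemma pline_self: "x \<in> pline x"
  unfolding pline_def by (rule image_eqI[of _ _ 1]) auto

lemma form_point_eqD:
  assumes "form_point f = form_point g"
  shows "\<exists>c. \<forall>x. meval x g = c * meval x f"
proof -
  have "lookup g \<in> form_point f" using assms pline_self[of "lookup g"] by (simp add: form_point_def)
  then obtain c where "lookup g = (\<lambda>m. c * lookup f m)" by (auto simp: form_point_def pline_def)
  then have g: "lookup g m = c * lookup f m" for m by simp
  then have "keys g \<subseteq> keys f" by (auto simp: in_keys_iff)
  then have "meval x g = c * meval x f" for x
    by (subst meval_superset[of "keys f" g]) (simp_all add: g meval_eq sum_distrib_left mult.assoc)
  then show ?thesis by blast
qed

lemma form_point_proj:
  assumes "f \<in> forms I d" "f \<noteq> 0"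
  shows "form_point f \<in> proj_space (monomials I d)"
proof -
  have "lookup f \<in> cvec (monomials I d)"
    using assms(1) by (auto simp: cvec_def forms_def subset_iff in_keys_iff)
  moreover have "lookup f \<noteq> (\<lambda>_. 0)" using assms(2) by (auto simp: poly_mapping_eq_iff fun_eq_iff)
  ultimately show ?thesis by (simp add: form_point_def proj_space_def)
qed

lemma smooth_locus_proj: "smooth_locus I d \<subseteq> proj_space (monomials I d)"
  by (auto simp: smooth_locus_def smooth_forms_def form_point_proj)

lemma nonvanishing_open:
  assumes "F \<in> forms K e"
  shows "openin (zariski K) {p \<in> proj_space K. \<exists>x\<in>p. meval x F \<noteq> 0}"
  unfolding openin_zariski zariski_open_def
  by (rule exI[of _ "{F}"]) (use assms in \<open>auto simp: zero_locus_def\<close>)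

lemma nonvanishing_form_point:
  assumes "F \<in> forms K e"
  shows "(\<exists>x\<in>form_point f. meval x F \<noteq> 0) \<longleftrightarrow> meval (lookup f) F \<noteq> 0"
proof
  assume "\<exists>x\<in>form_point f. meval x F \<noteq> 0"
  then show "meval (lookup f) F \<noteq> 0"
    by (auto simp: form_point_def pline_def meval_scale[OF assms])
next
  assume "meval (lookup f) F \<noteq> 0"
  then show "\<exists>x\<in>form_point f. meval x F \<noteq> 0" using pline_self[of "lookup f"] by (auto simp: form_point_def)
qed

text \<open>By the identity matrix \<open>g'\<close> represents a point of its own orbit, hence of
  that of \<open>g\<close>. The scalar remains because a point fixes a form only up to a
  factor.\<close>

lemma pgl_orbit_eqD:
  assumes I: "finite I" and g': "g' \<in> forms I d" "g' \<noteq> 0"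
    and eq: "pgl_orbit I (form_point g') = pgl_orbit I (form_point g)"
  shows "\<exists>A\<in>GL I. \<exists>c. c \<noteq> 0 \<and> (\<forall>x. meval x g' = c * meval (lin_map I A x) g)"
proof -
  have "lin_pullback I (\<lambda>i j. if i = j then 1 else 0) g' = g'"
    using I g'(1) by (intro forms_eqI[of _ I d] lin_pullback_forms) (simp_all add: meval_lin_pullback lin_map_id)
  then have "form_point g' \<in> pgl_orbit I (form_point g')"
    unfolding pgl_orbit_def using GL_id[OF I] by (smt (verit) mem_Collect_eq)
  then obtain A h where A: "A \<in> GL I" "form_point (lin_pullback I A h) = form_point g'" "form_point g = form_point h"
    unfolding eq by (auto simp: pgl_orbit_def)
  obtain c where c: "\<And>x. meval x g' = c * meval x (lin_pullback I A h)" using form_point_eqD[OF A(2)] by blast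
  obtain b where b: "\<And>x. meval x h = b * meval x g" using form_point_eqD[OF A(3)] by blast
  have cb: "meval x g' = (c * b) * meval (lin_map I A x) g" for x
    by (simp add: c b meval_lin_pullback)
  moreover have "c * b \<noteq> 0"
  proof
    assume "c * b = 0"
    then have "meval x g' = 0" for x using cb by simp
    then show False using meval_nonzero[OF g'(2)] by blast
  qed
  ultimately show ?thesis using A(1) by blast
qed

section \<open>Families of polynomials\<close>

text \<open>The range of summation contains all divisors of \<open>\<mu>\<close> and depends on
  \<open>\<mu>\<close> alone. As \<open>p\<close> and \<open>q\<close> vary with parameters, the
  same finite sum expresses the coefficient, although their supports change.\<close>

lemma lookup_mult_divisors:
  fixes p q :: "'v mpoly"
  defines "\<Delta> \<equiv> \<lambda>\<mu>. \<Union>e\<le>mdeg \<mu>. monomials (keys \<mu>) e"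
  shows "lookup (p * q) \<mu> = (\<Sum>k\<in>\<Delta> \<mu>. \<Sum>l\<in>\<Delta> \<mu>. if k + l = \<mu> then lookup p k * lookup q l else 0)"
proof -
  have fin: "finite (\<Delta> \<mu>)" by (simp add: \<Delta>_def finite_monomials)
  have div: "k \<in> \<Delta> (k + l)" "l \<in> \<Delta> (k + l)" for k l :: "'v \<Rightarrow>\<^sub>0 nat"
    by (auto simp: \<Delta>_def monomials_def mdeg_add in_keys_iff lookup_add)
  show ?thesis
  proof (induction p rule: mpoly_single_add_induct)
    case (single m c)
    show ?case
    proof (induction q rule: mpoly_single_add_induct)
      case (single m' c')
      have "(\<Sum>k\<in>\<Delta> \<mu>. \<Sum>l\<in>\<Delta> \<mu>. if k + l = \<mu> then lookup (single m c) k * lookup (single m' c') l else 0)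
        = (\<Sum>k\<in>\<Delta> \<mu>. \<Sum>l\<in>\<Delta> \<mu>. if l = m' then if k = m then if m + m' = \<mu> then c * c' else 0 else 0 else 0)"
        by (intro sum.cong refl) (auto simp: lookup_single when_def)
      also have "\<dots> = (if m + m' = \<mu> then c * c' else 0)"
        using fin div(1)[of m m'] div(2)[of m' m] by (auto simp: sum.delta intro!: sum.neutral)
      finally show ?case by (simp add: mult_single lookup_single when_def)
    next
      case (add f g)
      have "(\<Sum>k\<in>\<Delta> \<mu>. \<Sum>l\<in>\<Delta> \<mu>. if k + l = \<mu> then lookup (single m c) k * lookup (f + g) l else 0) =
        (\<Sum>k\<in>\<Delta> \<mu>. \<Sum>l\<in>\<Delta> \<mu>. (if k + l = \<mu> then lookup (single m c) k * lookup f l else 0) +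
          (if k + l = \<mu> then lookup (single m c) k * lookup g l else 0))"
        by (intro sum.cong refl) (simp add: lookup_add distrib_left)
      then show ?case using add by (simp add: distrib_left lookup_add sum.distrib)
    qed (simp cong: if_cong)
  next
    case (add f g)
    have "(\<Sum>k\<in>\<Delta> \<mu>. \<Sum>l\<in>\<Delta> \<mu>. if k + l = \<mu> then lookup (f + g) k * lookup q l else 0) =
      (\<Sum>k\<in>\<Delta> \<mu>. \<Sum>l\<in>\<Delta> \<mu>. (if k + l = \<mu> then lookup f k * lookup q l else 0) +
        (if k + l = \<mu> then lookup g k * lookup q l else 0))"
      by (intro sum.cong refl) (simp add: lookup_add distrib_right)
    then show ?case using add by (simp add: distrib_right lookup_add sum.distrib)
  qed (simp cong: if_cong)
qed

text \<open>This notion turns a polynomial condition on the coefficients of a substituted form into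
  a polynomial condition on the matrix of the substitution.\<close>

definition polynomial_family :: "(('s \<Rightarrow> complex) \<Rightarrow> 'v mpoly) \<Rightarrow> bool"
  where "polynomial_family p \<longleftrightarrow> (\<forall>\<mu>. \<exists>P. \<forall>x. lookup (p x) \<mu> = meval x P)"

lemma polynomial_family_const: "polynomial_family (\<lambda>x. q)"
  unfolding polynomial_family_def
proof
  fix \<mu> show "\<exists>P. \<forall>x. lookup q \<mu> = meval x P"
    by (rule exI[of _ "single 0 (lookup q \<mu>)"]) simp
qed

lemma polynomial_family_var: "polynomial_family (\<lambda>x. single 0 (x i))"
  unfolding polynomial_family_def
proof
  fix \<mu> :: "'b \<Rightarrow>\<^sub>0 nat"
  show "\<exists>P. \<forall>x. lookup (single 0 (x i)) \<mu> = meval x P"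
    by (rule exI[of _ "if \<mu> = 0 then mvar i else 0"]) (simp add: lookup_single when_def)
qed

lemma polynomial_family_add:
  assumes "polynomial_family p" "polynomial_family q"
  shows "polynomial_family (\<lambda>x. p x + q x)"
  unfolding polynomial_family_def
proof
  fix \<mu>
  obtain P Q where "\<forall>x. lookup (p x) \<mu> = meval x P" "\<forall>x. lookup (q x) \<mu> = meval x Q"
    using assms unfolding polynomial_family_def by blast
  then show "\<exists>P. \<forall>x. lookup (p x + q x) \<mu> = meval x P"
    by (intro exI[of _ "P + Q"]) (simp add: lookup_add)
qed

lemma polynomial_family_mult:
  fixes p q :: "('s \<Rightarrow> complex) \<Rightarrow> 'v mpoly"
  assumes "polynomial_family p" "polynomial_family q"
  shows "polynomial_family (\<lambda>x. p x * q x)"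
  unfolding polynomial_family_def
proof
  fix \<mu> :: "'v \<Rightarrow>\<^sub>0 nat"
  obtain P where P: "\<And>k x. lookup (p x) k = meval x (P k)"
    using assms(1) unfolding polynomial_family_def by metis
  obtain Q where Q: "\<And>k x. lookup (q x) k = meval x (Q k)"
    using assms(2) unfolding polynomial_family_def by metis
  let ?\<Delta> = "\<Union>e\<le>mdeg \<mu>. monomials (keys \<mu>) e"
  show "\<exists>R. \<forall>x. lookup (p x * q x) \<mu> = meval x R"
    by (rule exI[of _ "\<Sum>k\<in>?\<Delta>. \<Sum>l\<in>?\<Delta>. if k + l = \<mu> then P k * Q l else 0"])
       (simp add: lookup_mult_divisors P Q if_distrib[of "meval _"] cong: if_cong)
qed

lemma polynomial_family_sum:
  "(\<And>a. a \<in> A \<Longrightarrow> polynomial_family (p a)) \<Longrightarrow> polynomial_family (\<lambda>x. \<Sum>a\<in>A. p a x)"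
  by (induction A rule: infinite_finite_induct)
     (simp_all add: polynomial_family_add polynomial_family_const)

lemma polynomial_family_power: "polynomial_family p \<Longrightarrow> polynomial_family (\<lambda>x. p x ^ k)"
  by (induction k) (simp_all add: polynomial_family_mult polynomial_family_const)

lemma polynomial_family_prod:
  "(\<And>a. a \<in> A \<Longrightarrow> polynomial_family (p a)) \<Longrightarrow> polynomial_family (\<lambda>x. \<Prod>a\<in>A. p a x)"
  by (induction A rule: infinite_finite_induct)
     (simp_all add: polynomial_family_mult polynomial_family_const)

lemma polynomial_family_lin_pullback:
  "polynomial_family (\<lambda>M. lin_pullback J (\<lambda>i j. M (i, j)) f)"
  unfolding lin_pullback_def msubst_def eval_with_def
  by (intro polynomial_family_sum polynomial_family_mult polynomial_family_prod polynomial_family_power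
      polynomial_family_var polynomial_family_const)

section \<open>A form without linear syzygies\<close>

text \<open>The monomials of a form \<open>q\<close> of degree \<open>d - 1\<close> on which multiplication from linear forms to the
  degree \<open>d\<close> part of \<open>\<complex>[x\<^sub>1, \<dots>, x\<^sub>n] / (x\<^sub>i\<^sup>d\<^sup>-\<^sup>1)\<close> is injective: the single
  monomial \<open>x\<^sub>1\<^sup>d\<^sup>-\<^sup>3 x\<^sub>2 x\<^sub>3\<close> for \<open>d \<ge> 4\<close>, and \<open>x\<^sub>1 x\<^sub>2 + x\<^sub>3 x\<^sub>4\<close> for \<open>d = 3\<close>. The
  coefficient of the linear form at \<open>x\<^sub>j\<close> is read off at the monomial \<open>w j * x\<^sub>j\<close>.\<close>

lemma injective_multiplier:
  assumes "(d = 3 \<and> n \<ge> 5) \<or> (d \<ge> 4 \<and> n \<ge> 3)"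
  shows "\<exists>Q w. finite Q \<and> Q \<subseteq> monomials {1..n} (d - 1) \<and>
    (\<forall>j\<in>{1..n::nat}. w j \<in> Q \<and> (\<forall>i. lookup (w j + single j 1) i \<le> d - 2) \<and>
      (\<forall>q\<in>Q. \<forall>k\<in>{1..n}. q + single k 1 = w j + single j 1 \<longrightarrow> q = w j \<and> k = j))"
proof (cases "d = 3")
  case True
  then have n: "n \<ge> 5" using assms by auto
  define q1 where "q1 = (single 1 1 + single 2 1 :: nat \<Rightarrow>\<^sub>0 nat)"
  define q2 where "q2 = (single 3 1 + single 4 1 :: nat \<Rightarrow>\<^sub>0 nat)"
  have l1: "lookup q1 i = (if i = 1 \<or> i = 2 then 1 else 0)" for i
    by (auto simp: q1_def lookup_add lookup_single when_def)
  have l2: "lookup q2 i = (if i = 3 \<or> i = 4 then 1 else 0)" for i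
    by (auto simp: q2_def lookup_add lookup_single when_def)
  have mon: "{q1, q2} \<subseteq> monomials {1..n} (d - 1)"
    using n True by (auto simp: monomials_def mdeg_add q1_def q2_def in_keys_iff lookup_add lookup_single when_def
        split: if_splits)
  have ne: "q1 + single k 1 \<noteq> q2 + single j 1" for k j
  proof
    assume "q1 + single k 1 = q2 + single j 1"
    then have *: "lookup (q1 + single k 1) i = lookup (q2 + single j 1) i" for i by simp
    from *[of 3] *[of 4] show False by (auto simp: lookup_add l1 l2 lookup_single when_def split: if_splits)
  qed
  have inj: "q + single k 1 = q + single j 1 \<Longrightarrow> k = j" for q :: "nat \<Rightarrow>\<^sub>0 nat" and k j :: nat
    by (metis add_left_cancel lookup_single_eq lookup_single_not_eq zero_neq_one)
  \<comment> \<open>Modulo squares, \<open>q1\<close> annihilates the first two variables and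
    \<open>q2\<close> the third and fourth. The coefficient at \<open>j\<close> is therefore read
    off from a monomial that does not contain the \<open>j\<close>-th variable.\<close>
  show ?thesis
  proof (intro exI[of _ "{q1, q2}"] exI[of _ "\<lambda>j. if j \<le> 2 then q2 else q1"] conjI ballI mon)
    fix j assume "j \<in> {1..n}"
    show "\<forall>i. lookup ((if j \<le> 2 then q2 else q1) + single j 1) i \<le> d - 2"
      using True \<open>j \<in> _\<close> by (auto simp: lookup_add l1 l2 lookup_single when_def)
    fix q k assume "q \<in> {q1, q2}"
    then show "q + single k 1 = (if j \<le> 2 then q2 else q1) + single j 1 \<longrightarrow>
        q = (if j \<le> 2 then q2 else q1) \<and> k = j"
      using ne[of k j] ne[of j k] inj[of q k j] by (auto split: if_splits)
  qed auto
next
  case False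
  then have d: "d \<ge> 4" and n: "n \<ge> 3" using assms by auto
  \<comment> \<open>After multiplication by any variable the exponents \<open>d - 3\<close>, 1, 1
    stay at most \<open>d - 2\<close>; the increase from 1 to 2 needs
    \<open>d \<ge> 4\<close>.\<close>
  define q where "q = (single 1 (d - 3) + single 2 1 + single 3 1 :: nat \<Rightarrow>\<^sub>0 nat)"
  have l: "lookup q i = (if i = 1 then d - 3 else if i = 2 \<or> i = 3 then 1 else 0)" for i
    by (auto simp: q_def lookup_add lookup_single when_def)
  have mon: "{q} \<subseteq> monomials {1..n} (d - 1)"
    using n d by (auto simp: monomials_def mdeg_add q_def in_keys_iff lookup_add lookup_single when_def
        split: if_splits)
  have inj: "q + single k 1 = q + single j 1 \<Longrightarrow> k = j" for k j :: nat
    by (metis add_left_cancel lookup_single_eq lookup_single_not_eq zero_neq_one)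
  show ?thesis
    by (intro exI[of _ "{q}"] exI[of _ "\<lambda>j. q"] conjI ballI mon)
       (use d inj in \<open>auto simp: lookup_add l lookup_single when_def\<close>)
qed

text \<open>On \<open>x_0 = 0\<close> the derivatives of \<open>f\<close> are \<open>q\<close> for
  \<open>i = 0\<close> and \<open>d * x_i ^ (d - 1)\<close> otherwise, and \<open>v (i, j)\<close>
  is the coefficient of \<open>x_j\<close> in a linear form \<open>l_i\<close>. In a relation
  between them \<open>l_0 * q\<close> lies in the ideal of the powers \<open>x_i ^ (d - 1)\<close>,
  which forces \<open>l_0 = 0\<close>; the remaining products of these powers with variables are
  distinct monomials.\<close>

lemma no_linear_syzygies:
  fixes n d :: nat
  assumes nd: "(d = 3 \<and> n \<ge> 5) \<or> (d \<ge> 4 \<and> n \<ge> 3)"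
  shows "\<exists>f\<in>forms {..n} d. \<forall>v. (\<forall>y\<in>cvec {1..n}. (\<Sum>i\<le>n. \<Sum>j\<in>{1..n}. y j * meval y (mpartial i f) * v (i, j)) = 0)
    \<longrightarrow> (\<forall>b\<in>{..n} \<times> {1..n}. v b = 0)"
proof -
  have d: "d \<ge> 3" using nd by auto
  obtain Q w where "finite Q \<and> Q \<subseteq> monomials {1..n} (d - 1) \<and>
    (\<forall>j\<in>{1..n::nat}. w j \<in> Q \<and> (\<forall>i. lookup (w j + single j 1) i \<le> d - 2) \<and>
      (\<forall>q\<in>Q. \<forall>k\<in>{1..n}. q + single k 1 = w j + single j 1 \<longrightarrow> q = w j \<and> k = j))"
    using injective_multiplier[OF nd] by (elim exE)
  then have Q: "finite Q" "\<And>q. q \<in> Q \<Longrightarrow> q \<in> monomials {1..n} (d - 1)"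
    and w: "\<And>j. j \<in> {1..n} \<Longrightarrow> w j \<in> Q" "\<And>j i. j \<in> {1..n} \<Longrightarrow> lookup (w j + single j 1) i \<le> d - 2"
    "\<And>j q k. j \<in> {1..n} \<Longrightarrow> q \<in> Q \<Longrightarrow> k \<in> {1..n} \<Longrightarrow> q + single k 1 = w j + single j 1 \<Longrightarrow> q = w j \<and> k = j"
    by blast+
  have q0: "lookup q 0 = 0" if "q \<in> Q" for q
  proof -
    have "0 \<notin> keys q" using Q(2)[OF that] by (auto simp: monomials_def)
    then show ?thesis by (simp add: in_keys_iff)
  qed
  define f where "f = (\<Sum>i\<in>{1..n}. single (single i d) 1) + (\<Sum>q\<in>Q. single (single 0 1 + q) (1::complex))"
  have f: "f \<in> forms {..n} d"
  proof -
    have "single 0 1 + q \<in> monomials {..n} d" if "q \<in> Q" for q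
    proof -
      have "q \<in> monomials {..n} (d - 1)"
        using monomials_mono[of "{1..n}" "{..n}" "d - 1"] Q(2)[OF that] by auto
      then have "single 0 1 + q \<in> monomials {..n} (1 + (d - 1))"
        by (intro monomials_add monomials_single) simp
      then show ?thesis using d by simp
    qed
    then show ?thesis unfolding f_def
      by (intro forms_add forms_sum forms_single monomials_single) auto
  qed
  have par: "meval y (mpartial i f) = (if i = 0 then \<Sum>q\<in>Q. mpow y q else of_nat d * y i ^ (d - 1))"
    if y: "y \<in> cvec {1..n}" and i: "i \<in> {..n}" for y i
  proof -
    have y0: "y 0 = 0" using y by (simp add: cvec_def)
    have e: "meval y (mpartial i f) =
        (\<Sum>l\<in>{1..n}. of_nat (lookup (single l d) i) * mpow y (single l d - single i 1)) +
        (\<Sum>q\<in>Q. of_nat (lookup (single 0 1 + q) i) * mpow y (single 0 1 + q - single i 1))"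
      by (simp add: f_def meval_mpartial_add meval_mpartial_sum meval_mpartial_single)
    show ?thesis
    proof (cases "i = 0")
      case True
      have "(\<Sum>l\<in>{1..n}. of_nat (lookup (single l d) i) * mpow y (single l d - single i 1)) = 0"
        using True by (intro sum.neutral) (auto simp: lookup_single when_def)
      moreover have "(\<Sum>q\<in>Q. of_nat (lookup (single 0 1 + q) i) * mpow y (single 0 1 + q - single i 1))
          = (\<Sum>q\<in>Q. mpow y q)"
        using True q0 by (intro sum.cong refl) (simp add: lookup_add)
      ultimately show ?thesis unfolding e using True by simp
    next
      case False
      have "(\<Sum>l\<in>{1..n}. of_nat (lookup (single l d) i) * mpow y (single l d - single i 1))
          = (\<Sum>l\<in>{1..n}. if l = i then of_nat d * y i ^ (d - 1) else 0)"
      proof (intro sum.cong refl)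
        fix l
        have "single i d - single i 1 = single i (d - 1)" by (simp add: single_diff)
        then show "of_nat (lookup (single l d) i) * mpow y (single l d - single i 1) =
            (if l = i then of_nat d * y i ^ (d - 1) else 0)"
          by (simp add: lookup_single when_def del: One_nat_def)
      qed
      also have "\<dots> = of_nat d * y i ^ (d - 1)" using i False by simp
      finally have 1: "(\<Sum>l\<in>{1..n}. of_nat (lookup (single l d) i) * mpow y (single l d - single i 1))
          = of_nat d * y i ^ (d - 1)" .
      have "(\<Sum>q\<in>Q. of_nat (lookup (single 0 1 + q) i) * mpow y (single 0 1 + q - single i 1)) = 0"
      proof (intro sum.neutral ballI)
        fix q :: "nat \<Rightarrow>\<^sub>0 nat"
        have "lookup (single 0 1 + q - single i 1) 0 \<noteq> 0"
          using False by (simp add: lookup_add lookup_minus lookup_single)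
        then have "mpow y (single 0 1 + q - single i 1) = 0"
          unfolding mpow_def by (intro prod_zero) (auto simp: in_keys_iff y0 intro!: bexI[of _ 0])
        then show "of_nat (lookup (single 0 1 + q) i) * mpow y (single 0 1 + q - single i 1) = 0" by simp
      qed
      then show ?thesis unfolding e 1 using False by simp
    qed
  qed
  have "\<forall>b\<in>{..n} \<times> {1..n}. v b = 0"
    if v: "\<forall>y\<in>cvec {1..n}. (\<Sum>i\<le>n. \<Sum>j\<in>{1..n}. y j * meval y (mpartial i f) * v (i, j)) = 0" for v
  proof -
    define R1 where "R1 = (\<Sum>i\<in>{1..n}. \<Sum>j\<in>{1..n}. single (single i (d - 1) + single j 1) (of_nat d * v (i, j)))"
    define R2 where "R2 = (\<Sum>q\<in>Q. \<Sum>j\<in>{1..n}. single (q + single j 1) (v (0, j)))"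
    have mon1: "m + single j 1 \<in> monomials {1..n} d" if "m \<in> monomials {1..n} (d - 1)" "j \<in> {1..n}" for m j
      using monomials_add[OF that(1) monomials_single[OF that(2), of 1]] d by simp
    have "R1 + R2 \<in> forms {1..n} d"
      unfolding R1_def R2_def
      by (intro forms_add forms_sum forms_single mon1 monomials_single Q(2)) auto
    moreover have "meval y (R1 + R2) = 0" if y: "y \<in> cvec {1..n}" for y
    proof -
      have "{..n} = insert 0 {1..n}" by auto
      then have "(\<Sum>i\<le>n. \<Sum>j\<in>{1..n}. y j * meval y (mpartial i f) * v (i, j)) =
        (\<Sum>j\<in>{1..n}. y j * meval y (mpartial 0 f) * v (0, j)) +
        (\<Sum>i\<in>{1..n}. \<Sum>j\<in>{1..n}. y j * meval y (mpartial i f) * v (i, j))" by simp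
      also have "(\<Sum>j\<in>{1..n}. y j * meval y (mpartial 0 f) * v (0, j)) = meval y R2"
        unfolding R2_def using par[OF y, of 0]
        by (subst sum.swap) (simp add: mpow_add sum_distrib_left sum_distrib_right mult_ac)
      also have "(\<Sum>i\<in>{1..n}. \<Sum>j\<in>{1..n}. y j * meval y (mpartial i f) * v (i, j)) = meval y R1"
        unfolding R1_def meval_sum
        by (intro sum.cong refl) (simp add: par[OF y] mpow_add mult_ac)
      finally show ?thesis using v y by (simp add: add.commute)
    qed
    ultimately have R: "R1 + R2 = 0" by (intro forms_eqI[of _ "{1..n}" d]) auto
    have l1: "lookup R1 \<mu> = (\<Sum>i\<in>{1..n}. \<Sum>j\<in>{1..n}. if single i (d - 1) + single j 1 = \<mu> then of_nat d * v (i, j) else 0)" for \<mu>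
      unfolding R1_def by (simp add: lookup_sum lookup_single when_def)
    have l2: "lookup R2 \<mu> = (\<Sum>q\<in>Q. \<Sum>j\<in>{1..n}. if q + single j 1 = \<mu> then v (0, j) else 0)" for \<mu>
      unfolding R2_def by (simp add: lookup_sum lookup_single when_def)
    \<comment> \<open>All exponents of the monomial at \<open>w j + single j 1\<close> are below
      \<open>d - 1\<close>, so \<open>R1\<close> does not contribute and \<open>R2\<close>
      contributes \<open>v (0, j)\<close> alone.\<close>
    have v0: "v (0, j) = 0" if j: "j \<in> {1..n}" for j
    proof -
      let ?\<mu> = "w j + single j 1"
      have "single i (d - 1) + single k 1 \<noteq> ?\<mu>" for i k
      proof
        assume eq: "single i (d - 1) + single k 1 = ?\<mu>"
        have "lookup (single i (d - 1) + single k 1) i \<ge> d - 1" by (simp add: lookup_add)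
        then show False using w(2)[OF j, of i] d unfolding eq by linarith
      qed
      then have "lookup R1 ?\<mu> = 0" unfolding l1 by simp
      moreover have "lookup R2 ?\<mu> = (\<Sum>q\<in>Q. if q = w j then \<Sum>k\<in>{1..n}. if k = j then v (0, k) else 0 else 0)"
        unfolding l2
      proof (rule sum.cong[OF refl])
        fix q assume q: "q \<in> Q"
        show "(\<Sum>k\<in>{1..n}. if q + single k 1 = ?\<mu> then v (0, k) else 0) =
            (if q = w j then \<Sum>k\<in>{1..n}. if k = j then v (0, k) else 0 else 0)"
        proof (cases "q = w j")
          case True
          have "q + single k 1 = ?\<mu> \<longleftrightarrow> k = j" if "k \<in> {1..n}" for k
            using w(3)[OF j q that] True by blast
          then have "(\<Sum>k\<in>{1..n}. if q + single k 1 = ?\<mu> then v (0, k) else 0) = (\<Sum>k\<in>{1..n}. if k = j then v (0, k) else 0)"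
            by (intro sum.cong refl) (simp only:)
          then show ?thesis using True by (simp only: if_True refl)
        next
          case False
          then have "q + single k 1 \<noteq> ?\<mu>" if "k \<in> {1..n}" for k
            using w(3)[OF j q that] by blast
          then have "(\<Sum>k\<in>{1..n}. if q + single k 1 = ?\<mu> then v (0, k) else 0) = 0"
            by (intro sum.neutral ballI) (simp only: if_False)
          then show ?thesis using False by (simp only: if_False)
        qed
      qed
      moreover have "\<dots> = v (0, j)" using Q(1) w(1)[OF j] j by simp
      moreover have "lookup (R1 + R2) ?\<mu> = 0" unfolding R by simp
      ultimately show ?thesis by (simp add: lookup_add)
    qed
    have vi: "v (i, j) = 0" if i: "i \<in> {1..n}" and j: "j \<in> {1..n}" for i j
    proof -
      \<comment> \<open>Since \<open>d - 1 \<ge> 2\<close>, the index \<open>i\<close> is recognised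
        by its exponent; for quadrics \<open>x_i * x_j\<close> would arise twice.\<close>
      let ?\<mu> = "single i (d - 1) + single j 1"
      have inj: "single i' (d - 1) + single j' 1 = ?\<mu> \<longleftrightarrow> i' = i \<and> j' = j" for i' j'
      proof
        assume eq: "single i' (d - 1) + single j' 1 = ?\<mu>"
        have "i' = i"
        proof (rule ccontr)
          assume "i' \<noteq> i"
          then have "lookup (single i' (d - 1) + single j' 1) i \<le> 1"
            by (simp add: lookup_add lookup_single when_def)
          moreover have "d - 1 \<le> lookup ?\<mu> i" by (simp add: lookup_add)
          ultimately show False using d unfolding eq by linarith
        qed
        moreover from this have "single j' (1::nat) = single j 1" using eq by simp
        then have "j' = j" by (metis lookup_single_eq lookup_single_not_eq zero_neq_one)
        ultimately show "i' = i \<and> j' = j" by simp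
      qed simp
      have "lookup R2 ?\<mu> = 0" unfolding l2 by (intro sum.neutral ballI) (simp add: v0)
      moreover have "lookup R1 ?\<mu> = (\<Sum>i'\<in>{1..n}. if i' = i then \<Sum>j'\<in>{1..n}. if j' = j then of_nat d * v (i', j') else 0 else 0)"
        unfolding l1 inj by (intro sum.cong refl) auto
      moreover have "\<dots> = of_nat d * v (i, j)" using i j by simp
      moreover have "lookup (R1 + R2) ?\<mu> = 0" unfolding R by simp
      ultimately show ?thesis using d by (simp add: lookup_add)
    qed
    show ?thesis
    proof
      fix b assume "b \<in> {..n} \<times> {1..n}"
      then obtain i j where "b = (i, j)" "i \<le> n" "j \<in> {1..n}" by auto
      then show "v b = 0" using v0[of j] vi[of i j] by (cases "i = 0") auto
    qed
  qed
  then show ?thesis using f by blast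
qed

section \<open>Generic finiteness of the section map\<close>

lemma restrict_to_coordinate_hyperplane:
  fixes f :: "nat mpoly"
  assumes f: "f \<in> forms {..n} d" and y: "y \<in> cvec {1..n}"
  shows "meval y f = meval y (\<Sum>m\<in>monomials {1..n} d. single m (lookup f m))"
proof -
  have "meval y f = (\<Sum>m\<in>monomials {..n} d. lookup f m * mpow y m)"
    using f by (rule meval_forms) simp
  also have "\<dots> = (\<Sum>m\<in>monomials {1..n} d. lookup f m * mpow y m)"
  proof (rule sum.mono_neutral_right)
    show "monomials {1..n} d \<subseteq> monomials {..n} d" by (rule monomials_mono) auto
    show "\<forall>m\<in>monomials {..n} d - monomials {1..n} d. lookup f m * mpow y m = 0"
    proof
      fix m assume m: "m \<in> monomials {..n} d - monomials {1..n} d"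
      then have "\<not> keys m \<subseteq> {1..n}" "keys m \<subseteq> {..n}" by (auto simp: monomials_def)
      then obtain i where "i \<in> keys m" "i \<notin> {1..n}" by blast
      then have "mpow y m = 0" unfolding mpow_def using y
        by (intro prod_zero) (auto simp: cvec_def in_keys_iff intro!: bexI[of _ i])
      then show "lookup f m * mpow y m = 0" by simp
    qed
  qed (simp add: finite_monomials)
  finally show ?thesis by simp
qed

text \<open>\<open>jac\<close> says that the values of \<open>f\<close> after \<open>M\<close> at
  the points \<open>\<rho> s\<close>, as many as there are entries of \<open>M\<close>, have an
  invertible Jacobian at the inclusion of \<open>x_0 = 0\<close>. \<open>F\<close> reads only
  coefficients of monomials free of \<open>x_0\<close>, so its condition concerns the restriction of
  \<open>f\<close> to that hyperplane.\<close>

lemma generically_finite_criterion: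
  fixes n d :: nat and f :: "nat mpoly" and \<rho> :: "nat \<times> nat \<Rightarrow> nat \<Rightarrow> complex"
  assumes n: "n \<ge> 1" and d: "d \<ge> 2" and f: "f \<in> forms {..n} d"
    and \<rho>: "\<And>s. s \<in> {..n} \<times> {1..n} \<Longrightarrow> \<rho> s \<in> cvec {1..n}"
    and jac: "\<And>z. \<forall>s\<in>{..n} \<times> {1..n}. (\<Sum>b\<in>{..n} \<times> {1..n}. \<rho> s (snd b) * meval (\<rho> s) (mpartial (fst b) f) * z b) = 0
      \<Longrightarrow> \<forall>b\<in>{..n} \<times> {1..n}. z b = 0"
    and F: "F \<in> forms (monomials {1..n} d) e'" "meval (lookup f) F \<noteq> 0"
    and smooth: "\<And>g. g \<in> forms {1..n} d \<Longrightarrow> meval (lookup g) F \<noteq> 0 \<Longrightarrow> g \<in> smooth_forms {1..n} d"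
  shows "generically_finite_onto_image (smooth_sections n d f) (moduli {1..n} d) (hyperplane_section_map n f)"
proof -
  define I where "I = {1..n}"
  define B where "B = {..n} \<times> I"
  have finI: "finite I" and finB: "finite B" and neB: "B \<noteq> {}" using n by (auto simp: I_def B_def)
  note \<rho> = \<rho>[folded I_def, folded B_def] and jac = jac[folded I_def, folded B_def]
    and F = F[folded I_def] and smooth = smooth[folded I_def]
  define L where "L M y = lin_map I (\<lambda>i j. M (i, j)) y" for M :: "nat \<times> nat \<Rightarrow> complex" and y
  \<comment> \<open>The matrix of the inclusion of the hyperplane \<open>x_0 = 0\<close>.\<close>
  define m0 where "m0 b = (if b \<in> B \<and> fst b = snd b then 1 else 0 :: complex)" for b
  have m0: "m0 \<in> cvec B" by (simp add: m0_def cvec_def)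
  have Lm0: "L m0 y = y" if y: "y \<in> cvec I" for y
  proof
    fix i
    have "L m0 y i = (\<Sum>j\<in>I. if j = i then y j else 0)"
      unfolding L_def lin_map_def by (intro sum.cong refl) (auto simp: m0_def B_def I_def)
    then show "L m0 y i = y i" using y finI by (auto simp: cvec_def)
  qed
  have Ladd: "L (\<lambda>b. M b + t * v b) y = (\<lambda>i. L M y i + t * L v y i)" for M v t y
    by (simp add: L_def lin_map_def distrib_right sum.distrib sum_distrib_left mult.assoc)
  define \<psi> where "\<psi> s = msubst (\<lambda>i. \<Sum>j\<in>I. single 0 (\<rho> s j) * mvar (i, j)) f" for s
  have \<psi>: "meval M (\<psi> s) = meval (L M (\<rho> s)) f" for M s
    by (simp add: \<psi>_def meval_msubst L_def lin_map_def mult.commute)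
  have \<psi>_forms: "\<psi> s \<in> forms B d" for s
  proof -
    have "(\<Sum>j\<in>I. single 0 (\<rho> s j) * mvar (i, j)) \<in> forms B 1" if "i \<in> {..n}" for i
      using that by (intro forms_sum forms_scale forms_mvar) (simp add: B_def)
    then show ?thesis using forms_msubst[OF f, of _ B 1] by (simp add: \<psi>_def)
  qed
  have "\<exists>c e. c \<in> forms B e \<and> c \<noteq> 0 \<and>
      (\<forall>y. meval y c \<noteq> 0 \<longrightarrow> finite {M \<in> cvec B. \<forall>s\<in>B. meval M (\<psi> s) = y s})"
    using d by (intro finite_fibres[OF finB neB finB order_refl _ \<psi>_forms]) simp
  then obtain c e where "c \<in> forms B e \<and> c \<noteq> 0 \<and>
      (\<forall>y. meval y c \<noteq> 0 \<longrightarrow> finite {M \<in> cvec B. \<forall>s\<in>B. meval M (\<psi> s) = y s})"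
    by (elim exE)
  then have c: "c \<in> forms B e" "c \<noteq> 0"
    and fin: "\<And>y. meval y c \<noteq> 0 \<Longrightarrow> finite {M \<in> cvec B. \<forall>s\<in>B. meval M (\<psi> s) = y s}" by simp_all

  \<comment> \<open>Here the relation is shown to be nontrivial on the actual values: straight lines
    through \<open>m0\<close> realise every tangent direction, by \<open>jac\<close>.\<close>
  have "\<exists>M\<in>cvec B. meval M (msubst \<psi> c) \<noteq> 0"
  proof -
    define \<Gamma> where "\<Gamma> = {\<gamma>. \<exists>v\<in>cvec B. \<forall>t. \<forall>s\<in>B. \<gamma> t s = meval (\<lambda>b. m0 b + t * v b) (\<psi> s)}"
    define y0 where "y0 s = (if s \<in> B then meval m0 (\<psi> s) else 0)" for s
    have "\<exists>\<gamma>\<in>\<Gamma>. \<exists>t. meval (\<gamma> t) c \<noteq> 0"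
    proof (rule nonvanishing_along_curve[OF c(2), of \<Gamma> y0])
      fix w :: "nat \<times> nat \<Rightarrow> complex"
      have "\<exists>v. \<forall>s\<in>B. (\<Sum>b\<in>B. \<rho> s (snd b) * meval (\<rho> s) (mpartial (fst b) f) * v b) = w s"
        by (rule square_system_solvable[OF finB]) (rule jac)
      then obtain v' where v': "\<forall>s\<in>B. (\<Sum>b\<in>B. \<rho> s (snd b) * meval (\<rho> s) (mpartial (fst b) f) * v' b) = w s"
        by blast
      define v where "v b = (if b \<in> B then v' b else 0)" for b
      \<comment> \<open>Coordinates outside \<open>B\<close> are filled in linearly, since the
        criterion prescribes derivatives in all coordinates; \<open>c\<close> does not involve
        them.\<close>
      define \<gamma> where "\<gamma> t s = (if s \<in> B then meval (\<lambda>b. m0 b + t * v b) (\<psi> s) else t * w s)" for t s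
      have "v \<in> cvec B" by (simp add: v_def cvec_def)
      then have "\<gamma> \<in> \<Gamma>"
        unfolding \<Gamma>_def mem_Collect_eq by (intro bexI[of _ v] allI ballI) (simp_all add: \<gamma>_def)
      moreover have "\<gamma> 0 s = y0 s" for s by (simp add: \<gamma>_def y0_def)
      moreover have "((\<lambda>t. \<gamma> t s) has_field_derivative w s) (at 0)" for s
      proof (cases "s \<in> B")
        case True
        have "((\<lambda>t. meval (\<lambda>i. \<rho> s i + t * L v (\<rho> s) i) f) has_field_derivative
            (\<Sum>i\<in>{..n}. L v (\<rho> s) i * meval (\<lambda>i. \<rho> s i + 0 * L v (\<rho> s) i) (mpartial i f))) (at 0)"
          by (rule meval_has_derivative[OF f]) (auto intro!: derivative_eq_intros)
        moreover have "meval (\<lambda>i. \<rho> s i + t * L v (\<rho> s) i) f = \<gamma> t s" for t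
          using True by (simp add: \<gamma>_def \<psi> Ladd Lm0 \<rho>)
        moreover have "(\<Sum>i\<in>{..n}. L v (\<rho> s) i * meval (\<lambda>i. \<rho> s i + 0 * L v (\<rho> s) i) (mpartial i f)) =
            (\<Sum>b\<in>B. \<rho> s (snd b) * meval (\<rho> s) (mpartial (fst b) f) * v b)"
          unfolding B_def L_def lin_map_def
          by (simp add: sum_distrib_left sum_distrib_right mult_ac sum.cartesian_product case_prod_beta)
        moreover have "\<dots> = w s" using v' True by (simp add: v_def)
        ultimately show ?thesis by simp
      next
        case False
        then show ?thesis by (auto simp: \<gamma>_def intro!: derivative_eq_intros)
      qed
      ultimately show "\<exists>\<gamma>\<in>\<Gamma>. \<forall>s. \<gamma> 0 s = y0 s \<and> ((\<lambda>t. \<gamma> t s) has_field_derivative w s) (at 0)"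
        by blast
    qed
    then obtain \<gamma> t v where v: "v \<in> cvec B" "\<forall>t. \<forall>s\<in>B. \<gamma> t s = meval (\<lambda>b. m0 b + t * v b) (\<psi> s)"
      and nz: "meval (\<gamma> t) c \<noteq> 0" unfolding \<Gamma>_def by blast
    have "meval (\<lambda>b. m0 b + t * v b) (msubst \<psi> c) = meval (\<gamma> t) c"
      unfolding meval_msubst by (rule meval_cong[OF c(1)]) (simp add: v(2))
    moreover have "(\<lambda>b. m0 b + t * v b) \<in> cvec B" using m0 v(1) by (simp add: cvec_def)
    ultimately show ?thesis using nz by metis
  qed
  then obtain Mc where Mc: "Mc \<in> cvec B" "meval Mc (msubst \<psi> c) \<noteq> 0" by blast

  \<comment> \<open>Smoothness of the pulled back form becomes the condition
    \<open>msubst P F\<close> on the matrix. It holds at \<open>m0\<close>, so it can be met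
    together with the nonvanishing of \<open>c\<close>.\<close>
  obtain P where P: "\<And>\<mu> M. lookup (lin_pullback I (\<lambda>i j. M (i, j)) f) \<mu> = meval M (P \<mu>)"
    using polynomial_family_lin_pullback[of I f] unfolding polynomial_family_def by metis
  have evP: "meval M (msubst P F) = meval (lookup (lin_pullback I (\<lambda>i j. M (i, j)) f)) F" for M
    by (simp add: meval_msubst flip: P)
  have "meval m0 (msubst P F) \<noteq> 0"
  proof -
    have "lin_pullback I (\<lambda>i j. m0 (i, j)) f = (\<Sum>m\<in>monomials I d. single m (lookup f m))" (is "_ = ?g")
    proof (rule forms_eqI)
      show "lin_pullback I (\<lambda>i j. m0 (i, j)) f \<in> forms I d" by (rule lin_pullback_forms[OF f])
      show "?g \<in> forms I d" by (intro forms_sum forms_single)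
      show "meval y (lin_pullback I (\<lambda>i j. m0 (i, j)) f) = meval y ?g" if "y \<in> cvec I" for y
        using that Lm0[OF that] restrict_to_coordinate_hyperplane[OF f that[unfolded I_def]]
        by (simp add: meval_lin_pullback L_def I_def)
    qed
    then have "meval m0 (msubst P F) = meval (lookup f) F"
      unfolding evP using finite_monomials[OF finI, of d]
      by (intro meval_cong[OF F(1)]) (simp add: lookup_sum_single)
    then show ?thesis using F(2) by simp
  qed
  then obtain M1 where M1: "M1 \<in> cvec B" "meval M1 (msubst \<psi> c) \<noteq> 0" "meval M1 (msubst P F) \<noteq> 0"
    using common_nonvanishing[OF Mc m0] by blast
  define g1 where "g1 = lin_pullback I (\<lambda>i j. M1 (i, j)) f"
  have g1: "g1 \<in> smooth_forms I d"
    using M1(3) unfolding evP g1_def by (intro smooth lin_pullback_forms[OF f])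

  define ch where "ch H = lin_map I (hyperplane_chart n H)" for H
  have ch: "bij_betw (ch H) (cvec I) (hyperplane n H)" if "H \<in> proj_space {..n}" for H
    using hyperplane_chart_bij[OF that] by (simp add: ch_def I_def)
  define sec where "sec = hyperplane_section n f"
  have sec: "sec H \<in> forms I d" "meval y (sec H) = meval (ch H y) f" for H y
    using lin_pullback_forms[OF f, of I] by (simp_all add: sec_def hyperplane_section_def I_def ch_def meval_lin_pullback)
  define U where "U = smooth_sections n d f"
  have U: "H \<in> U \<longleftrightarrow> H \<in> proj_space {..n} \<and> sec H \<in> smooth_forms I d" for H
    by (simp add: U_def smooth_sections_def sec_def I_def)
  define \<phi> where "\<phi> = hyperplane_section_map n f"
  have \<phi>: "\<phi> H = pgl_orbit I (form_point (sec H))" for H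
    by (simp add: \<phi>_def hyperplane_section_map_def sec_def I_def)
  \<comment> \<open>Nonvanishing of \<open>c\<close> on the values of \<open>g\<close> at the points
    \<open>\<rho> s\<close> is not invariant under \<open>GL\<close>; requiring it for some
    translate is.\<close>
  define good where "good A g \<longleftrightarrow> meval (\<lambda>s. meval (lin_map I A (\<rho> s)) g) c \<noteq> 0"
    for A and g :: "nat mpoly"
  define V where "V = {pgl_orbit I (form_point g) | g. g \<in> smooth_forms I d \<and> (\<exists>A\<in>GL I. good A g)}"

  have "openin (moduli I d) V"
  proof -
    let ?K = "monomials I d"
    \<comment> \<open>Evaluation at \<open>y\<close> as a linear form in the coefficients of
      \<open>g\<close>, which makes \<open>good A\<close> a polynomial condition on them.\<close>
    define ev where "ev y = (\<Sum>\<mu>\<in>?K. single (single \<mu> (1::nat)) (mpow y \<mu>))" for y :: "nat \<Rightarrow> complex"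
    define FA where "FA A = msubst (\<lambda>s. ev (lin_map I A (\<rho> s))) c" for A
    have FA: "FA A \<in> forms ?K e" for A
    proof -
      have "ev y \<in> forms ?K 1" for y unfolding ev_def by (intro forms_sum forms_single monomials_single)
      then show ?thesis using forms_msubst[OF c(1), of _ ?K 1] by (simp add: FA_def)
    qed
    have evFA: "meval (lookup g) (FA A) \<noteq> 0 \<longleftrightarrow> good A g" if "g \<in> forms I d" for g A
      unfolding FA_def meval_msubst good_def
      by (simp add: ev_def meval_forms[OF that finI] mult.commute)
    define T where "T = (\<Union>A\<in>GL I. {p \<in> proj_space ?K. \<exists>x\<in>p. meval x (FA A) \<noteq> 0})"
    have "openin (zariski ?K) T"
      unfolding T_def by (intro openin_Union) (auto intro: nonvanishing_open[OF FA])
    moreover have "{p \<in> proj_space ?K \<inter> smooth_locus I d. pgl_orbit I p \<in> V} = T \<inter> smooth_locus I d"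
    proof (intro subset_antisym subsetI)
      fix p assume "p \<in> {p \<in> proj_space ?K \<inter> smooth_locus I d. pgl_orbit I p \<in> V}"
      then have p: "p \<in> proj_space ?K" "p \<in> smooth_locus I d" "pgl_orbit I p \<in> V" by auto
      obtain g where g: "p = form_point g" "g \<in> smooth_forms I d" using p(2) by (auto simp: smooth_locus_def)
      obtain g' A where g': "pgl_orbit I p = pgl_orbit I (form_point g')" "g' \<in> smooth_forms I d"
        "A \<in> GL I" "good A g'" using p(3) by (auto simp: V_def)
      have gf: "g \<in> forms I d" "g' \<in> forms I d" "g' \<noteq> 0" using g g' by (auto simp: smooth_forms_def)
      obtain A' k where A': "A' \<in> GL I" "\<And>x. meval x g' = k * meval (lin_map I A' x) g"
        using pgl_orbit_eqD[OF finI gf(2,3), of g] g'(1) g(1) by auto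
      \<comment> \<open>A change of representative changes the translate by composition; the scalar
        factors out because \<open>c\<close> is homogeneous.\<close>
      define C where "C i j = (\<Sum>l\<in>I. A' i l * A l j)" for i j
      have C: "C \<in> GL I" unfolding C_def by (rule GL_compose[OF finI A'(1) g'(3)])
      have "meval (\<lambda>s. meval (lin_map I A (\<rho> s)) g') c = k ^ e * meval (\<lambda>s. meval (lin_map I C (\<rho> s)) g) c"
        by (simp add: A'(2) lin_map_compose C_def[abs_def] meval_scale[OF c(1)])
      then have "good C g" using g'(4) by (auto simp: good_def)
      then have "p \<in> {p \<in> proj_space ?K. \<exists>x\<in>p. meval x (FA C) \<noteq> 0}"
        using p(1) evFA[OF gf(1)] nonvanishing_form_point[OF FA] by (simp add: g(1))
      then show "p \<in> T \<inter> smooth_locus I d" using C p(2) by (auto simp: T_def)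
    next
      fix p assume p: "p \<in> T \<inter> smooth_locus I d"
      then obtain g where g: "p = form_point g" "g \<in> smooth_forms I d" by (auto simp: smooth_locus_def)
      obtain A where A: "A \<in> GL I" "\<exists>x\<in>p. meval x (FA A) \<noteq> 0" using p by (auto simp: T_def)
      have "g \<in> forms I d" using g by (simp add: smooth_forms_def)
      then have "good A g" using A(2) nonvanishing_form_point[OF FA] evFA by (simp add: g(1))
      then have "pgl_orbit I p \<in> V" using A(1) g by (auto simp: V_def)
      then show "p \<in> {p \<in> proj_space ?K \<inter> smooth_locus I d. pgl_orbit I p \<in> V}"
        using p smooth_locus_proj by auto
    qed
    ultimately have op: "openin (subtopology (zariski ?K) (smooth_locus I d))
        {p \<in> proj_space ?K \<inter> smooth_locus I d. pgl_orbit I p \<in> V}"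
      unfolding openin_subtopology by blast
    have "V \<subseteq> pgl_orbit I ` (proj_space ?K \<inter> smooth_locus I d)"
      using smooth_locus_proj by (fastforce simp: V_def smooth_locus_def)
    then show ?thesis using op
      unfolding moduli_def openin_quotient_top by (simp add: topspace_zariski)
  qed
  then have "openin (subtopology (moduli I d) (\<phi> ` U)) (V \<inter> \<phi> ` U)"
    by (rule openin_subtopology_Int)

  moreover have "V \<inter> \<phi> ` U \<noteq> {}"
  proof -
    \<comment> \<open>A hyperplane containing the image of \<open>M1\<close>. Smoothness of
      \<open>g1\<close> makes \<open>M1\<close> injective, so \<open>M1\<close> differs from the
      chart of \<open>H\<close> by some \<open>T\<close> in \<open>GL\<close>, and the section
      inherits smoothness and the condition on \<open>c\<close>.\<close>
    obtain H where H: "H \<in> proj_space {..n}"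
      "\<And>x. x \<in> cvec {..n} \<Longrightarrow> (\<exists>y. x = L M1 y) \<Longrightarrow> x \<in> hyperplane n H"
      using image_in_hyperplane[of n "\<lambda>i j. M1 (i, j)"] unfolding L_def I_def by blast
    have Lc: "L M1 y \<in> cvec {..n}" for y
      using M1(1) by (auto simp: L_def lin_map_def cvec_def B_def)
    have "\<exists>T\<in>GL I. \<forall>y\<in>cvec I. lin_map I (\<lambda>i j. M1 (i, j)) y = lin_map I (hyperplane_chart n H) (lin_map I T y)"
    proof (rule lin_map_factor[OF finI])
      show "bij_betw (lin_map I (hyperplane_chart n H)) (cvec I) (hyperplane n H)"
        using ch[OF H(1)] by (simp add: ch_def)
      show "lin_map I (\<lambda>i j. M1 (i, j)) y \<in> hyperplane n H" for y
        using H(2)[OF Lc[of y]] by (auto simp: L_def)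
      show "y = (\<lambda>_. 0)" if "y \<in> cvec I" "lin_map I (\<lambda>i j. M1 (i, j)) y = (\<lambda>_. 0)" for y
        using smooth_imp_injective[OF finI f d g1[unfolded g1_def] that(1)] that(2) by simp
    qed
    then obtain T where T: "T \<in> GL I" "\<And>y. y \<in> cvec I \<Longrightarrow> L M1 y = ch H (lin_map I T y)"
      unfolding L_def ch_def by blast
    obtain T' where T': "T' \<in> GL I" "\<And>y. y \<in> cvec I \<Longrightarrow> lin_map I T (lin_map I T' y) = y"
      using GL_inverse[OF finI T(1)] by blast
    have "sec H = lin_pullback I T' g1"
    proof (rule forms_eqI[OF sec(1)])
      show "lin_pullback I T' g1 \<in> forms I d"
        using g1 by (intro lin_pullback_forms[of _ I]) (simp add: smooth_forms_def)
      show "meval y (sec H) = meval y (lin_pullback I T' g1)" if "y \<in> cvec I" for y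
        using T(2)[OF GL_mem[OF T'(1) that]] T'(2)[OF that]
        by (simp add: sec(2) g1_def meval_lin_pullback L_def)
    qed
    then have sm: "sec H \<in> smooth_forms I d" using smooth_pullback[OF finI T'(1) g1] by simp
    have "meval (\<lambda>s. meval (lin_map I T (\<rho> s)) (sec H)) c = meval M1 (msubst \<psi> c)"
      unfolding meval_msubst by (rule meval_cong[OF c(1)]) (simp add: sec(2) \<psi> T(2) \<rho>)
    then have "good T (sec H)" using M1(2) by (simp add: good_def)
    then have "\<phi> H \<in> V" using T(1) sm by (auto simp: V_def \<phi>)
    moreover have "H \<in> U" using H(1) sm by (simp add: U)
    ultimately show ?thesis by blast
  qed

  moreover have "finite {H \<in> U. \<phi> H = y}" if y: "y \<in> V \<inter> \<phi> ` U" for y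
  proof -
    obtain g A where g: "y = pgl_orbit I (form_point g)" "g \<in> smooth_forms I d" "A \<in> GL I" "good A g"
      using y by (auto simp: V_def)
    define \<M> where "\<M> = {M \<in> cvec B. \<forall>s\<in>B. meval M (\<psi> s) = meval (lin_map I A (\<rho> s)) g}"
    have "finite \<M>" unfolding \<M>_def using g(4) by (intro fin) (simp add: good_def)
    have gf: "g \<in> forms I d" "g \<noteq> 0" using g(2) by (auto simp: smooth_forms_def)
    \<comment> \<open>The chart of \<open>H\<close> is composed with \<open>r\<close> times the
      matrices \<open>A'\<close> and \<open>A\<close>, where \<open>r ^ d = k\<close>. The resulting
      \<open>M\<close> gives \<open>f\<close> at the points \<open>\<rho> s\<close> the values
      prescribed by \<open>g\<close> and \<open>A\<close>, and still has the whole hyperplane as its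
      image.\<close>
    have "hyperplane n H \<in> (\<lambda>M. L M ` cvec I) ` \<M>" if H: "H \<in> U" "\<phi> H = y" for H
    proof -
      have Hp: "H \<in> proj_space {..n}" using H by (simp add: U)
      obtain A' k where A': "A' \<in> GL I" "k \<noteq> 0" "\<And>x. meval x g = k * meval (lin_map I A' x) (sec H)"
        using pgl_orbit_eqD[OF finI gf, of "sec H"] H(2) g(1) by (auto simp: \<phi>)
      obtain r where r: "r ^ d = k" using d by (metis exists_complex_root not_numeral_le_zero)
      have r0: "r \<noteq> 0" using r A'(2) d by auto
      define C where "C i j = r * (\<Sum>l\<in>I. A' i l * A l j)" for i j
      have C: "C \<in> GL I" unfolding C_def by (intro GL_scale[OF finI] GL_compose[OF finI] A' g(3) r0)
      have Cv: "lin_map I C x = (\<lambda>i. r * lin_map I A' (lin_map I A x) i)" for x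
        unfolding C_def lin_map_scale_matrix lin_map_compose ..
      define M where "M b = (if b \<in> B then \<Sum>l\<in>I. hyperplane_chart n H (fst b) l * C l (snd b) else 0)" for b
      have LM: "L M x = ch H (lin_map I C x)" if x: "x \<in> cvec I" for x
      proof
        fix i
        show "L M x i = ch H (lin_map I C x) i"
        proof (cases "i \<le> n")
          case True
          then show ?thesis unfolding L_def ch_def lin_map_compose
            by (simp add: lin_map_def M_def B_def)
        next
          case False
          have "ch H (lin_map I C x) \<in> hyperplane n H"
            using bij_betwE[OF ch[OF Hp]] GL_mem[OF C x] by blast
          then show ?thesis using False by (simp add: hyperplane_def cvec_def L_def lin_map_def M_def B_def)
        qed
      qed
      have "meval M (\<psi> s) = meval (lin_map I A (\<rho> s)) g" if s: "s \<in> B" for s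
      proof -
        have "meval M (\<psi> s) = meval (lin_map I C (\<rho> s)) (sec H)"
          by (simp add: \<psi> LM \<rho>[OF s] sec(2))
        also have "\<dots> = k * meval (lin_map I A' (lin_map I A (\<rho> s))) (sec H)"
          unfolding Cv by (simp add: meval_scale[OF sec(1)] r)
        finally show ?thesis by (simp add: A'(3))
      qed
      moreover have "M \<in> cvec B" by (simp add: M_def cvec_def)
      ultimately have "M \<in> \<M>" by (simp add: \<M>_def)
      have "L M ` cvec I = ch H ` lin_map I C ` cvec I"
        using LM by (force simp: image_image)
      also have "\<dots> = hyperplane n H"
        using C ch[OF Hp] by (simp add: GL_def bij_betw_def)
      finally show ?thesis using \<open>M \<in> \<M>\<close> by (intro image_eqI[of _ _ M]) simp_all
    qed
    then have "hyperplane n ` {H \<in> U. \<phi> H = y} \<subseteq> (\<lambda>M. L M ` cvec I) ` \<M>" by blast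
    then have "finite (hyperplane n ` {H \<in> U. \<phi> H = y})"
      using \<open>finite \<M>\<close> by (rule finite_subset[OF _ finite_imageI])
    moreover have "inj_on (hyperplane n) {H \<in> U. \<phi> H = y}"
      using hyperplane_inj by (rule inj_on_subset) (auto simp: U)
    ultimately show ?thesis by (rule finite_imageD)
  qed
  ultimately show ?thesis
    unfolding generically_finite_onto_image_def U_def \<phi>_def I_def by blast
qed

theorem corollary6p6:
  fixes n d :: nat
  assumes "(d = 3 \<and> n \<ge> 5) \<or> (d \<ge> 4 \<and> n \<ge> 3)"
  shows "\<exists>G. openin (zariski (monomials {..n} d)) G \<and> G \<noteq> {} \<and> G \<subseteq> smooth_locus {..n} d \<and>
    (\<forall>f\<in>forms {..n} d. form_point f \<in> G \<longrightarrow>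
       generically_finite_onto_image (smooth_sections n d f) (moduli {1..n} d) (hyperplane_section_map n f))"
proof -
  have n: "n \<ge> 1" and d: "d \<ge> 2" using assms by auto
  let ?I = "{..n}" and ?J = "{1..n}"
  let ?K = "monomials ?I d" and ?B = "?I \<times> ?J"
  have finK: "finite ?K" and finB: "finite ?B" by (simp_all add: finite_monomials)
  have KK: "monomials ?J d \<subseteq> ?K" by (rule monomials_mono) auto
  have lookup_cvec: "lookup g \<in> cvec ?K" if "g \<in> forms ?I d" for g
    using that by (auto simp: cvec_def forms_def subset_iff in_keys_iff)
  obtain F1 e1 where F1: "F1 \<in> forms ?K e1" "meval (lookup (fermat ?I d)) F1 \<noteq> 0"
    "\<And>f. f \<in> forms ?I d \<Longrightarrow> meval (lookup f) F1 \<noteq> 0 \<Longrightarrow> f \<in> smooth_forms ?I d"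
    using smooth_certificate[of ?I d] d by auto
  \<comment> \<open>The smoothness condition for the single section \<open>x_0 = 0\<close>; it is
    later read as a condition on all coefficients of \<open>f\<close>.\<close>
  obtain F2 e2 where F2: "F2 \<in> forms (monomials ?J d) e2" "meval (lookup (fermat ?J d)) F2 \<noteq> 0"
    "\<And>f. f \<in> forms ?J d \<Longrightarrow> meval (lookup f) F2 \<noteq> 0 \<Longrightarrow> f \<in> smooth_forms ?J d"
    using smooth_certificate[of ?J d] d n by auto
  obtain f0 where f0: "f0 \<in> forms ?I d"
    "\<And>v. \<forall>y\<in>cvec ?J. (\<Sum>i\<le>n. \<Sum>j\<in>?J. y j * meval y (mpartial i f0) * v (i, j)) = 0 \<Longrightarrow> \<forall>b\<in>?B. v b = 0"
    using no_linear_syzygies[OF assms] by blast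
  \<comment> \<open>The derivative of \<open>f\<close> after \<open>M\<close> at \<open>y\<close>
    with respect to the entry \<open>b\<close> of \<open>M\<close>, at the inclusion of
    \<open>x_0 = 0\<close>, as a linear form in the coefficients of \<open>f\<close>.\<close>
  define a where "a y b = (\<Sum>k\<in>?K. single (single k (1::nat))
      (y (snd b) * (of_nat (lookup k (fst b)) * mpow y (k - single (fst b) 1))))" for y :: "nat \<Rightarrow> complex" and b
  have a_forms: "a y b \<in> forms ?K 1" for y b
    unfolding a_def by (intro forms_sum forms_single monomials_single)
  have a: "meval (lookup f) (a y b) = y (snd b) * meval y (mpartial (fst b) f)" if "f \<in> forms ?I d" for f y b
    by (simp add: a_def meval_mpartial_forms[OF that] sum_distrib_left mult_ac)
  \<comment> \<open>The rows are all points of the hyperplane. The elimination at \<open>f0\<close>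
    selects finitely many of them, and this selection \<open>\<rho>\<close> then serves every
    \<open>f\<close> at which \<open>F\<close> does not vanish.\<close>
  have "\<exists>F e \<rho>. F \<in> forms ?K e \<and> \<rho> ` ?B \<subseteq> cvec ?J \<and> meval (lookup f0) F \<noteq> 0 \<and>
    (\<forall>x z. meval x F \<noteq> 0 \<longrightarrow> (\<forall>s\<in>?B. (\<Sum>b\<in>?B. meval x (a (\<rho> s) b) * z b) = 0) \<longrightarrow> (\<forall>b\<in>?B. z b = 0))"
  proof (rule open_nonsingular[OF finB a_forms])
    fix z assume z: "\<forall>y\<in>cvec ?J. (\<Sum>b\<in>?B. meval (lookup f0) (a y b) * z b) = 0"
    show "\<forall>b\<in>?B. z b = 0"
      using z by (intro f0(2)) (simp add: a[OF f0(1)] sum.cartesian_product case_prod_beta)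
  qed
  then obtain F3 e3 \<rho> where "F3 \<in> forms ?K e3 \<and> \<rho> ` ?B \<subseteq> cvec ?J \<and> meval (lookup f0) F3 \<noteq> 0 \<and>
    (\<forall>x z. meval x F3 \<noteq> 0 \<longrightarrow> (\<forall>s\<in>?B. (\<Sum>b\<in>?B. meval x (a (\<rho> s) b) * z b) = 0) \<longrightarrow> (\<forall>b\<in>?B. z b = 0))"
    by (elim exE)
  then have F3: "F3 \<in> forms ?K e3" "\<And>s. s \<in> ?B \<Longrightarrow> \<rho> s \<in> cvec ?J" "meval (lookup f0) F3 \<noteq> 0"
    "\<And>x z. meval x F3 \<noteq> 0 \<Longrightarrow> \<forall>s\<in>?B. (\<Sum>b\<in>?B. meval x (a (\<rho> s) b) * z b) = 0 \<Longrightarrow> \<forall>b\<in>?B. z b = 0"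
    by blast+
  define F where "F = F1 * F2 * F3"
  have F: "F \<in> forms ?K (e1 + e2 + e3)"
    unfolding F_def by (intro forms_mult F1(1) F3(1) forms_mono[OF KK F2(1)])
  define G where "G = {p \<in> proj_space ?K. \<exists>x\<in>p. meval x F \<noteq> 0}"
  have form_of: "\<exists>g\<in>forms ?I d. lookup g = x" if "x \<in> cvec ?K" for x
  proof (rule bexI[of _ "\<Sum>k\<in>?K. single k (x k)"])
    show "lookup (\<Sum>k\<in>?K. single k (x k)) = x"
      using that finK by (auto simp: lookup_sum_single cvec_def fun_eq_iff)
  qed (intro forms_sum forms_single)
  have "G \<noteq> {}"
  proof -
    \<comment> \<open>The Fermat form in \<open>x_1, ..., x_n\<close> is a witness for
      \<open>F2\<close> only; combining the three separate witnesses yields one form for all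
      conditions.\<close>
    have J: "fermat ?J d \<in> forms ?I d" using fermat_forms by (rule forms_mono[rotated]) auto
    obtain x where x: "x \<in> cvec ?K" "meval x F1 \<noteq> 0 \<and> meval x F2 \<noteq> 0"
      using common_nonvanishing[OF lookup_cvec[OF fermat_forms] F1(2) lookup_cvec[OF J] F2(2)] by blast
    then have "meval x (F1 * F2) \<noteq> 0" by simp
    then obtain u where u: "u \<in> cvec ?K" "meval u (F1 * F2) \<noteq> 0" "meval u F3 \<noteq> 0"
      using common_nonvanishing[OF x(1) _ lookup_cvec[OF f0(1)] F3(3)] by blast
    obtain g where g: "g \<in> forms ?I d" "lookup g = u" using form_of[OF u(1)] by blast
    have Fg: "meval (lookup g) F \<noteq> 0" using u g by (simp add: F_def)
    then have "g \<noteq> 0" using F1(3)[OF g(1)] by (auto simp: F_def smooth_forms_def)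
    then have "form_point g \<in> G"
      using Fg form_point_proj[OF g(1)] nonvanishing_form_point[OF F] by (simp add: G_def)
    then show ?thesis by blast
  qed
  moreover have "G \<subseteq> smooth_locus ?I d"
  proof
    fix p assume p: "p \<in> G"
    then obtain x where x: "p = pline x" "x \<in> cvec ?K" by (auto simp: G_def proj_space_def)
    obtain g where g: "g \<in> forms ?I d" "lookup g = x" using form_of[OF x(2)] by blast
    have pg: "p = form_point g" by (simp add: form_point_def g x)
    then have "meval (lookup g) F \<noteq> 0" using p nonvanishing_form_point[OF F] by (simp add: G_def)
    then have "g \<in> smooth_forms ?I d" using F1(3)[OF g(1)] by (auto simp: F_def)
    then show "p \<in> smooth_locus ?I d" by (auto simp: smooth_locus_def pg)
  qed
  moreover have "openin (zariski ?K) G" unfolding G_def by (rule nonvanishing_open[OF F])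
  moreover have "generically_finite_onto_image (smooth_sections n d f) (moduli ?J d) (hyperplane_section_map n f)"
    if f: "f \<in> forms ?I d" and fG: "form_point f \<in> G" for f
  proof (rule generically_finite_criterion[OF n d f F3(2) _ F2(1) _ F2(3)])
    have "meval (lookup f) F \<noteq> 0" using fG nonvanishing_form_point[OF F] by (simp add: G_def)
    then have nz: "meval (lookup f) F2 \<noteq> 0" "meval (lookup f) F3 \<noteq> 0" by (auto simp: F_def)
    show "meval (lookup f) F2 \<noteq> 0" by (fact nz)
    fix z assume "\<forall>s\<in>?B. (\<Sum>b\<in>?B. \<rho> s (snd b) * meval (\<rho> s) (mpartial (fst b) f) * z b) = 0"
    then have "\<forall>s\<in>?B. (\<Sum>b\<in>?B. meval (lookup f) (a (\<rho> s) b) * z b) = 0" by (simp add: a[OF f])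
    then show "\<forall>b\<in>?B. z b = 0" by (rule F3(4)[OF nz(2)])
  qed
  ultimately show ?thesis by blast
qed

end
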